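(* Let $B_1\subset\mathbb{R}^N$ be the unit ball, $\lambda_0:B_1\to(0,\infty)$ a function bounded away from zero and from infinity, $g:\partial B_1\to\mathbb{R}$ Lipschitz, and let $u_\infty$ be a uniform limit, along some sequence $p\to\infty$, of weak solutions $u_p$ to $$-\Delta_p u_p+\lambda_0(x)\chi_{\{u_p>0\}}(x)=0\ \text{ in }B_1,\qquad u_p=g\ \text{ on }\partial B_1.$$ Let $x_0\in\partial\{u_\infty>0\}\cap B_{1/2}$ be a free boundary point. Then for any $0<\rho<\frac12$, $$\mathcal{L}^N\big(B_\rho(x_0)\cap\{u_\infty>0\}\big)\ge\theta\rho^N,$$ for a universal constant $\theta>0$ (depending only on $N$ and the Lipschitz constant of $g$).
   Context: $\Delta_p u=\operatorname{div}(|\nabla u|^{p-2}\nabla u)$; $\mathcal{L}^N$ is Lebesgue measure; $B_r$ is the ball of radius $r$ centred at the origin. A weak solution $u_p\in W^{1,p}(B_1)$ satisfies $\int|\nabla u_p|^{p-2}\nabla u_p\cdot\nabla\varphi\,dx=-\int\lambda_0\chi_{\{u_p>0\}}\varphi\,dx$ for all $\varphi\in C^1_0(B_1)$ and takes the boundary value $g$. *)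

theory Defs
  imports "HOL-Analysis.Analysis"
begin

definition gradient :: "('a::euclidean_space \<Rightarrow> real) \<Rightarrow> 'a \<Rightarrow> 'a" where
  "gradient f x = (THE D. GDERIV f x :> D)"

text \<open>Elements of \<open>C1_0 \<Omega>\<close> are extended by zero to the whole space, so that
  being continuously differentiable with compact support in the open set \<open>\<Omega>\<close> can be
  expressed on \<open>UNIV\<close>.\<close>

definition C1_0 :: "'a::euclidean_space set \<Rightarrow> ('a \<Rightarrow> real) set" where
  "C1_0 \<Omega> = {\<phi>. (\<forall>x. \<phi> differentiable (at x)) \<and> continuous_on UNIV (gradient \<phi>) \<and>
                  compact (closure {x. \<phi> x \<noteq> 0}) \<and> closure {x. \<phi> x \<noteq> 0} \<subseteq> \<Omega>}"

definition Lp :: "real \<Rightarrow> 'a::euclidean_space set \<Rightarrow> ('a \<Rightarrow> 'b::euclidean_space) set" where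
  "Lp p \<Omega> = {f. f \<in> borel_measurable (lebesgue_on \<Omega>) \<and>
                 integrable (lebesgue_on \<Omega>) (\<lambda>x. norm (f x) powr p)}"

definition weak_gradient ::
    "'a::euclidean_space set \<Rightarrow> ('a \<Rightarrow> real) \<Rightarrow> ('a \<Rightarrow> 'a) \<Rightarrow> bool" where
  "weak_gradient \<Omega> u Du \<longleftrightarrow>
     (\<forall>\<phi>\<in>C1_0 \<Omega>. (LINT x|lebesgue_on \<Omega>. u x *\<^sub>R gradient \<phi> x)
                  = - (LINT x|lebesgue_on \<Omega>. \<phi> x *\<^sub>R Du x))"

text \<open>\<open>W1p p \<Omega> u Du\<close>: the function \<open>u\<close> belongs to the Sobolev space of exponent \<open>p\<close> on
  \<open>\<Omega>\<close>, and \<open>Du\<close> is a representative of its weak gradient (unique up to null sets).\<close>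

definition W1p ::
    "real \<Rightarrow> 'a::euclidean_space set \<Rightarrow> ('a \<Rightarrow> real) \<Rightarrow> ('a \<Rightarrow> 'a) \<Rightarrow> bool" where
  "W1p p \<Omega> u Du \<longleftrightarrow> u \<in> Lp p \<Omega> \<and> Du \<in> Lp p \<Omega> \<and> weak_gradient \<Omega> u Du"

text \<open>The closure of \<open>C1_0 \<Omega>\<close> in the Sobolev norm.\<close>

definition W1p_0 :: "real \<Rightarrow> 'a::euclidean_space set \<Rightarrow> ('a \<Rightarrow> real) set" where
  "W1p_0 p \<Omega> = {v. \<exists>Dv. W1p p \<Omega> v Dv \<and>
     (\<exists>\<phi>::nat \<Rightarrow> 'a \<Rightarrow> real. (\<forall>k. \<phi> k \<in> C1_0 \<Omega>) \<and>
        (\<lambda>k. LINT x|lebesgue_on \<Omega>. \<bar>v x - \<phi> k x\<bar> powr p) \<longlonglongrightarrow> 0 \<and>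
        (\<lambda>k. LINT x|lebesgue_on \<Omega>. norm (Dv x - gradient (\<phi> k) x) powr p) \<longlonglongrightarrow> 0)}"

text \<open>Lipschitz boundary data are attained in the Sobolev sense: \<open>u\<close> minus a Lipschitz
  extension of \<open>g\<close> lies in \<open>W1p_0\<close>. The choice of the extension is immaterial, and its
  Lipschitz constant is not prescribed.\<close>

definition boundary_value ::
    "real \<Rightarrow> 'a::euclidean_space set \<Rightarrow> ('a \<Rightarrow> real) \<Rightarrow> ('a \<Rightarrow> real) \<Rightarrow> bool" where
  "boundary_value p \<Omega> u g \<longleftrightarrow>
     (\<exists>G K. K-lipschitz_on (closure \<Omega>) G \<and> (\<forall>x\<in>frontier \<Omega>. G x = g x) \<and>
            (\<lambda>x. u x - G x) \<in> W1p_0 p \<Omega>)"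

text \<open>Weak solutions of \<open>- \<Delta>\<^sub>p u + \<lambda> \<chi>{u > 0} = 0\<close> in \<open>\<Omega>\<close> with \<open>u = g\<close> on the boundary.
  Elements of the Sobolev space are classes modulo null sets; as usual, a solution is
  identified with its continuous representative, to which pointwise statements
  (uniform limits, positivity sets) refer.\<close>

definition weak_solution ::
    "real \<Rightarrow> 'a::euclidean_space set \<Rightarrow> ('a \<Rightarrow> real) \<Rightarrow> ('a \<Rightarrow> real) \<Rightarrow> ('a \<Rightarrow> real) \<Rightarrow> bool" where
  "weak_solution p \<Omega> lam g u \<longleftrightarrow>
     continuous_on \<Omega> u \<and> boundary_value p \<Omega> u g \<and>
     (\<exists>Du. W1p p \<Omega> u Du \<and>
       (\<forall>\<phi>\<in>C1_0 \<Omega>.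
          (LINT x|lebesgue_on \<Omega>. (norm (Du x) powr (p - 2) *\<^sub>R Du x) \<bullet> gradient \<phi> x)
          = - (LINT x|lebesgue_on \<Omega>. lam x * indicat_real {y. u y > 0} x * \<phi> x)))"

end

theory Submission
  imports Defs
begin

text \<open>
  The estimate combines two bounds on the limit \<open>u\<close>, both independent of \<open>\<lambda>\<^sub>0\<close>.

  Testing the equation with \<open>u\<^sub>p\<close> minus an \<open>L\<close>-Lipschitz extension of \<open>g\<close> gives
  \<open>\<integral>|\<nabla>u\<^sub>p|\<^sup>p \<le> 2 (|B\<^sub>1| (2L)\<^sup>p + D)\<close> with \<open>D\<close> independent of \<open>p\<close>; since
  \<open>|\<nabla>u\<^sub>p| \<le> t + t\<^sup>1\<^sup>-\<^sup>p |\<nabla>u\<^sub>p|\<^sup>p\<close> for every \<open>t > 0\<close>, the choice \<open>t = 2L + 2\<close> bounds the gradients of the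
  mollified \<open>u\<^sub>p\<close> by \<open>2L + 2 + o(1)\<close>, so \<open>u\<close> is \<open>(2L + 2)\<close>-Lipschitz.

  Conversely \<open>u\<close> grows linearly away from the free boundary: with \<open>q = p / (p - 1)\<close> the function
  \<open>|x - y|\<^sup>q / 2\<close> has constant \<open>p\<close>-Laplacian \<open>N (q / 2)\<^sup>p\<^sup>-\<^sup>1\<close>, which tends to zero and hence is
  eventually below the lower bound of \<open>\<lambda>\<^sub>0\<close>. By comparison, every ball of radius \<open>r\<close> around a positivity point
  contains a point with \<open>u \<ge> r / 8\<close>, and the Lipschitz bound turns this point into a ball of positivity
  whose radius is a fixed fraction of \<open>\<rho>\<close>.
\<close>

section \<open>Continuously differentiable functions\<close>

text \<open>The obstacle is that the equation may be tested only with \<open>C1_0\<close> functions,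
  while the energy bound calls for \<open>u - Gt\<close> and the comparison for a truncation of
  \<open>u - v\<close>, both merely of Sobolev type. Both are reached through smooth functions
  \<open>W n = F n + \<theta> n\<close> with \<open>\<theta> n\<close> in \<open>C1_0\<close>,
  gradients of \<open>F n\<close> bounded by \<open>L\<close>, gradients of \<open>W n\<close>
  bounded in L^p, and \<open>W n\<close> tending to \<open>u\<close> in L^1. Their gradients then
  converge weakly against fields of the conjugate exponent p/(p-1), and the flux of the p-Laplacian
  is such a field. The boundary condition supplies an extension of \<open>g\<close> whose Lipschitz
  constant is arbitrary. Its difference to an \<open>L\<close>-Lipschitz extension vanishes on the
  sphere and is moved into \<open>\<theta> n\<close>, so only \<open>L\<close> enters the energy
  bound. The bounds of the coefficient decide only from which index on the estimates take effect;
  they disappear from the limit. This is why the final constant is universal.\<close>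

definition C1 :: "('a::euclidean_space \<Rightarrow> real) \<Rightarrow> bool" where
  "C1 f \<longleftrightarrow> (\<forall>x. GDERIV f x :> gradient f x) \<and> continuous_on UNIV (gradient f)"

lemma gradient_eq:
  assumes "GDERIV f x :> D"
  shows "gradient f x = D"
proof -
  have "E = D" if "GDERIV f x :> E" for E
  proof -
    have "(\<lambda>h. inner h E) = (\<lambda>h. inner h D)"
      using assms that unfolding gderiv_def by (rule has_derivative_unique[rotated])
    then have "\<And>h. inner h E = inner h D" by (rule fun_cong)
    then show ?thesis using vector_eq_ldot[of E D] by (simp add: inner_commute)
  qed
  then show ?thesis
    unfolding gradient_def using assms by (intro the_equality)
qed

text \<open>Since \<open>gradient\<close> is a definite description, its value is known only once a
  derivative has been exhibited; regularity and the formula for the gradient are therefore obtained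
  together.\<close>

lemma C1_conjI:
  assumes "\<And>x. GDERIV f x :> D x" "continuous_on UNIV D"
  shows "C1 f \<and> gradient f = D"
proof -
  have "gradient f = D"
    using gradient_eq[OF assms(1)] by auto
  then show ?thesis
    unfolding C1_def using assms by blast
qed

lemma C1_GDERIV: "C1 f \<Longrightarrow> GDERIV f x :> gradient f x"
  by (simp add: C1_def)

lemma C1_continuous_gradient: "C1 f \<Longrightarrow> continuous_on A (gradient f)"
  using C1_def continuous_on_subset by blast

lemma C1_continuous: "C1 f \<Longrightarrow> continuous_on A f"
  using C1_GDERIV[of f] has_derivative_continuous[of f]
  by (auto simp: gderiv_def intro!: continuous_at_imp_continuous_on)

text \<open>Connects \<open>C1_0\<close>, which is phrased with \<open>differentiable\<close>, to
  \<open>GDERIV\<close>: the values of the derivative on \<open>Basis\<close> are the coordinates of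
  the representing vector.\<close>

lemma GDERIV_differentiable:
  fixes f :: "'a::euclidean_space \<Rightarrow> real"
  assumes "f differentiable (at x)"
  shows "GDERIV f x :> gradient f x"
proof -
  obtain f' where f': "(f has_derivative f') (at x)"
    using assms differentiable_def by blast
  then interpret bounded_linear f' by (rule has_derivative_bounded_linear)
  define D where "D = (\<Sum>b\<in>Basis. f' b *\<^sub>R b)"
  have "f' h = h \<bullet> D" for h
  proof -
    have "f' h = f' (\<Sum>b\<in>Basis. (h \<bullet> b) *\<^sub>R b)" by (simp add: euclidean_representation)
    also have "\<dots> = h \<bullet> D" by (simp add: D_def sum scaleR inner_sum_right mult.commute)
    finally show ?thesis .
  qed
  then have "f' = (\<lambda>h. h \<bullet> D)" by auto
  then have "GDERIV f x :> D" using f' by (simp add: gderiv_def)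
  then show ?thesis using gradient_eq by metis
qed

lemma C1_iff: "C1 f \<longleftrightarrow> (\<forall>x. f differentiable (at x)) \<and> continuous_on UNIV (gradient f)"
  unfolding C1_def using GDERIV_differentiable by (metis differentiable_def gderiv_def)

lemma C1_const: "C1 (\<lambda>x. c)" "gradient (\<lambda>x. c) = (\<lambda>x. 0)"
  using C1_conjI[OF GDERIV_const] by auto

lemma C1_add:
  assumes "C1 f" "C1 g"
  shows "C1 (\<lambda>x. f x + g x)" "gradient (\<lambda>x. f x + g x) = (\<lambda>x. gradient f x + gradient g x)"
  using C1_conjI[OF GDERIV_add[OF C1_GDERIV[OF assms(1)] C1_GDERIV[OF assms(2)]]] assms
  by (auto intro!: continuous_intros C1_continuous_gradient C1_continuous)

lemma C1_diff:
  assumes "C1 f" "C1 g"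
  shows "C1 (\<lambda>x. f x - g x)" "gradient (\<lambda>x. f x - g x) = (\<lambda>x. gradient f x - gradient g x)"
  using C1_conjI[OF GDERIV_diff[OF C1_GDERIV[OF assms(1)] C1_GDERIV[OF assms(2)]]] assms
  by (auto intro!: continuous_intros C1_continuous_gradient C1_continuous)

lemma C1_mult:
  assumes "C1 f" "C1 g"
  shows "C1 (\<lambda>x. f x * g x)"
    "gradient (\<lambda>x. f x * g x) = (\<lambda>x. f x *\<^sub>R gradient g x + g x *\<^sub>R gradient f x)"
proof -
  have "continuous_on UNIV (\<lambda>x. f x *\<^sub>R gradient g x + g x *\<^sub>R gradient f x)"
    using assms by (intro continuous_intros C1_continuous C1_continuous_gradient)
  then show "C1 (\<lambda>x. f x * g x)"
    "gradient (\<lambda>x. f x * g x) = (\<lambda>x. f x *\<^sub>R gradient g x + g x *\<^sub>R gradient f x)"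
    using C1_conjI[OF GDERIV_mult[OF C1_GDERIV[OF assms(1)] C1_GDERIV[OF assms(2)]]] by auto
qed

lemma C1_compose:
  assumes "C1 f" "\<And>t. DERIV h t :> h' t" "continuous_on UNIV h'"
  shows "C1 (\<lambda>x. h (f x))" "gradient (\<lambda>x. h (f x)) = (\<lambda>x. h' (f x) *\<^sub>R gradient f x)"
proof -
  have "continuous_on UNIV (\<lambda>x. h' (f x) *\<^sub>R gradient f x)"
    using assms by (intro continuous_intros continuous_on_compose2[OF assms(3)] C1_continuous
        C1_continuous_gradient) auto
  then show "C1 (\<lambda>x. h (f x))" "gradient (\<lambda>x. h (f x)) = (\<lambda>x. h' (f x) *\<^sub>R gradient f x)"
    using C1_conjI[OF GDERIV_DERIV_compose[OF C1_GDERIV[OF assms(1)] assms(2)]] by auto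
qed

lemma C1_inner: "C1 (\<lambda>x. x \<bullet> e)" "gradient (\<lambda>x. x \<bullet> e) = (\<lambda>x. e)"
proof -
  have "GDERIV (\<lambda>x. x \<bullet> e) x :> e" for x
    by (auto simp: gderiv_def intro!: derivative_eq_intros)
  then show "C1 (\<lambda>x. x \<bullet> e)" "gradient (\<lambda>x. x \<bullet> e) = (\<lambda>x. e)"
    using C1_conjI[of "\<lambda>x. x \<bullet> e" "\<lambda>_. e"] by auto
qed

lemma C1_translate:
  assumes "C1 f"
  shows "C1 (\<lambda>x. f (x - y))" "gradient (\<lambda>x. f (x - y)) = (\<lambda>x. gradient f (x - y))"
proof -
  have "GDERIV (\<lambda>x. f (x - y)) x :> gradient f (x - y)" for x
  proof -
    have "((\<lambda>x. x - y) has_derivative (\<lambda>h. h)) (at x)"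
      by (auto intro!: derivative_eq_intros)
    moreover have "(f has_derivative (\<lambda>h. h \<bullet> gradient f (x - y))) (at (x - y))"
      using C1_GDERIV[OF assms] by (simp add: gderiv_def)
    ultimately show ?thesis
      unfolding gderiv_def by (rule has_derivative_compose)
  qed
  moreover have "continuous_on UNIV (\<lambda>x. gradient f (x - y))"
    by (rule continuous_on_compose2[OF C1_continuous_gradient[OF assms, of UNIV]])
       (auto intro!: continuous_intros)
  ultimately show "C1 (\<lambda>x. f (x - y))" "gradient (\<lambda>x. f (x - y)) = (\<lambda>x. gradient f (x - y))"
    using C1_conjI[of "\<lambda>x. f (x - y)" "\<lambda>x. gradient f (x - y)"] by auto
qed

text \<open>Makes the Stone-Weierstrass theorem a source of smooth approximants.\<close>

lemma C1_real_polynomial_function: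
  fixes f :: "'a::euclidean_space \<Rightarrow> real"
  shows "real_polynomial_function f \<Longrightarrow> C1 f"
proof (induction rule: real_polynomial_function.induct)
  case (linear f)
  then interpret bounded_linear f .
  have "f h = h \<bullet> (\<Sum>b\<in>Basis. f b *\<^sub>R b)" for h
  proof -
    have "f h = f (\<Sum>b\<in>Basis. (h \<bullet> b) *\<^sub>R b)" by (simp add: euclidean_representation)
    also have "\<dots> = h \<bullet> (\<Sum>b\<in>Basis. f b *\<^sub>R b)"
      by (simp add: sum scaleR inner_sum_right mult.commute)
    finally show ?thesis .
  qed
  then have "f = (\<lambda>h. h \<bullet> (\<Sum>b\<in>Basis. f b *\<^sub>R b))" by blast
  then show ?case using C1_inner by metis
qed (auto intro: C1_const C1_add C1_mult)

text \<open>Squaring removes the kink of the positive part: at 0 the difference quotient is at most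
  the increment in absolute value. Both the mollifier and \<open>bump\<close> are built on this
  function.\<close>

lemma DERIV_max_0_power2: "DERIV (\<lambda>t::real. (max 0 t)^2) t :> 2 * max 0 t"
proof (cases t "0::real" rule: linorder_cases)
  case less
  have "DERIV (\<lambda>t::real. 0) t :> 2 * max 0 t" using less by auto
  then show ?thesis
    by (rule has_field_derivative_transform_within_open[of _ _ _ "{..<0}"]) (use less in auto)
next
  case greater
  have "DERIV (\<lambda>t::real. t^2) t :> 2 * max 0 t"
    using greater by (auto intro!: derivative_eq_intros)
  then show ?thesis
    by (rule has_field_derivative_transform_within_open[of _ _ _ "{0<..}"]) (use greater in auto)
next
  case equal
  have "((\<lambda>h. ((max 0 (0+h))^2 - (max 0 0)^2) / h) \<longlongrightarrow> 0) (at (0::real))"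
  proof (rule Lim_null_comparison)
    show "\<forall>\<^sub>F h in at (0::real). norm (((max 0 (0+h))^2 - (max 0 0)^2) / h) \<le> \<bar>h\<bar>"
      by (rule always_eventually) (auto simp: max_def power2_eq_square)
    show "((\<lambda>h::real. \<bar>h\<bar>) \<longlongrightarrow> 0) (at 0)"
      using tendsto_rabs_zero[OF tendsto_ident_at[of 0 UNIV]] by simp
  qed
  then show ?thesis using equal by (simp add: DERIV_def)
qed

text \<open>The barrier has exponent p/(p-1), close to 1, so the exponent \<open>q - 2\<close> is
  negative. The formula still holds at the origin, since \<open>0 powr _\<close> is 0 and the
  derivative there vanishes because \<open>q - 1\<close> is positive.\<close>

lemma GDERIV_norm_powr:
  fixes x :: "'a::euclidean_space"
  assumes "1 < q"
  shows "GDERIV (\<lambda>x. norm x powr q) x :> (q * norm x powr (q - 2)) *\<^sub>R x"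
proof (cases "x = 0")
  case False
  have "GDERIV (\<lambda>x. norm x powr q) x :> (q * norm x powr (q - 1)) *\<^sub>R sgn x"
    by (rule GDERIV_DERIV_compose[OF GDERIV_norm[OF False]])
       (use False in \<open>auto intro!: derivative_eq_intros\<close>)
  moreover have "(q * norm x powr (q - 1)) *\<^sub>R sgn x = (q * norm x powr (q - 2)) *\<^sub>R x"
  proof -
    have "norm x powr (q - 1) = norm x powr (q - 2) * norm x"
      using False powr_add[of "norm x" "q - 2" 1] by simp
    then show ?thesis using False by (simp add: sgn_div_norm)
  qed
  ultimately show ?thesis by simp
next
  case True
  have "((\<lambda>h::'a. norm (norm h powr q) / norm h) \<longlongrightarrow> 0) (at 0)"
  proof (rule Lim_transform_eventually)
    show "((\<lambda>h::'a. norm h powr (q - 1)) \<longlongrightarrow> 0) (at 0)"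
      using assms by (auto intro!: tendsto_eq_intros)
    have "norm h powr (q - 1) = norm (norm h powr q) / norm h" if "h \<noteq> 0" for h :: 'a
      using that by (simp add: powr_diff)
    then show "\<forall>\<^sub>F h::'a in at 0. norm h powr (q - 1) = norm (norm h powr q) / norm h"
      by (auto simp: eventually_at_filter)
  qed
  then show ?thesis
    using True assms unfolding gderiv_def
    by (auto simp: has_derivative_at)
qed

lemma continuous_on_norm_powr_scaleR:
  assumes "1 < q"
  shows "continuous_on UNIV (\<lambda>x::'a::euclidean_space. (q * norm x powr (q - 2)) *\<^sub>R x)"
proof -
  have "isCont (\<lambda>x::'a. (q * norm x powr (q - 2)) *\<^sub>R x) x" for x
  proof (cases "x = 0")
    case False
    then show ?thesis by (auto intro!: continuous_intros)
  next
    case True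
    have "((\<lambda>h::'a. (q * norm h powr (q - 2)) *\<^sub>R h) \<longlongrightarrow> 0) (at 0)"
    proof (rule Lim_null_comparison)
      show "((\<lambda>h::'a. q * norm h powr (q - 1)) \<longlongrightarrow> 0) (at 0)"
        using assms by (auto intro!: tendsto_eq_intros)
      have "norm ((q * norm h powr (q - 2)) *\<^sub>R h) \<le> q * norm h powr (q - 1)" if "h \<noteq> 0" for h :: 'a
        using that assms powr_add[of "norm h" "q - 2" 1] by (simp add: abs_mult mult.assoc)
      then show "\<forall>\<^sub>F h::'a in at 0. norm ((q * norm h powr (q - 2)) *\<^sub>R h) \<le> q * norm h powr (q - 1)"
        by (auto simp: eventually_at_filter)
    qed
    then show ?thesis using True by (simp add: isCont_def)
  qed
  then show ?thesis by (simp add: continuous_on_eq_continuous_at)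
qed

lemma C1_norm_powr:
  assumes "1 < q"
  shows "C1 (\<lambda>x::'a::euclidean_space. norm x powr q)"
    "gradient (\<lambda>x::'a. norm x powr q) = (\<lambda>x. (q * norm x powr (q - 2)) *\<^sub>R x)"
  using C1_conjI[OF GDERIV_norm_powr[OF assms] continuous_on_norm_powr_scaleR[OF assms]] by auto

section \<open>Test functions with compact support\<close>

lemma C1_0I:
  assumes "C1 f" "compact K" "K \<subseteq> \<Omega>" "\<And>x. x \<notin> K \<Longrightarrow> f x = 0"
  shows "f \<in> C1_0 \<Omega>"
proof -
  have *: "closure {x. f x \<noteq> 0} \<subseteq> K"
    using assms by (intro closure_minimal) (auto intro: compact_imp_closed)
  then have "compact (closure {x. f x \<noteq> 0})"
    by (metis assms(2) closed_Int_compact closed_closure inf.absorb1)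
  then show ?thesis
    using * assms by (auto simp: C1_0_def C1_iff)
qed

lemma C1_0_C1: "f \<in> C1_0 \<Omega> \<Longrightarrow> C1 f"
  by (auto simp: C1_0_def C1_iff)

lemma GDERIV_zero_open:
  assumes "open S" "x \<in> S" "\<And>y. y \<in> S \<Longrightarrow> f y = c"
  shows "gradient f x = 0"
proof -
  have "GDERIV f x :> 0"
    unfolding gderiv_def
    by (rule has_derivative_transform_within_open[of "\<lambda>_. c" _ _ _ S])
      (use assms in \<open>auto intro!: derivative_eq_intros\<close>)
  then show ?thesis by (rule gradient_eq)
qed

lemma C1_0_support:
  assumes "f \<in> C1_0 \<Omega>"
  obtains K where "compact K" "K \<subseteq> \<Omega>" "\<And>x. x \<notin> K \<Longrightarrow> f x = 0" "\<And>x. x \<notin> K \<Longrightarrow> gradient f x = 0"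
proof -
  define K where "K = closure {x. f x \<noteq> 0}"
  have K: "compact K" "K \<subseteq> \<Omega>" using assms by (simp_all add: C1_0_def K_def)
  have f0: "f x = 0" if "x \<notin> K" for x
    using that closure_subset[of "{x. f x \<noteq> 0}"] unfolding K_def by blast
  have "gradient f x = 0" if "x \<notin> K" for x
  proof (rule GDERIV_zero_open)
    show "open (- K)" using K(1) compact_imp_closed by blast
    show "x \<in> - K" using that by simp
    show "f y = 0" if "y \<in> - K" for y using f0[of y] that by simp
  qed
  with K f0 show ?thesis by (rule that)
qed

lemma C1_0_mono: "f \<in> C1_0 A \<Longrightarrow> A \<subseteq> B \<Longrightarrow> f \<in> C1_0 B"
  by (auto simp: C1_0_def)

lemma C1_0_add:
  assumes "f \<in> C1_0 \<Omega>" "g \<in> C1_0 \<Omega>"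
  shows "(\<lambda>x. f x + g x) \<in> C1_0 \<Omega>"
proof -
  obtain K where K: "compact K" "K \<subseteq> \<Omega>" "\<And>x. x \<notin> K \<Longrightarrow> f x = 0"
    using C1_0_support[OF assms(1)] by metis
  obtain J where J: "compact J" "J \<subseteq> \<Omega>" "\<And>x. x \<notin> J \<Longrightarrow> g x = 0"
    using C1_0_support[OF assms(2)] by metis
  show ?thesis
    by (rule C1_0I[of _ "K \<union> J"])
      (use assms K J in \<open>auto intro: C1_add C1_0_C1 compact_Un\<close>)
qed

lemma C1_0_mult:
  assumes "f \<in> C1_0 \<Omega>" "C1 g"
  shows "(\<lambda>x. f x * g x) \<in> C1_0 \<Omega>"
proof -
  obtain K where K: "compact K" "K \<subseteq> \<Omega>" "\<And>x. x \<notin> K \<Longrightarrow> f x = 0"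
    using C1_0_support[OF assms(1)] by metis
  show ?thesis
    by (rule C1_0I[of _ "K"]) (use assms K in \<open>auto intro: C1_mult C1_0_C1\<close>)
qed

lemma continuous_compact_support_bounded:
  fixes f :: "'a::euclidean_space \<Rightarrow> 'b::euclidean_space"
  assumes "continuous_on UNIV f" "compact K" "\<And>x. x \<notin> K \<Longrightarrow> f x = 0"
  shows "\<exists>B\<ge>0. \<forall>x. norm (f x) \<le> B"
proof -
  have "compact (f ` K)"
    using assms compact_continuous_image continuous_on_subset by blast
  then obtain B where B: "\<And>x. x \<in> K \<Longrightarrow> norm (f x) \<le> B"
    using compact_imp_bounded[of "f ` K"] by (auto simp: bounded_iff)
  have "norm (f x) \<le> max B 0" for x
    using B[of x] assms(3)[of x] by (cases "x \<in> K") auto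
  then show ?thesis by (intro exI[of _ "max B 0"]) simp
qed

lemma C1_0_bounded:
  assumes "f \<in> C1_0 \<Omega>"
  obtains B where "0 \<le> B" "\<And>x. \<bar>f x\<bar> \<le> B" "\<And>x. norm (gradient f x) \<le> B"
proof -
  obtain K where K: "compact K" "K \<subseteq> \<Omega>" "\<And>x. x \<notin> K \<Longrightarrow> f x = 0" "\<And>x. x \<notin> K \<Longrightarrow> gradient f x = 0"
    using C1_0_support[OF assms] by metis
  obtain B where "0 \<le> B" "\<And>x. norm (f x) \<le> B"
    using continuous_compact_support_bounded[OF C1_continuous[OF C1_0_C1[OF assms]] K(1,3)] by auto
  moreover obtain B' where "0 \<le> B'" "\<And>x. norm (gradient f x) \<le> B'"
    using continuous_compact_support_bounded[OF C1_continuous_gradient[OF C1_0_C1[OF assms]] K(1,4)] by auto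
  ultimately show ?thesis
    by (intro that[of "max B B'"]) (auto simp: le_max_iff_disj)
qed

section \<open>Integration by parts\<close>

lemma integrable_continuous_compact_support:
  fixes f :: "'a::euclidean_space \<Rightarrow> 'b::euclidean_space"
  assumes "continuous_on UNIV f" "compact K" "\<And>x. x \<notin> K \<Longrightarrow> f x = 0"
  shows "integrable lborel f"
proof -
  have "integrable lborel (\<lambda>x. indicator K x *\<^sub>R f x)"
    using assms(1,2) by (intro borel_integrable_compact) (auto intro: continuous_on_subset)
  moreover have "(\<lambda>x. indicator K x *\<^sub>R f x) = f"
    using assms(3) by (auto simp: indicator_def)
  ultimately show ?thesis by simp
qed

text \<open>Weak equations are stated over \<open>lebesgue_on\<close>, whereas translation
  invariance and integrals of compactly supported functions are handled over \<open>lborel\<close>.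
  For continuous functions vanishing off the domain the two integrals agree.\<close>

lemma integral_lebesgue_on_support:
  fixes f :: "'a::euclidean_space \<Rightarrow> 'b::euclidean_space"
  assumes "continuous_on UNIV f" "\<Omega> \<in> sets lebesgue" "\<And>x. x \<notin> \<Omega> \<Longrightarrow> f x = 0"
  shows "(LINT x|lebesgue_on \<Omega>. f x) = (LINT x|lborel. f x)"
proof -
  have "(LINT x|lebesgue_on \<Omega>. f x) = (LINT x|lebesgue. indicator \<Omega> x *\<^sub>R f x)"
    using assms(2) by (intro integral_restrict_space) auto
  also have "(\<lambda>x. indicator \<Omega> x *\<^sub>R f x) = f"
    using assms(3) by (auto simp: indicator_def)
  also have "(LINT x|lebesgue. f x) = (LINT x|lborel. f x)"
    using assms(1) by (intro integral_completion) (simp add: borel_measurable_continuous_onI)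
  finally show ?thesis .
qed

lemma integral_lborel_translate:
  fixes f :: "'a::euclidean_space \<Rightarrow> 'b::euclidean_space"
  assumes "f \<in> borel_measurable borel"
  shows "(LINT x|lborel. f (c + x)) = (LINT x|lborel. f x)"
proof -
  have "(LINT x|lborel. f x) = (LINT x|distr lborel borel ((+) c). f x)"
    by (simp add: lborel_distr_plus)
  also have "\<dots> = (LINT x|lborel. f (c + x))"
    using assms by (intro integral_distr) auto
  finally show ?thesis by simp
qed

lemma C1_lipschitz_bound:
  fixes f :: "'a::euclidean_space \<Rightarrow> real"
  assumes "C1 f" "convex S" "\<And>x. x \<in> S \<Longrightarrow> norm (gradient f x) \<le> B" "x \<in> S" "y \<in> S"
  shows "\<bar>f x - f y\<bar> \<le> B * norm (x - y)"
proof -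
  have "norm (f x - f y) \<le> B * norm (x - y)"
  proof (rule differentiable_bound[OF assms(2) _ _ assms(4,5)])
    show "(f has_derivative (\<lambda>h. h \<bullet> gradient f z)) (at z within S)" if "z \<in> S" for z
      using C1_GDERIV[OF assms(1), of z] has_derivative_at_withinI by (auto simp: gderiv_def)
    show "onorm (\<lambda>h. h \<bullet> gradient f z) \<le> B" if "z \<in> S" for z
    proof (rule onorm_le)
      show "norm (h \<bullet> gradient f z) \<le> B * norm h" for h
      proof -
        have "norm (h \<bullet> gradient f z) \<le> norm h * norm (gradient f z)"
          using Cauchy_Schwarz_ineq2[of h "gradient f z"] by simp
        also have "\<dots> \<le> norm h * B"
          by (intro mult_left_mono assms(3) that norm_ge_zero)
        finally show ?thesis by (simp add: mult.commute)
      qed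
    qed
  qed
  then show ?thesis by simp
qed

lemma GDERIV_difference_quotient:
  assumes "GDERIV f x :> D"
  shows "((\<lambda>t. (f (x + t *\<^sub>R e) - f x) / t) \<longlongrightarrow> e \<bullet> D) (at 0)"
proof -
  have "((\<lambda>t::real. x + t *\<^sub>R e) has_derivative (\<lambda>t. t *\<^sub>R e)) (at 0)"
    by (auto intro!: derivative_eq_intros)
  moreover have "(f has_derivative (\<lambda>h. h \<bullet> D)) (at (x + 0 *\<^sub>R e))"
    using assms by (simp add: gderiv_def)
  ultimately have "((\<lambda>t. f (x + t *\<^sub>R e)) has_derivative (\<lambda>t. (t *\<^sub>R e) \<bullet> D)) (at 0)"
    by (rule has_derivative_compose)
  then have "DERIV (\<lambda>t. f (x + t *\<^sub>R e)) 0 :> e \<bullet> D"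
    by (simp add: has_field_derivative_def mult_commute_abs)
  then show ?thesis by (simp add: DERIV_def)
qed

text \<open>By translation invariance every difference quotient has integral zero; dominated
  convergence carries this over to the directional derivatives.\<close>

lemma integral_gradient_zero:
  fixes f :: "'a::euclidean_space \<Rightarrow> real"
  assumes "C1 f" "compact K" "\<And>x. x \<notin> K \<Longrightarrow> f x = 0" "\<And>x. x \<notin> K \<Longrightarrow> gradient f x = 0"
  shows "(LINT x|lborel. gradient f x) = 0"
proof (rule euclidean_eqI)
  fix e :: 'a assume e: "e \<in> Basis"
  have int_grad: "integrable lborel (gradient f)"
    using assms by (intro integrable_continuous_compact_support C1_continuous_gradient) auto
  have int_f: "integrable lborel f"
    using assms by (intro integrable_continuous_compact_support C1_continuous) auto
  obtain B where B: "0 \<le> B" "\<And>x. norm (gradient f x) \<le> B"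
    using continuous_compact_support_bounded[OF C1_continuous_gradient[OF assms(1)] assms(2,4)] by auto
  obtain R where R: "K \<subseteq> cball 0 R"
    using compact_imp_bounded[OF assms(2)] by (auto simp: bounded_iff subset_iff)
  define s where "s n x = (f (x + (1 / real (Suc n)) *\<^sub>R e) - f x) / (1 / real (Suc n))" for n x
  have meas[measurable]: "f \<in> borel_measurable borel" "gradient f \<in> borel_measurable borel"
    by (rule borel_measurable_continuous_onI, rule C1_continuous[OF assms(1)])
      (rule borel_measurable_continuous_onI, rule C1_continuous_gradient[OF assms(1)])
  have lim: "(\<lambda>n. LINT x|lborel. s n x) \<longlonglongrightarrow> (LINT x|lborel. e \<bullet> gradient f x)"
  proof (rule integral_dominated_convergence)
    show "(\<lambda>x. e \<bullet> gradient f x) \<in> borel_measurable lborel" by simp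
    show "s n \<in> borel_measurable lborel" for n unfolding s_def by measurable
    \<comment> \<open>The shifts have length at most 1, so enlarging the radius by 1 covers the
      supports of all difference quotients.\<close>
    have "integrable lborel (indicator (cball 0 (R + 1)) :: 'a \<Rightarrow> real)"
      using emeasure_lborel_cball_finite[of "0::'a" "R + 1"]
      by (simp add: integrable_indicator_iff infinity_ennreal_def)
    then show "integrable lborel (\<lambda>x::'a. B * indicat_real (cball 0 (R + 1)) x)"
      by (rule integrable_mult_right)
    show "AE x in lborel. (\<lambda>n. s n x) \<longlonglongrightarrow> e \<bullet> gradient f x"
    proof (rule AE_I2)
      fix x
      have "filterlim (\<lambda>n. 1 / real (Suc n)) (at 0) sequentially"
        unfolding filterlim_at using LIMSEQ_inverse_real_of_nat by (auto simp: inverse_eq_divide)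
      then show "(\<lambda>n. s n x) \<longlonglongrightarrow> e \<bullet> gradient f x"
        unfolding s_def
        by (rule filterlim_compose[OF GDERIV_difference_quotient[OF C1_GDERIV[OF assms(1)]]])
    qed
    show "AE x in lborel. norm (s n x) \<le> B * indicat_real (cball 0 (R + 1)) x" for n
    proof (rule AE_I2)
      fix x
      let ?h = "(1 / real (Suc n)) *\<^sub>R e"
      have h: "norm ?h = 1 / real (Suc n)" using e by simp
      show "norm (s n x) \<le> B * indicat_real (cball 0 (R + 1)) x"
      proof (cases "x \<in> cball 0 (R + 1)")
        case True
        have "\<bar>f (x + ?h) - f x\<bar> \<le> B * norm ?h"
          using C1_lipschitz_bound[OF assms(1) convex_UNIV B(2), of "x + ?h" x] by simp
        then have "\<bar>f (x + ?h) - f x\<bar> / (1 / real (Suc n)) \<le> B"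
          unfolding h by (subst pos_divide_le_eq) auto
        then show ?thesis using True by (simp add: s_def abs_mult)
      next
        case False
        have "norm ?h \<le> 1" using h by simp
        moreover have "norm x - norm ?h \<le> norm (x + ?h)"
          using norm_triangle_ineq2[of x "- ?h"] by simp
        moreover have "R + 1 < norm x" using False by simp
        ultimately have "norm (x + ?h) > R" by linarith
        then have "x + ?h \<notin> K" "x \<notin> K" using False R by auto
        then show ?thesis using assms(3) B(1) by (simp add: s_def)
      qed
    qed
  qed
  have "(LINT x|lborel. s n x) = 0" for n
  proof -
    let ?h = "(1 / real (Suc n)) *\<^sub>R e"
    have "integrable lborel (\<lambda>x. f (?h + x))"
    proof -
      have "integrable (distr lborel borel ((+) ?h)) f" using int_f by (simp add: lborel_distr_plus)
      then show ?thesis by (subst (asm) integrable_distr_eq) auto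
    qed
    then have "(LINT x|lborel. f (?h + x) - f x) = 0"
      using int_f integral_lborel_translate[OF meas(1), of ?h] by simp
    then show ?thesis by (simp add: s_def add.commute)
  qed
  with lim have "(LINT x|lborel. e \<bullet> gradient f x) = 0"
    by (simp add: LIMSEQ_const_iff)
  then show "(LINT x|lborel. gradient f x) \<bullet> e = 0 \<bullet> e"
    using integral_inner_right[of e lborel "gradient f"] int_grad by (simp add: inner_commute)
qed

lemma integral_gradient_C1_0:
  assumes "f \<in> C1_0 \<Omega>"
  shows "(LINT x|lborel. gradient f x) = 0"
  using C1_0_support[OF assms] integral_gradient_zero[OF C1_0_C1[OF assms]] by metis

lemma C1_0_integrable:
  assumes "f \<in> C1_0 \<Omega>"
  shows "integrable lborel f" "integrable lborel (gradient f)"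
proof -
  obtain K where "compact K" "K \<subseteq> \<Omega>" "\<And>x. x \<notin> K \<Longrightarrow> f x = 0" "\<And>x. x \<notin> K \<Longrightarrow> gradient f x = 0"
    using C1_0_support[OF assms] by metis
  then show "integrable lborel f" "integrable lborel (gradient f)"
    using integrable_continuous_compact_support[of f K] integrable_continuous_compact_support[of "gradient f" K]
     C1_continuous[OF C1_0_C1[OF assms]] C1_continuous_gradient[OF C1_0_C1[OF assms]] by auto
qed

lemma C1_0_scaleR_integrable:
  fixes G :: "'a::euclidean_space \<Rightarrow> 'b::euclidean_space"
  assumes "f \<in> C1_0 \<Omega>" "continuous_on UNIV G"
  shows "integrable lborel (\<lambda>x. f x *\<^sub>R G x)"
proof -
  obtain K where "compact K" "K \<subseteq> \<Omega>" "\<And>x. x \<notin> K \<Longrightarrow> f x = 0"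
    using C1_0_support[OF assms(1)] by metis
  then show ?thesis
    using C1_continuous[OF C1_0_C1[OF assms(1)]] assms(2)
    by (intro integrable_continuous_compact_support[of _ K] continuous_intros) auto
qed

lemma C1_0_gradient_scaleR_integrable:
  assumes "f \<in> C1_0 \<Omega>" "continuous_on UNIV g"
  shows "integrable lborel (\<lambda>x. g x *\<^sub>R gradient f x)"
proof -
  obtain K where "compact K" "K \<subseteq> \<Omega>" "\<And>x. x \<notin> K \<Longrightarrow> gradient f x = 0"
    using C1_0_support[OF assms(1)] by metis
  then show ?thesis
    using C1_continuous_gradient[OF C1_0_C1[OF assms(1)]] assms(2)
    by (intro integrable_continuous_compact_support[of _ K] continuous_intros) auto
qed

lemma integral_by_parts_C1:
  assumes "f \<in> C1_0 \<Omega>" "C1 g"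
  shows "(LINT x|lborel. g x *\<^sub>R gradient f x) = - (LINT x|lborel. f x *\<^sub>R gradient g x)"
proof -
  have "(LINT x|lborel. gradient (\<lambda>x. f x * g x) x) = 0"
    using integral_gradient_C1_0[OF C1_0_mult[OF assms]] .
  then have "(LINT x|lborel. f x *\<^sub>R gradient g x + g x *\<^sub>R gradient f x) = 0"
    by (simp add: C1_mult[OF C1_0_C1[OF assms(1)] assms(2)])
  then have "(LINT x|lborel. f x *\<^sub>R gradient g x) + (LINT x|lborel. g x *\<^sub>R gradient f x) = 0"
    by (subst (asm) Bochner_Integration.integral_add)
       (use C1_0_scaleR_integrable[OF assms(1) C1_continuous_gradient[OF assms(2)]]
          C1_0_gradient_scaleR_integrable[OF assms(1) C1_continuous[OF assms(2)]] in auto)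
  then show ?thesis by (simp add: eq_neg_iff_add_eq_0 add.commute)
qed

lemma C1_weak_gradient:
  assumes "C1 g" "\<Omega> \<in> sets lebesgue"
  shows "weak_gradient \<Omega> g (gradient g)"
  unfolding weak_gradient_def
proof
  fix \<phi> assume \<phi>: "\<phi> \<in> C1_0 \<Omega>"
  obtain K where K: "compact K" "K \<subseteq> \<Omega>" "\<And>x. x \<notin> K \<Longrightarrow> \<phi> x = 0" "\<And>x. x \<notin> K \<Longrightarrow> gradient \<phi> x = 0"
    using C1_0_support[OF \<phi>] by metis
  have c: "continuous_on UNIV (\<lambda>x. g x *\<^sub>R gradient \<phi> x)" "continuous_on UNIV (\<lambda>x. \<phi> x *\<^sub>R gradient g x)"
    using assms(1) C1_0_C1[OF \<phi>] by (auto intro!: continuous_intros C1_continuous C1_continuous_gradient)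
  have "\<phi> x = 0" "gradient \<phi> x = 0" if "x \<notin> \<Omega>" for x
    using K(2) K(3,4)[of x] that by auto
  then show "(LINT x|lebesgue_on \<Omega>. g x *\<^sub>R gradient \<phi> x) = - (LINT x|lebesgue_on \<Omega>. \<phi> x *\<^sub>R gradient g x)"
    using integral_lebesgue_on_support[OF c(1) assms(2)] integral_lebesgue_on_support[OF c(2) assms(2)]
      integral_by_parts_C1[OF \<phi> assms(1)] by simp
qed

text \<open>The field \<open>x - y\<close> has divergence N. Up to a factor it is the flux of the
  barrier used for comparison.\<close>

lemma integral_linear_field:
  fixes y :: "'a::euclidean_space"
  assumes "f \<in> C1_0 \<Omega>"
  shows "(LINT x|lborel. (x - y) \<bullet> gradient f x) = - real DIM('a) * (LINT x|lborel. f x)"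
proof -
  have c: "C1 (\<lambda>x. (x - y) \<bullet> e)" "gradient (\<lambda>x. (x - y) \<bullet> e) = (\<lambda>x. e)" for e
    using C1_translate[OF C1_inner(1)[of e], of y] unfolding C1_inner(2) .
  have int: "integrable lborel (\<lambda>x. ((x - y) \<bullet> e) *\<^sub>R gradient f x)" for e
    using C1_0_gradient_scaleR_integrable[OF assms C1_continuous[OF c(1)]] .
  have *: "(LINT x|lborel. (((x - y) \<bullet> e) *\<^sub>R gradient f x) \<bullet> e) = - (LINT x|lborel. f x)"
    if "e \<in> Basis" for e
  proof -
    have "(LINT x|lborel. ((x - y) \<bullet> e) *\<^sub>R gradient f x) = - (LINT x|lborel. f x *\<^sub>R e)"
      using integral_by_parts_C1[OF assms c(1)[of e]] by (simp add: c(2))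
    also have "\<dots> = - (LINT x|lborel. f x) *\<^sub>R e"
      using C1_0_integrable(1)[OF assms] by simp
    finally have "(LINT x|lborel. ((x - y) \<bullet> e) *\<^sub>R gradient f x) \<bullet> e = - (LINT x|lborel. f x)"
      using that by (simp add: inner_Basis)
    then show ?thesis using integral_inner_left[of e lborel, OF int[of e]] by simp
  qed
  have "(LINT x|lborel. (x - y) \<bullet> gradient f x)
      = (LINT x|lborel. (\<Sum>e\<in>Basis. (((x - y) \<bullet> e) *\<^sub>R gradient f x) \<bullet> e))"
  proof (rule Bochner_Integration.integral_cong)
    show "(x - y) \<bullet> gradient f x = (\<Sum>e\<in>Basis. (((x - y) \<bullet> e) *\<^sub>R gradient f x) \<bullet> e)" for x
      unfolding inner_scaleR_left by (rule euclidean_inner)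
  qed simp
  also have "\<dots> = (\<Sum>e\<in>Basis. (LINT x|lborel. (((x - y) \<bullet> e) *\<^sub>R gradient f x) \<bullet> e))"
    using int by (intro Bochner_Integration.integral_sum integrable_inner_left) auto
  also have "\<dots> = (\<Sum>e\<in>(Basis::'a set). - (LINT x|lborel. f x))"
    by (rule sum.cong[OF refl *])
  finally show ?thesis by simp
qed

section \<open>Mollification\<close>

definition mollifier :: "real \<Rightarrow> ('a::euclidean_space \<Rightarrow> real) \<Rightarrow> bool" where
  "mollifier \<delta> \<eta> \<longleftrightarrow> C1 \<eta> \<and> (\<forall>z. 0 \<le> \<eta> z) \<and> (\<forall>z. \<delta> \<le> norm z \<longrightarrow> \<eta> z = 0) \<and> (LINT z|lborel. \<eta> z) = 1"

text \<open>The kernel is evaluated at \<open>z - x\<close>, so that for fixed \<open>x\<close> it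
  is a translate of \<open>\<eta>\<close> and can serve as a test function in \<open>z\<close>; no
  symmetry of \<open>\<eta>\<close> is involved.\<close>

definition mollify :: "('a::euclidean_space \<Rightarrow> real) \<Rightarrow> ('a \<Rightarrow> real) \<Rightarrow> 'a \<Rightarrow> real" where
  "mollify \<eta> f x = (LINT z|lborel. \<eta> (z - x) * f z)"

lemma mollifier_exists:
  assumes "0 < \<delta>"
  shows "\<exists>\<eta>::'a::euclidean_space \<Rightarrow> real. mollifier \<delta> \<eta>"
proof -
  define h :: "'a \<Rightarrow> real" where "h z = 1 - norm z powr 2 / \<delta>\<^sup>2" for z
  define b where "b z = (max 0 (h z))^2" for z
  have "C1 h"
    using C1_diff(1)[OF C1_const(1)[of 1] C1_mult(1)[OF C1_norm_powr(1)[of 2] C1_const(1)[of "1 / \<delta>\<^sup>2"]]]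
    by (simp add: h_def[abs_def])
  then have C1b: "C1 b"
    unfolding b_def[abs_def]
    by (rule C1_compose(1)[OF _ DERIV_max_0_power2]) (auto intro!: continuous_intros)
  have b0: "0 \<le> b z" for z by (simp add: b_def)
  have bz: "b z = 0" if "\<delta> \<le> norm z" for z
  proof -
    have "\<delta>\<^sup>2 \<le> (norm z)\<^sup>2" using assms that by (intro power_mono) auto
    then have "h z \<le> 0" using assms by (simp add: h_def powr_numeral)
    then show ?thesis by (simp add: b_def max_def)
  qed
  have bK: "b z = 0" if "z \<notin> cball 0 \<delta>" for z using bz[of z] that by auto
  have intb: "integrable lborel b"
    by (rule integrable_continuous_compact_support[OF C1_continuous[OF C1b] compact_cball bK])
  have pos: "0 < (LINT z|lborel. b z)"
  proof -
    \<comment> \<open>Inside half the radius, \<open>h\<close> is at least 1 - 1/4 = 3/4, hence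
      \<open>b\<close> is at least 9/16. This makes the normalising integral positive.\<close>
    have le: "(9/16) * indicat_real (ball 0 (\<delta>/2)) z \<le> b z" for z
    proof (cases "norm z < \<delta>/2")
      case True
      have "(norm z)\<^sup>2 \<le> (\<delta>/2)\<^sup>2" using True by (intro power_mono) auto
      then have "3/4 \<le> h z" using assms by (simp add: h_def powr_numeral field_simps power2_eq_square)
      then have "(3/4)\<^sup>2 \<le> b z" unfolding b_def by (intro power_mono) auto
      then show ?thesis using True by (simp add: power2_eq_square)
    qed (simp add: b0)
    have "0 < (9/16) * measure lborel (ball (0::'a) (\<delta>/2))"
      using content_ball_pos[of "\<delta>/2" "0::'a"] assms by simp
    also have "\<dots> = (LINT z|lborel. (9/16) * indicat_real (ball (0::'a) (\<delta>/2)) z)"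
      by simp
    also have "\<dots> \<le> (LINT z|lborel. b z)"
    proof (rule integral_mono[OF _ intb])
      show "integrable lborel (\<lambda>z::'a. (9/16) * indicat_real (ball 0 (\<delta>/2)) z)"
        using emeasure_lborel_ball_finite[of "0::'a" "\<delta>/2"]
        by (intro integrable_mult_right) (simp add: integrable_indicator_iff infinity_ennreal_def)
    qed (rule le)
    finally show ?thesis .
  qed
  define c where "c = 1 / (LINT z|lborel. b z)"
  have "C1 (\<lambda>z. c * b z)" by (rule C1_mult(1)[OF C1_const(1) C1b])
  moreover have "(LINT z|lborel. c * b z) = 1" using pos by (simp add: c_def)
  ultimately have "mollifier \<delta> (\<lambda>z. c * b z)"
    unfolding mollifier_def using b0 bz pos by (auto simp: c_def)
  then show ?thesis by blast
qed

lemma mollifier_integrable_mult: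
  fixes f :: "'a::euclidean_space \<Rightarrow> real"
  assumes "mollifier \<delta> \<eta>" "continuous_on UNIV f"
  shows "integrable lborel (\<lambda>z. \<eta> (z - x) * f z)"
proof (rule integrable_continuous_compact_support)
  have "continuous_on UNIV (\<lambda>z. \<eta> (z - x))"
    using assms(1) C1_translate(1) C1_continuous unfolding mollifier_def by blast
  then show "continuous_on UNIV (\<lambda>z. \<eta> (z - x) * f z)"
    using assms(2) by (rule continuous_on_mult)
  show "compact (cball x \<delta>)" by simp
  show "\<eta> (z - x) * f z = 0" if "z \<notin> cball x \<delta>" for z
    using assms(1) that by (simp add: mollifier_def dist_norm norm_minus_commute)
qed

lemma mollifier_continuous: "mollifier \<delta> \<eta> \<Longrightarrow> continuous_on A \<eta>"
  by (simp add: mollifier_def C1_continuous)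

lemma integral_mollifier_translate:
  fixes f :: "'a::euclidean_space \<Rightarrow> real"
  assumes "mollifier \<delta> \<eta>" "continuous_on UNIV f"
  shows "(LINT z|lborel. \<eta> z * f (z + x)) = mollify \<eta> f x"
proof -
  have c: "continuous_on UNIV (\<lambda>z. \<eta> z * f (z + x))"
    by (intro continuous_intros mollifier_continuous[OF assms(1)] continuous_on_compose2[OF assms(2)]) auto
  have "(LINT z|lborel. \<eta> (- x + z) * f ((- x + z) + x)) = (LINT z|lborel. \<eta> z * f (z + x))"
    by (rule integral_lborel_translate[OF borel_measurable_continuous_onI[OF c]])
  then show ?thesis by (simp add: mollify_def)
qed

lemma integral_mollifier_shift:
  assumes "mollifier \<delta> \<eta>"
  shows "(LINT z|lborel. \<eta> (z - x)) = 1"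
  using integral_mollifier_translate[OF assms continuous_on_const[of UNIV 1], of x] assms
  by (simp add: mollifier_def mollify_def)

text \<open>A weighted mean stays as close to \<open>c\<close> as the averaged values do. The free
  choice of \<open>c\<close> covers several uses: uniform approximation, local preservation of
  constants (\<open>e = 0\<close>), and the range [0, 1] (\<open>c = e = 1/2\<close>).\<close>

lemma mollify_close:
  fixes f :: "'a::euclidean_space \<Rightarrow> real"
  assumes "mollifier \<delta> \<eta>" "continuous_on UNIV f"
    and "\<And>z. z \<in> ball x \<delta> \<Longrightarrow> \<bar>f z - c\<bar> \<le> e"
  shows "\<bar>mollify \<eta> f x - c\<bar> \<le> e"
proof -
  note i = mollifier_integrable_mult[OF assms(1)]
  have i1: "integrable lborel (\<lambda>z. \<eta> (z - x) * (f z - c))"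
    using assms(2) by (intro i continuous_intros)
  have i2: "integrable lborel (\<lambda>z. \<eta> (z - x) * c')" for c'
    by (intro i continuous_intros)
  have "mollify \<eta> f x - c = (LINT z|lborel. \<eta> (z - x) * f z) - (LINT z|lborel. \<eta> (z - x) * c)"
    using integral_mollifier_shift[OF assms(1), of x] by (simp add: mollify_def)
  also have "\<dots> = (LINT z|lborel. \<eta> (z - x) * (f z - c))"
    by (subst Bochner_Integration.integral_diff[symmetric, OF i[OF assms(2)] i2])
       (simp add: right_diff_distrib)
  finally have eq: "mollify \<eta> f x - c = (LINT z|lborel. \<eta> (z - x) * (f z - c))" .
  have "\<bar>LINT z|lborel. \<eta> (z - x) * (f z - c)\<bar> \<le> (LINT z|lborel. \<bar>\<eta> (z - x) * (f z - c)\<bar>)"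
    using integral_norm_bound[of lborel "\<lambda>z. \<eta> (z - x) * (f z - c)"] by simp
  also have "\<dots> \<le> (LINT z|lborel. \<eta> (z - x) * e)"
  proof (rule integral_mono[OF integrable_abs[OF i1] i2])
    fix z
    show "\<bar>\<eta> (z - x) * (f z - c)\<bar> \<le> \<eta> (z - x) * e"
    proof (cases "z \<in> ball x \<delta>")
      case True
      then show ?thesis
        using assms(1,3) by (auto simp: abs_mult mollifier_def intro!: mult_left_mono)
    next
      case False
      then have "\<eta> (z - x) = 0"
        using assms(1) by (simp add: mollifier_def dist_norm norm_minus_commute)
      then show ?thesis by simp
    qed
  qed
  also have "\<dots> = e" using integral_mollifier_shift[OF assms(1), of x] by simp
  finally show ?thesis unfolding eq .
qed

text \<open>After a change of variables the shift acts on \<open>f\<close> and not on the kernel, so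
  the Lipschitz constant survives the averaging.\<close>

lemma mollify_lipschitz:
  fixes f :: "'a::euclidean_space \<Rightarrow> real"
  assumes "mollifier \<delta> \<eta>" "L-lipschitz_on UNIV f"
  shows "L-lipschitz_on UNIV (mollify \<eta> f)"
proof (rule lipschitz_onI)
  show "0 \<le> L" using assms(2) lipschitz_on_nonneg by blast
  fix x y :: 'a
  have c: "continuous_on UNIV f" using assms(2) lipschitz_on_continuous_on by blast
  have c': "continuous_on UNIV (\<lambda>z. f (z + v))" for v
    by (intro continuous_on_compose2[OF c] continuous_intros) auto
  have i: "integrable lborel (\<lambda>z. \<eta> z * g z)" if "continuous_on UNIV g" for g
    using mollifier_integrable_mult[OF assms(1) that, of 0] by simp
  have "mollify \<eta> f x - mollify \<eta> f y = (LINT z|lborel. \<eta> z * f (z + x)) - (LINT z|lborel. \<eta> z * f (z + y))"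
    by (simp add: integral_mollifier_translate[OF assms(1) c])
  also have "\<dots> = (LINT z|lborel. \<eta> z * (f (z + x) - f (z + y)))"
    by (subst Bochner_Integration.integral_diff[symmetric, OF i[OF c'] i[OF c']])
       (simp add: right_diff_distrib)
  finally have eq: "mollify \<eta> f x - mollify \<eta> f y = (LINT z|lborel. \<eta> z * (f (z + x) - f (z + y)))" .
  have i1: "integrable lborel (\<lambda>z. \<eta> z * (f (z + x) - f (z + y)))"
    by (intro i continuous_on_diff c')
  have i2: "integrable lborel (\<lambda>z. \<eta> z * (L * dist x y))"
    by (intro i continuous_on_const)
  have "\<bar>LINT z|lborel. \<eta> z * (f (z + x) - f (z + y))\<bar> \<le> (LINT z|lborel. \<bar>\<eta> z * (f (z + x) - f (z + y))\<bar>)"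
    using integral_norm_bound[of lborel "\<lambda>z. \<eta> z * (f (z + x) - f (z + y))"] by simp
  also have "\<dots> \<le> (LINT z|lborel. \<eta> z * (L * dist x y))"
  proof (rule integral_mono[OF integrable_abs[OF i1] i2])
    fix z
    have "\<bar>f (z + x) - f (z + y)\<bar> \<le> L * dist x y"
      using lipschitz_onD[OF assms(2), of "z + x" "z + y"] by (simp add: dist_real_def)
    then show "\<bar>\<eta> z * (f (z + x) - f (z + y))\<bar> \<le> \<eta> z * (L * dist x y)"
      using assms(1) by (auto simp: abs_mult mollifier_def intro!: mult_left_mono)
  qed
  also have "\<dots> = L * dist x y" using assms(1) by (simp add: mollifier_def)
  finally show "dist (mollify \<eta> f x) (mollify \<eta> f y) \<le> L * dist x y"
    by (simp add: dist_real_def eq)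
qed

lemma integral_lborel_cbox:
  fixes f :: "'a::euclidean_space \<Rightarrow> 'b::euclidean_space"
  assumes "continuous_on UNIV f" "\<And>z. z \<notin> cbox a b \<Longrightarrow> f z = 0"
  shows "(LINT z|lborel. f z) = integral (cbox a b) f"
proof -
  have "(LINT z|lborel. f z) = integral UNIV f"
    using integral_lborel[OF integrable_continuous_compact_support[OF assms(1) compact_cbox assms(2)]] by simp
  also have "\<dots> = integral UNIV (\<lambda>z. if z \<in> cbox a b then f z else 0)"
    using assms(2) by (intro integral_cong) auto
  also have "\<dots> = integral (cbox a b) f" by (rule integral_restrict_UNIV)
  finally show ?thesis .
qed

text \<open>As \<open>f\<close> is only continuous, the derivative falls on the kernel; the sign
  comes from the argument \<open>z - x\<close>.\<close>

lemma mollify_C1: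
  fixes f :: "'a::euclidean_space \<Rightarrow> real"
  assumes "mollifier \<delta> \<eta>" "continuous_on UNIV f"
  shows "C1 (mollify \<eta> f)"
    and "gradient (mollify \<eta> f) = (\<lambda>x. - (LINT z|lborel. f z *\<^sub>R gradient \<eta> (z - x)))"
proof -
  let ?D = "\<lambda>x. - (LINT z|lborel. f z *\<^sub>R gradient \<eta> (z - x))"
  have C1: "C1 \<eta>" using assms(1) by (simp add: mollifier_def)
  have cg: "continuous_on UNIV (\<lambda>z. f z *\<^sub>R gradient \<eta> (z - x))" for x
    by (intro continuous_intros assms(2) continuous_on_compose2[OF C1_continuous_gradient[OF C1]]) auto
  have cf: "continuous_on UNIV (\<lambda>z. \<eta> (z - x) * f z)" for x
    by (intro continuous_intros assms(2) continuous_on_compose2[OF C1_continuous[OF C1]]) auto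
  have g0: "gradient \<eta> z = 0" if "\<delta> < norm z" for z
  proof (rule GDERIV_zero_open)
    show "open {z. \<delta> < norm z}" by (intro open_Collect_less continuous_intros)
    show "z \<in> {z. \<delta> < norm z}" using that by simp
    show "\<eta> y = 0" if "y \<in> {z. \<delta> < norm z}" for y
      using assms(1) that by (simp add: mollifier_def)
  qed
  have loc: "GDERIV (mollify \<eta> f) x0 :> ?D x0 \<and> isCont ?D x0" for x0
  proof -
    \<comment> \<open>One box contains the supports of the kernels for all \<open>x\<close> within
      distance 1 of \<open>x0\<close>. Near \<open>x0\<close> the integral thus runs over a fixed
      compact set, where the Leibniz rule applies.\<close>
    obtain a where a: "cball x0 (1 + \<delta>) \<subseteq> cbox (- a) a"
      using bounded_subset_cbox_symmetric[OF bounded_cball] by metis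
    define b where "b = - a"
    have ab: "cball x0 (1 + \<delta>) \<subseteq> cbox b a" using a by (simp add: b_def)
    define U where "U = ball x0 1"
    have far: "\<delta> < norm (z - x)" if "x \<in> U" "z \<notin> cbox b a" for x z
    proof -
      have "z \<notin> cball x0 (1 + \<delta>)" using ab that by blast
      then have "1 + \<delta> < dist x0 z" by simp
      also have "\<dots> \<le> dist x0 x + dist x z" by (rule dist_triangle)
      finally show ?thesis using that(1) by (simp add: U_def dist_norm norm_minus_commute)
    qed
    have F: "mollify \<eta> f x = integral (cbox b a) (\<lambda>z. \<eta> (z - x) * f z)" if "x \<in> U" for x
      unfolding mollify_def
    proof (rule integral_lborel_cbox[OF cf])
      show "\<eta> (z - x) * f z = 0" if "z \<notin> cbox b a" for z
        using far[OF \<open>x \<in> U\<close> that] assms(1) by (simp add: mollifier_def)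
    qed
    have D: "(LINT z|lborel. f z *\<^sub>R gradient \<eta> (z - x)) = integral (cbox b a) (\<lambda>z. f z *\<^sub>R gradient \<eta> (z - x))"
      if "x \<in> U" for x
    proof (rule integral_lborel_cbox[OF cg])
      show "f z *\<^sub>R gradient \<eta> (z - x) = 0" if "z \<notin> cbox b a" for z
        using g0[OF far[OF \<open>x \<in> U\<close> that]] by simp
    qed
    have cont2: "continuous_on (U \<times> cbox b a) (\<lambda>(x, z). f z *\<^sub>R gradient \<eta> (z - x))"
      unfolding split_beta
      by (intro continuous_intros continuous_on_compose2[OF assms(2)]
          continuous_on_compose2[OF C1_continuous_gradient[OF C1]]) auto
    have contD: "continuous_on U (\<lambda>x. integral (cbox b a) (\<lambda>z. f z *\<^sub>R gradient \<eta> (z - x)))"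
      by (rule integral_continuous_on_param[OF cont2])
    have "continuous_on U ?D"
      using D by (intro continuous_on_minus continuous_on_eq[OF contD]) simp
    then have isC: "isCont ?D x0"
      by (rule continuous_on_interior) (simp add: U_def interior_open)
    have x0: "x0 \<in> U" by (simp add: U_def)
    define G where "G x z = - (f z *\<^sub>R gradient \<eta> (z - x))" for x z
    have "((\<lambda>x. integral (cbox b a) (\<lambda>z. \<eta> (z - x) * f z)) has_derivative
        blinfun_apply (integral (cbox b a) (\<lambda>z. blinfun_inner_left (G x0 z)))) (at x0 within U)"
    proof (rule leibniz_rule[OF _ _ _ x0])
      show "((\<lambda>x. \<eta> (z - x) * f z) has_derivative blinfun_apply (blinfun_inner_left (G x z))) (at x within U)"
        for x z
      proof -
        have 1: "((\<lambda>x. z - x) has_derivative (\<lambda>h. - h)) (at x within U)"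
          by (auto intro!: derivative_eq_intros)
        have 2: "(\<eta> has_derivative (\<lambda>h. h \<bullet> gradient \<eta> (z - x))) (at (z - x))"
          using C1_GDERIV[OF C1] by (simp add: gderiv_def)
        have "((\<lambda>x. \<eta> (z - x)) has_derivative (\<lambda>h. - h \<bullet> gradient \<eta> (z - x))) (at x within U)"
          by (rule has_derivative_compose[OF 1 2])
        then have "((\<lambda>x. \<eta> (z - x) * f z) has_derivative (\<lambda>h. (- h \<bullet> gradient \<eta> (z - x)) * f z)) (at x within U)"
          by (rule has_derivative_mult_left)
        moreover have "blinfun_apply (blinfun_inner_left (G x z)) = (\<lambda>h. (- h \<bullet> gradient \<eta> (z - x)) * f z)"
          by (auto simp: G_def blinfun_inner_left.rep_eq inner_commute mult.commute)
        ultimately show ?thesis by simp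
      qed
      show "(\<lambda>z. \<eta> (z - x) * f z) integrable_on cbox b a" for x
        by (intro integrable_continuous continuous_on_subset[OF cf]) auto
      have "continuous_on (U \<times> cbox b a) (\<lambda>y. blinfun_inner_left (- (case y of (x, z) \<Rightarrow> f z *\<^sub>R gradient \<eta> (z - x))))"
        by (intro bounded_linear.continuous_on[OF bounded_linear_blinfun_inner_left] continuous_intros cont2)
      then show "continuous_on (U \<times> cbox b a) (\<lambda>(x, z). blinfun_inner_left (G x z))"
        by (simp add: G_def split_beta)
      show "convex U" by (simp add: U_def)
    qed
    moreover have "integral (cbox b a) (\<lambda>z. blinfun_inner_left (G x0 z)) = blinfun_inner_left (?D x0)"
    proof -
      have "G x0 integrable_on cbox b a"
        unfolding G_def by (intro integrable_continuous continuous_on_minus continuous_on_subset[OF cg]) auto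
      note lin = integral_linear[OF this bounded_linear_blinfun_inner_left]
      have "integral (cbox b a) (\<lambda>z. blinfun_inner_left (G x0 z)) = blinfun_inner_left (integral (cbox b a) (G x0))"
        using lin by (simp add: o_def)
      also have "integral (cbox b a) (G x0) = ?D x0"
        unfolding D[OF x0] G_def by (rule integral_neg)
      finally show ?thesis .
    qed
    ultimately have "((\<lambda>x. integral (cbox b a) (\<lambda>z. \<eta> (z - x) * f z)) has_derivative (\<lambda>h. h \<bullet> ?D x0)) (at x0 within U)"
      by (simp add: blinfun_inner_left.rep_eq inner_commute)
    then have "((\<lambda>x. integral (cbox b a) (\<lambda>z. \<eta> (z - x) * f z)) has_derivative (\<lambda>h. h \<bullet> ?D x0)) (at x0)"
      using x0 by (simp add: U_def at_within_open[of x0 "ball x0 1"])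
    then have "(mollify \<eta> f has_derivative (\<lambda>h. h \<bullet> ?D x0)) (at x0)"
      by (rule has_derivative_transform_within_open[of _ _ _ _ U]) (use x0 F in \<open>auto simp: U_def\<close>)
    with isC show ?thesis by (simp add: gderiv_def)
  qed
  then have "C1 (mollify \<eta> f) \<and> gradient (mollify \<eta> f) = ?D"
    by (intro C1_conjI) (auto intro: continuous_at_imp_continuous_on)
  then show "C1 (mollify \<eta> f)" "gradient (mollify \<eta> f) = ?D" by auto
qed

lemma lipschitz_C1_gradient_bound:
  fixes f :: "'a::euclidean_space \<Rightarrow> real"
  assumes "C1 f" "L-lipschitz_on UNIV f"
  shows "norm (gradient f x) \<le> L"
proof -
  \<comment> \<open>Differentiating in the direction of the gradient itself gives its squared norm,
    which the Lipschitz bound compares with \<open>L * norm e\<close>.\<close>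
  define e where "e = gradient f x"
  have lim: "((\<lambda>t. (f (x + t *\<^sub>R e) - f x) / t) \<longlongrightarrow> e \<bullet> e) (at 0)"
    using GDERIV_difference_quotient[OF C1_GDERIV[OF assms(1)]] by (simp add: e_def)
  have "e \<bullet> e \<le> L * norm e"
  proof (rule tendsto_upperbound[OF lim])
    have "(f (x + t *\<^sub>R e) - f x) / t \<le> L * norm e" if "t \<noteq> 0" for t
    proof -
      have "\<bar>f (x + t *\<^sub>R e) - f x\<bar> \<le> L * norm e * \<bar>t\<bar>"
        using lipschitz_onD[OF assms(2), of "x + t *\<^sub>R e" x]
        by (simp add: dist_real_def dist_norm mult_ac)
      then have "\<bar>f (x + t *\<^sub>R e) - f x\<bar> / \<bar>t\<bar> \<le> L * norm e"
        using that by (simp add: pos_divide_le_eq)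
      then show ?thesis by (simp flip: abs_divide)
    qed
    then show "\<forall>\<^sub>F t in at 0. (f (x + t *\<^sub>R e) - f x) / t \<le> L * norm e"
      by (auto simp: eventually_at_filter)
  qed simp
  then have "norm e * norm e \<le> L * norm e"
    by (simp add: dot_square_norm power2_eq_square)
  moreover have "0 \<le> L" using assms(2) lipschitz_on_nonneg by blast
  ultimately show ?thesis unfolding e_def[symmetric]
    by (cases "norm e = 0") auto
qed

section \<open>Smooth approximation of Lipschitz functions\<close>

text \<open>McShane's extension: the infimum of the cones of slope \<open>L\<close> with vertices on
  the graph over \<open>S\<close>.\<close>

lemma lipschitz_extension:
  fixes f :: "'a::metric_space \<Rightarrow> real"
  assumes "L-lipschitz_on S f" "S \<noteq> {}"
  shows "\<exists>F. L-lipschitz_on UNIV F \<and> (\<forall>x\<in>S. F x = f x)"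
proof -
  have L: "0 \<le> L" using assms(1) lipschitz_on_nonneg by blast
  have fl: "f y \<le> f z + L * dist y z" if "y \<in> S" "z \<in> S" for y z
    using lipschitz_onD[OF assms(1) that] by (simp add: dist_real_def)
  define F where "F x = (INF y\<in>S. f y + L * dist x y)" for x
  have bdd: "bdd_below ((\<lambda>y. f y + L * dist x y) ` S)" for x
  proof -
    obtain z where z: "z \<in> S" using assms(2) by blast
    have "f z - L * dist x z \<le> f y + L * dist x y" if "y \<in> S" for y
    proof -
      have "L * dist z y \<le> L * (dist x z + dist x y)"
        using L dist_triangle[of z y x] by (intro mult_left_mono) (simp_all add: dist_commute)
      then show ?thesis using fl[OF z that] by (simp add: algebra_simps)
    qed
    then show ?thesis by (intro bdd_belowI2)
  qed
  have le: "F x \<le> F x' + L * dist x x'" for x x'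
  proof -
    have "F x - L * dist x x' \<le> f y + L * dist x' y" if "y \<in> S" for y
    proof -
      have "F x \<le> f y + L * dist x y" unfolding F_def by (rule cINF_lower[OF bdd that])
      also have "\<dots> \<le> f y + L * (dist x x' + dist x' y)"
        using L dist_triangle[of x y x'] by (intro add_left_mono mult_left_mono)
      finally show ?thesis by (simp add: algebra_simps)
    qed
    then have "F x - L * dist x x' \<le> F x'"
      unfolding F_def[of x'] using assms(2) by (intro cINF_greatest)
    then show ?thesis by simp
  qed
  have "L-lipschitz_on UNIV F"
  proof (rule lipschitz_onI[OF _ L])
    fix x x'
    show "dist (F x) (F x') \<le> L * dist x x'"
      using le[of x x'] le[of x' x] by (simp add: dist_real_def dist_commute abs_le_iff)
  qed
  moreover have "F x = f x" if "x \<in> S" for x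
  proof (rule antisym)
    have "F x \<le> f x + L * dist x x" unfolding F_def by (rule cINF_lower[OF bdd that])
    then show "F x \<le> f x" by simp
    show "f x \<le> F x" unfolding F_def
      using assms(2) fl[OF that] by (intro cINF_greatest)
  qed
  ultimately show ?thesis by blast
qed

text \<open>The last clause says that smoothing spreads the support by at most
  \<open>\<delta>\<close>, which keeps it compact in the ball when the function vanishes near the
  sphere.\<close>

lemma lipschitz_C1_approx:
  fixes f :: "'a::euclidean_space \<Rightarrow> real"
  assumes "L-lipschitz_on UNIV f" "0 < \<delta>"
  shows "\<exists>F. C1 F \<and> (\<forall>x. norm (gradient F x) \<le> L) \<and> (\<forall>x. \<bar>F x - f x\<bar> \<le> L * \<delta>) \<and>
    (\<forall>x. (\<forall>z\<in>ball x \<delta>. f z = 0) \<longrightarrow> F x = 0)"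
proof -
  obtain \<eta> :: "'a \<Rightarrow> real" where \<eta>: "mollifier \<delta> \<eta>" using mollifier_exists[OF assms(2)] by blast
  have L: "0 \<le> L" using assms(1) lipschitz_on_nonneg by blast
  have c: "continuous_on UNIV f" using assms(1) lipschitz_on_continuous_on by blast
  have C1: "C1 (mollify \<eta> f)" by (rule mollify_C1[OF \<eta> c])
  show ?thesis
  proof (intro exI[of _ "mollify \<eta> f"] conjI allI impI)
    show "C1 (mollify \<eta> f)" by fact
    show "norm (gradient (mollify \<eta> f) x) \<le> L" for x
      by (rule lipschitz_C1_gradient_bound[OF C1 mollify_lipschitz[OF \<eta> assms(1)]])
    show "\<bar>mollify \<eta> f x - f x\<bar> \<le> L * \<delta>" for x
    proof (rule mollify_close[OF \<eta> c])
      fix z assume "z \<in> ball x \<delta>"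
      then have "L * dist z x \<le> L * \<delta>" using L by (intro mult_left_mono) (auto simp: dist_commute)
      then show "\<bar>f z - f x\<bar> \<le> L * \<delta>"
        using lipschitz_onD[OF assms(1), of z x] by (simp add: dist_real_def)
    qed
    show "mollify \<eta> f x = 0" if "\<forall>z\<in>ball x \<delta>. f z = 0" for x
      using mollify_close[OF \<eta> c, of x 0 0] that by simp
  qed
qed

lemma abs_lipschitz_sphere_zero:
  fixes w :: "'a::euclidean_space \<Rightarrow> real"
  assumes "K-lipschitz_on UNIV w" "\<And>x. x \<in> sphere 0 1 \<Longrightarrow> w x = 0" "norm x \<le> 1"
  shows "\<bar>w x\<bar> \<le> K * (1 - norm x)"
proof -
  obtain b :: 'a where b: "b \<in> Basis" using nonempty_Basis by blast
  \<comment> \<open>The nearest point of the sphere is the radial projection; at the centre every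
    point of the sphere has distance 1, and any unit vector will do.\<close>
  define s where "s = (if x = 0 then b else x /\<^sub>R norm x)"
  have s: "norm s = 1" using b by (simp add: s_def)
  have "dist x s = 1 - norm x"
  proof (cases "x = 0")
    case False
    have "x - s = (1 - 1 / norm x) *\<^sub>R x" using False by (simp add: s_def algebra_simps inverse_eq_divide)
    then have "dist x s = \<bar>1 - 1 / norm x\<bar> * norm x" by (simp add: dist_norm)
    also have "\<dots> = \<bar>(1 - 1 / norm x) * norm x\<bar>" by (simp add: abs_mult)
    also have "\<dots> = 1 - norm x" using False assms(3) by (simp add: algebra_simps)
    finally show ?thesis .
  qed (use s in \<open>simp add: s_def\<close>)
  moreover have "w s = 0" using assms(2) s by simp
  ultimately show ?thesis
    using lipschitz_onD[OF assms(1), of x s] by (simp add: dist_real_def)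
qed

text \<open>Clamping \<open>w\<close> between \<open>- c\<close> and \<open>c\<close>, where
  \<open>c\<close> vanishes near the sphere, gives compact support without raising the Lipschitz
  constant. Since \<open>w\<close> is controlled by the distance to the sphere, clamping costs at
  most \<open>K * \<epsilon>\<close>, and mollification costs half of that again.\<close>

lemma lipschitz_sphere_zero_C1_0_approx:
  fixes w :: "'a::euclidean_space \<Rightarrow> real"
  assumes "K-lipschitz_on UNIV w" "\<And>x. x \<in> sphere 0 1 \<Longrightarrow> w x = 0" "0 < \<epsilon>"
  shows "\<exists>\<psi>\<in>C1_0 (ball 0 1). (\<forall>x. norm (gradient \<psi> x) \<le> K) \<and> (\<forall>x\<in>ball 0 1. \<bar>\<psi> x - w x\<bar> \<le> 2 * K * \<epsilon>)"
proof -
  have K: "0 \<le> K" using assms(1) lipschitz_on_nonneg by blast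
  define c where "c x = K * max 0 (1 - \<epsilon> - norm x)" for x :: 'a
  define v where "v x = max (- c x) (min (w x) (c x))" for x
  have c0: "0 \<le> c x" for x using K by (simp add: c_def)
  have cl: "\<bar>c x - c y\<bar> \<le> K * dist x y" for x y
  proof -
    have "\<bar>c x - c y\<bar> = K * \<bar>max 0 (1 - \<epsilon> - norm x) - max 0 (1 - \<epsilon> - norm y)\<bar>"
      using K by (simp add: c_def abs_mult flip: right_diff_distrib)
    also have "\<dots> \<le> K * dist x y"
      using norm_triangle_ineq3[of x y] K by (intro mult_left_mono) (auto simp: dist_norm)
    finally show ?thesis .
  qed
  have vl: "K-lipschitz_on UNIV v"
  proof (rule lipschitz_onI[OF _ K])
    fix x y
    have "\<bar>w x - w y\<bar> \<le> K * dist x y"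
      using lipschitz_onD[OF assms(1), of x y] by (simp add: dist_real_def)
    then show "dist (v x) (v y) \<le> K * dist x y"
      using cl[of x y] unfolding v_def dist_real_def by linarith
  qed
  have vw: "\<bar>v x - w x\<bar> \<le> K * \<epsilon>" if "x \<in> ball 0 1" for x
  proof -
    have "\<bar>w x\<bar> \<le> K * (1 - norm x)"
      using abs_lipschitz_sphere_zero[OF assms(1,2)] that by simp
    also have "\<dots> \<le> K * (max 0 (1 - \<epsilon> - norm x) + \<epsilon>)"
      using K by (intro mult_left_mono) auto
    finally have "\<bar>w x\<bar> \<le> c x + K * \<epsilon>" by (simp add: c_def algebra_simps)
    moreover have "0 \<le> K * \<epsilon>" using K assms(3) by simp
    ultimately show ?thesis using c0[of x] unfolding v_def by linarith
  qed
  have v0: "v x = 0" if "1 - \<epsilon> \<le> norm x" for x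
    using that by (simp add: v_def c_def max_def)
  obtain \<psi> where \<psi>: "C1 \<psi>" "\<And>x. norm (gradient \<psi> x) \<le> K" "\<And>x. \<bar>\<psi> x - v x\<bar> \<le> K * (\<epsilon> / 2)"
      "\<And>x. (\<forall>z\<in>ball x (\<epsilon>/2). v z = 0) \<Longrightarrow> \<psi> x = 0"
    using lipschitz_C1_approx[OF vl, of "\<epsilon>/2"] assms(3) by auto
  have "\<psi> \<in> C1_0 (ball 0 1)"
  proof (rule C1_0I[OF \<psi>(1) compact_cball])
    show "cball 0 (1 - \<epsilon>/2) \<subseteq> ball (0::'a) 1" using assms(3) by auto
    show "\<psi> x = 0" if "x \<notin> cball 0 (1 - \<epsilon>/2)" for x
    proof (rule \<psi>(4), rule ballI, rule v0)
      fix z assume "z \<in> ball x (\<epsilon>/2)"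
      then have "norm (x - z) < \<epsilon>/2" by (simp add: dist_norm)
      then show "1 - \<epsilon> \<le> norm z"
        using that norm_triangle_ineq2[of x z] by simp
    qed
  qed
  moreover have "\<bar>\<psi> x - w x\<bar> \<le> 2 * K * \<epsilon>" if "x \<in> ball 0 1" for x
  proof -
    have "0 \<le> K * \<epsilon>" using K assms(3) by simp
    moreover have "\<bar>\<psi> x - v x\<bar> \<le> K * \<epsilon> / 2" using \<psi>(3)[of x] by simp
    ultimately have "\<bar>\<psi> x - w x\<bar> \<le> 2 * (K * \<epsilon>)" using vw[OF that] by linarith
    then show ?thesis by simp
  qed
  ultimately show ?thesis using \<psi>(2) by blast
qed

lemma C1_0_cutoff:
  fixes y :: "'a::euclidean_space"
  assumes "0 < a" "a < b"
  shows "\<exists>\<zeta>\<in>C1_0 (ball y b). (\<forall>x. 0 \<le> \<zeta> x \<and> \<zeta> x \<le> 1) \<and> (\<forall>x\<in>cball y a. \<zeta> x = 1)"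
proof -
  \<comment> \<open>The ramp \<open>f\<close> is 1 up to \<open>a + d\<close> and 0 from
    \<open>b - 2 * d\<close> on. Mollification at scale \<open>d\<close> leaves the value 1 on
    \<open>cball y a\<close> and a support inside \<open>cball y (b - d)\<close>.\<close>
  define d where "d = (b - a) / 4"
  have d: "0 < d" using assms by (simp add: d_def)
  obtain \<eta> :: "'a \<Rightarrow> real" where \<eta>: "mollifier d \<eta>" using mollifier_exists[OF d] by blast
  define f where "f x = max 0 (min 1 ((b - 2 * d - dist x y) / d))" for x
  have cf: "continuous_on UNIV f" unfolding f_def using d by (intro continuous_intros) auto
  have f1: "f x = 1" if "dist x y \<le> a + d" for x
  proof -
    have "4 * d = b - a" by (simp add: d_def)
    then have "d \<le> b - 2 * d - dist x y" using that by linarith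
    then show ?thesis using d by (simp add: f_def min_def)
  qed
  have f0: "f x = 0" if "b - 2 * d \<le> dist x y" for x
  proof -
    have "(b - 2 * d - dist x y) / d \<le> 0" using that d by (simp add: divide_nonpos_pos)
    then show ?thesis by (simp add: f_def)
  qed
  have "mollify \<eta> f \<in> C1_0 (ball y b)"
  proof (rule C1_0I[OF mollify_C1(1)[OF \<eta> cf] compact_cball])
    show "cball y (b - d) \<subseteq> ball y b" using d by auto
    show "mollify \<eta> f x = 0" if "x \<notin> cball y (b - d)" for x
    proof -
      have "\<bar>f z - 0\<bar> \<le> 0" if "z \<in> ball x d" for z
      proof -
        have "dist x y \<le> dist x z + dist z y" by (rule dist_triangle)
        then have "f z = 0" using that \<open>x \<notin> cball y (b - d)\<close> by (intro f0) (simp add: dist_commute)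
        then show ?thesis by simp
      qed
      then show ?thesis using mollify_close[OF \<eta> cf, of x 0 0] by simp
    qed
  qed
  moreover have "0 \<le> mollify \<eta> f x \<and> mollify \<eta> f x \<le> 1" for x
  proof -
    have "\<bar>f z - 1/2\<bar> \<le> 1/2" for z unfolding f_def by linarith
    then have "\<bar>mollify \<eta> f x - 1/2\<bar> \<le> 1/2" by (intro mollify_close[OF \<eta> cf])
    then show ?thesis by linarith
  qed
  moreover have "mollify \<eta> f x = 1" if "x \<in> cball y a" for x
  proof -
    have "\<bar>f z - 1\<bar> \<le> 0" if "z \<in> ball x d" for z
    proof -
      have "dist z y \<le> dist z x + dist x y" by (rule dist_triangle)
      then have "f z = 1" using that \<open>x \<in> cball y a\<close> by (intro f1) (simp add: dist_commute)
      then show ?thesis by simp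
    qed
    then show ?thesis using mollify_close[OF \<eta> cf, of x 1 0] by simp
  qed
  ultimately show ?thesis by blast
qed

section \<open>Weak convergence in Lebesgue spaces\<close>

abbreviation unit_ball_lebesgue :: "'a::euclidean_space measure" where
  "unit_ball_lebesgue \<equiv> lebesgue_on (ball 0 1)"

lemma finite_measure_unit_ball: "finite_measure (unit_ball_lebesgue :: 'a::euclidean_space measure)"
  by (rule finite_measure_lebesgue_on) simp

lemma integrable_unit_ball_bounded:
  fixes f :: "'a::euclidean_space \<Rightarrow> 'b::{banach, second_countable_topology}"
  assumes "f \<in> borel_measurable unit_ball_lebesgue" "\<And>x. x \<in> ball 0 1 \<Longrightarrow> norm (f x) \<le> B"
  shows "integrable unit_ball_lebesgue f"
  using assms
  by (intro finite_measure.integrable_const_bound[OF finite_measure_unit_ball, of _ B] AE_I2) auto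

lemma integrable_unit_ball_const: "integrable unit_ball_lebesgue (\<lambda>x. c::real)"
  by (rule integrable_unit_ball_bounded[of _ "\<bar>c\<bar>"]) auto

lemma measurable_unit_ball_continuous:
  fixes f :: "'a::euclidean_space \<Rightarrow> 'b::euclidean_space"
  assumes "continuous_on (ball 0 1) f"
  shows "f \<in> borel_measurable unit_ball_lebesgue"
  using assms by (intro continuous_imp_measurable_on_sets_lebesgue) auto

lemma C1_0_measurable:
  assumes "\<phi> \<in> C1_0 \<Omega>"
  shows "\<phi> \<in> borel_measurable unit_ball_lebesgue" "gradient \<phi> \<in> borel_measurable unit_ball_lebesgue"
  using C1_0_C1[OF assms] by (auto intro: measurable_unit_ball_continuous C1_continuous C1_continuous_gradient)

text \<open>Young's inequality with non-optimal constants, split at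
  \<open>a = s * b powr (p - 1)\<close>: on either side one of the two summands alone dominates. The
  weight \<open>s\<close> can be made small on the factor that is only bounded.\<close>

lemma young_eps:
  fixes a b p s :: real
  assumes "1 < p" "0 < s" "0 \<le> a" "0 \<le> b"
  shows "a * b \<le> s * b powr p + s powr (- 1 / (p - 1)) * a powr (p / (p - 1))"
proof (cases "a \<le> s * b powr (p - 1)")
  case True
  have "a * b \<le> s * b powr (p - 1) * b" using True assms by (intro mult_right_mono) auto
  also have "\<dots> = s * b powr p"
    using assms powr_add[of b "p - 1" 1] by (cases "b = 0") auto
  finally show ?thesis by (simp add: add_increasing2)
next
  case False
  then have a: "0 < a" using assms by (cases "a = 0") (auto simp: zero_le_mult_iff)
  have "b powr (p - 1) \<le> a / s" using False assms by (simp add: field_simps)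
  then have "(b powr (p - 1)) powr (1 / (p - 1)) \<le> (a / s) powr (1 / (p - 1))"
    using assms by (intro powr_mono2) auto
  then have "b \<le> (a / s) powr (1 / (p - 1))" using assms by (simp add: powr_powr)
  also have "\<dots> = a powr (1 / (p - 1)) * s powr (- 1 / (p - 1))"
    using assms by (simp add: powr_divide powr_minus_divide)
  finally have "a * b \<le> a * (a powr (1 / (p - 1)) * s powr (- 1 / (p - 1)))"
    using a by (intro mult_left_mono) auto
  also have "\<dots> = s powr (- 1 / (p - 1)) * a powr (p / (p - 1))"
  proof -
    have "1 + 1 / (p - 1) = p / (p - 1)" using assms by (simp add: field_simps)
    then have "a powr (p / (p - 1)) = a * a powr (1 / (p - 1))"
      using powr_add[of a 1 "1 / (p - 1)"] a by simp
    then show ?thesis by simp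
  qed
  finally show ?thesis using assms by (simp add: add_increasing)
qed

lemma powr_add_le:
  fixes a b q :: real
  assumes "0 \<le> a" "0 \<le> b" "0 < q"
  shows "(a + b) powr q \<le> 2 powr q * (a powr q + b powr q)"
proof -
  have "(a + b) powr q \<le> (2 * max a b) powr q" using assms by (intro powr_mono2) auto
  also have "\<dots> = 2 powr q * (max a b) powr q" using assms by (simp add: powr_mult)
  also have "\<dots> \<le> 2 powr q * (a powr q + b powr q)"
    by (intro mult_left_mono) (auto simp: max_def)
  finally show ?thesis .
qed

text \<open>A measurable function is an almost everywhere limit of continuous ones. These are
  clamped, replaced by polynomials, and cut off near the sphere; the bound \<open>R + 1\<close> is
  uniform, ready for dominated convergence.\<close>

lemma C1_0_dense_bounded:
  fixes \<Psi> :: "'a::euclidean_space \<Rightarrow> real"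
  assumes "\<Psi> \<in> borel_measurable unit_ball_lebesgue" "0 \<le> R" "\<And>x. \<bar>\<Psi> x\<bar> \<le> R"
  shows "\<exists>\<phi>::nat \<Rightarrow> 'a \<Rightarrow> real. (\<forall>n. \<phi> n \<in> C1_0 (ball 0 1)) \<and> (\<forall>n. \<forall>x\<in>ball 0 1. \<bar>\<phi> n x\<bar> \<le> R + 1) \<and>
    (AE x in unit_ball_lebesgue. (\<lambda>n. \<phi> n x) \<longlonglongrightarrow> \<Psi> x)"
proof -
  have "\<Psi> measurable_on (ball 0 1)"
    using assms(1) by (subst measurable_on_iff_borel_measurable) auto
  then obtain N and g :: "nat \<Rightarrow> 'a \<Rightarrow> real" where N: "negligible N" and g': "\<forall>n. continuous_on UNIV (g n)"
    and lim': "\<forall>x. x \<notin> N \<longrightarrow> (\<lambda>n. g n x) \<longlonglongrightarrow> (if x \<in> ball 0 1 then \<Psi> x else 0)"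
    unfolding measurable_on_def by auto
  note g = g'[rule_format] and lim = lim'[rule_format]
  define cg where "cg n x = max (- R) (min R (g n x))" for n x
  have "\<exists>P. real_polynomial_function P \<and> (\<forall>x\<in>cball 0 1. \<bar>cg n x - P x\<bar> < 1 / Suc n)" for n
  proof -
    have "continuous_on (cball 0 1) (cg n)"
      unfolding cg_def by (intro continuous_intros continuous_on_subset[OF g]) auto
    then show ?thesis
    proof (rule Stone_Weierstrass_real_polynomial_function[OF compact_cball])
      show "0 < 1 / real (Suc n)" by simp
      fix P assume "real_polynomial_function P" "\<And>x. x \<in> cball 0 1 \<Longrightarrow> \<bar>cg n x - P x\<bar> < 1 / real (Suc n)"
      then show ?thesis by (intro exI[of _ P]) simp
    qed
  qed
  then have "\<forall>n. \<exists>P. real_polynomial_function P \<and> (\<forall>x\<in>cball 0 1. \<bar>cg n x - P x\<bar> < 1 / Suc n)"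
    by (rule allI)
  from choice[OF this]
  obtain P where P: "\<And>n. real_polynomial_function (P n)"
    "\<And>n x. x \<in> cball 0 1 \<Longrightarrow> \<bar>cg n x - P n x\<bar> < 1 / Suc n" by blast
  \<comment> \<open>The radii tend to 1, so at each point of the ball the cutoffs are eventually 1.
    The double \<open>Suc\<close> makes \<open>a 0\<close> equal to 1/2, as
    \<open>C1_0_cutoff\<close> requires a positive inner radius.\<close>
  define a where "a n = 1 - inverse (real (Suc (Suc n)))" for n
  have "\<exists>\<zeta>\<in>C1_0 (ball 0 1). (\<forall>x::'a. 0 \<le> \<zeta> x \<and> \<zeta> x \<le> 1) \<and> (\<forall>x\<in>cball 0 (a n). \<zeta> x = 1)" for n
    by (rule C1_0_cutoff) (simp_all add: a_def field_simps)
  then have "\<forall>n. \<exists>\<zeta>. \<zeta> \<in> C1_0 (ball 0 1) \<and> (\<forall>x::'a. 0 \<le> \<zeta> x \<and> \<zeta> x \<le> 1) \<and> (\<forall>x\<in>cball 0 (a n). \<zeta> x = 1)"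
    unfolding Bex_def by blast
  from choice[OF this]
  obtain \<zeta> where \<zeta>: "\<And>n. \<zeta> n \<in> C1_0 (ball (0::'a) 1)" "\<And>n x. 0 \<le> \<zeta> n x" "\<And>n x. \<zeta> n x \<le> 1"
    "\<And>n x. x \<in> cball 0 (a n) \<Longrightarrow> \<zeta> n x = 1" by blast
  define \<phi> where "\<phi> n x = \<zeta> n x * P n x" for n x
  have 1: "\<phi> n \<in> C1_0 (ball 0 1)" for n
    unfolding \<phi>_def by (rule C1_0_mult[OF \<zeta>(1) C1_real_polynomial_function[OF P(1)]])
  have 2: "\<bar>\<phi> n x\<bar> \<le> R + 1" if "x \<in> ball 0 1" for n x
  proof -
    have "\<bar>cg n x - P n x\<bar> < 1 / Suc n" using P(2)[of x n] that by auto
    moreover have "1 / real (Suc n) \<le> 1" by simp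
    moreover have "\<bar>cg n x\<bar> \<le> R" using assms(2) unfolding cg_def by auto
    ultimately have "\<bar>P n x\<bar> \<le> R + 1" by linarith
    moreover have "\<bar>\<phi> n x\<bar> \<le> 1 * \<bar>P n x\<bar>"
      unfolding \<phi>_def abs_mult using \<zeta>(2,3)[of n x] by (intro mult_right_mono) auto
    ultimately show ?thesis by simp
  qed
  have 3: "(\<lambda>n. \<phi> n x) \<longlonglongrightarrow> \<Psi> x" if "x \<in> ball 0 1" "x \<notin> N" for x
  proof -
    have "(\<lambda>n. g n x) \<longlonglongrightarrow> \<Psi> x" using lim[OF that(2)] that(1) by simp
    then have "(\<lambda>n. cg n x) \<longlonglongrightarrow> max (- R) (min R (\<Psi> x))"
      unfolding cg_def by (intro tendsto_intros)
    moreover have "max (- R) (min R (\<Psi> x)) = \<Psi> x" using assms(3)[of x] by auto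
    moreover have "(\<lambda>n. P n x - cg n x) \<longlonglongrightarrow> 0"
    proof (rule Lim_null_comparison)
      show "\<forall>\<^sub>F n in sequentially. norm (P n x - cg n x) \<le> 1 / Suc n"
        using P(2)[of x] that by (intro always_eventually allI) (auto simp: abs_minus_commute less_imp_le)
      show "(\<lambda>n. 1 / real (Suc n)) \<longlonglongrightarrow> 0"
        using LIMSEQ_inverse_real_of_nat by (simp add: inverse_eq_divide)
    qed
    ultimately have "(\<lambda>n. cg n x + (P n x - cg n x)) \<longlonglongrightarrow> \<Psi> x + 0"
      by (intro tendsto_add) auto
    then have limP: "(\<lambda>n. P n x) \<longlonglongrightarrow> \<Psi> x" by simp
    have "a \<longlonglongrightarrow> 1 - 0"
      unfolding a_def by (intro tendsto_intros LIMSEQ_Suc[OF LIMSEQ_inverse_real_of_nat])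
    then have "\<forall>\<^sub>F n in sequentially. norm x < a n"
      using that(1) by (intro order_tendstoD) auto
    then have "\<forall>\<^sub>F n in sequentially. P n x = \<phi> n x"
      by eventually_elim (simp add: \<phi>_def \<zeta>(4))
    with limP show ?thesis by (rule Lim_transform_eventually)
  qed
  have "AE x in lebesgue. x \<notin> N" using N by (auto simp: negligible_iff_null_sets intro: AE_not_in)
  then have "AE x in unit_ball_lebesgue. x \<notin> N"
    by (subst AE_restrict_space_iff) auto
  then have "AE x in unit_ball_lebesgue. (\<lambda>n. \<phi> n x) \<longlonglongrightarrow> \<Psi> x"
    by (rule AE_mp) (auto intro!: AE_I2 3)
  with 1 2 show ?thesis by blast
qed

lemma C1_0_dense_Lq:
  fixes \<Psi> :: "'a::euclidean_space \<Rightarrow> real"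
  assumes "0 < q" "\<Psi> \<in> borel_measurable unit_ball_lebesgue"
    and int: "integrable unit_ball_lebesgue (\<lambda>x. \<bar>\<Psi> x\<bar> powr q)" and "0 < e"
  shows "\<exists>\<phi>\<in>C1_0 (ball 0 1). integrable unit_ball_lebesgue (\<lambda>x. \<bar>\<Psi> x - \<phi> x\<bar> powr q) \<and>
    (LINT x|unit_ball_lebesgue. \<bar>\<Psi> x - \<phi> x\<bar> powr q) < e"
proof -
  let ?M = "unit_ball_lebesgue :: 'a measure"
  note [measurable] = assms(2)
  define T where "T n x = max (- real n) (min (real n) (\<Psi> x))" for n :: nat and x
  have T_meas[measurable]: "T n \<in> borel_measurable ?M" for n unfolding T_def by measurable
  have le: "\<bar>\<Psi> x - T n x\<bar> powr q \<le> \<bar>\<Psi> x\<bar> powr q" for n x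
    using assms(1) by (intro powr_mono2) (auto simp: T_def)
  have intT: "integrable ?M (\<lambda>x. \<bar>\<Psi> x - T n x\<bar> powr q)" for n
    by (rule Bochner_Integration.integrable_bound[OF int]) (use le in auto)
  have "(\<lambda>n. LINT x|?M. \<bar>\<Psi> x - T n x\<bar> powr q) \<longlonglongrightarrow> (LINT x|?M. 0)"
  proof (rule integral_dominated_convergence[OF _ _ int])
    show "AE x in ?M. (\<lambda>n. \<bar>\<Psi> x - T n x\<bar> powr q) \<longlonglongrightarrow> 0"
    proof (rule AE_I2)
      fix x
      have "\<forall>\<^sub>F n in sequentially. \<bar>\<Psi> x - T n x\<bar> powr q = 0"
      proof -
        have "\<forall>\<^sub>F n in sequentially. nat \<lceil>\<bar>\<Psi> x\<bar>\<rceil> \<le> n" by (rule eventually_ge_at_top)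
        then show ?thesis
        proof eventually_elim
          case (elim n)
          then have "\<bar>\<Psi> x\<bar> \<le> real n" by linarith
          then have "T n x = \<Psi> x" by (auto simp: T_def)
          then show ?case by simp
        qed
      qed
      then show "(\<lambda>n. \<bar>\<Psi> x - T n x\<bar> powr q) \<longlonglongrightarrow> 0" by (rule tendsto_eventually)
    qed
  qed (use le in auto)
  \<comment> \<open>The truncation error and the smoothing error each receive this budget; the
    factor \<open>2 powr q\<close> of \<open>powr_add_le\<close> then restores exactly
    \<open>e\<close>.\<close>
  then have "\<forall>\<^sub>F n in sequentially. (LINT x|?M. \<bar>\<Psi> x - T n x\<bar> powr q) < e / 2 / 2 powr q"
    using assms(4) by (intro order_tendstoD) auto
  then obtain n where n: "(LINT x|?M. \<bar>\<Psi> x - T n x\<bar> powr q) < e / 2 / 2 powr q"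
    using eventually_happens by force
  have "\<bar>T n x\<bar> \<le> real n" for x by (auto simp: T_def)
  from C1_0_dense_bounded[OF T_meas of_nat_0_le_iff this]
  obtain \<phi> :: "nat \<Rightarrow> 'a \<Rightarrow> real" where \<phi>: "\<And>k. \<phi> k \<in> C1_0 (ball 0 1)"
    "\<And>k x. x \<in> ball 0 1 \<Longrightarrow> \<bar>\<phi> k x\<bar> \<le> real n + 1"
    "AE x in ?M. (\<lambda>k. \<phi> k x) \<longlonglongrightarrow> T n x"
    by blast
  note [measurable] = C1_0_measurable(1)[OF \<phi>(1)]
  have le2: "\<bar>T n x - \<phi> k x\<bar> powr q \<le> (2 * real n + 1) powr q" if "x \<in> ball 0 1" for x k
    using assms(1) \<phi>(2)[OF that, of k] by (intro powr_mono2) (auto simp: T_def)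
  have intphi: "integrable ?M (\<lambda>x. \<bar>T n x - \<phi> k x\<bar> powr q)" for k
    by (rule integrable_unit_ball_bounded) (use le2 in auto)
  have "(\<lambda>k. LINT x|?M. \<bar>T n x - \<phi> k x\<bar> powr q) \<longlonglongrightarrow> (LINT x|?M. 0)"
  proof (rule integral_dominated_convergence)
    show "integrable ?M (\<lambda>x. (2 * real n + 1) powr q)" by (rule integrable_unit_ball_const)
    show "AE x in ?M. (\<lambda>k. \<bar>T n x - \<phi> k x\<bar> powr q) \<longlonglongrightarrow> 0"
      using \<phi>(3)
    proof (rule AE_mp, intro AE_I2 impI)
      fix x assume "(\<lambda>k. \<phi> k x) \<longlonglongrightarrow> T n x"
      then have "(\<lambda>k. \<bar>T n x - \<phi> k x\<bar>) \<longlonglongrightarrow> \<bar>T n x - T n x\<bar>"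
        by (intro tendsto_intros)
      then show "(\<lambda>k. \<bar>T n x - \<phi> k x\<bar> powr q) \<longlonglongrightarrow> 0"
        using tendsto_zero_powrI[of "\<lambda>k. \<bar>T n x - \<phi> k x\<bar>" sequentially "\<lambda>_. q" q] assms(1) by simp
    qed
    show "AE x in ?M. norm (\<bar>T n x - \<phi> k x\<bar> powr q) \<le> (2 * real n + 1) powr q" for k
      using le2 by (intro AE_I2) auto
  qed auto
  then have "\<forall>\<^sub>F k in sequentially. (LINT x|?M. \<bar>T n x - \<phi> k x\<bar> powr q) < e / 2 / 2 powr q"
    using assms(4) by (intro order_tendstoD) auto
  then obtain k where k: "(LINT x|?M. \<bar>T n x - \<phi> k x\<bar> powr q) < e / 2 / 2 powr q"
    using eventually_happens by force
  have le3: "\<bar>\<Psi> x - \<phi> k x\<bar> powr q \<le> 2 powr q * (\<bar>\<Psi> x - T n x\<bar> powr q + \<bar>T n x - \<phi> k x\<bar> powr q)" for x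
  proof -
    have "\<bar>\<Psi> x - \<phi> k x\<bar> powr q \<le> (\<bar>\<Psi> x - T n x\<bar> + \<bar>T n x - \<phi> k x\<bar>) powr q"
      using assms(1) by (intro powr_mono2) auto
    also have "\<dots> \<le> 2 powr q * (\<bar>\<Psi> x - T n x\<bar> powr q + \<bar>T n x - \<phi> k x\<bar> powr q)"
      using assms(1) by (intro powr_add_le) auto
    finally show ?thesis .
  qed
  have int3: "integrable ?M (\<lambda>x. 2 powr q * (\<bar>\<Psi> x - T n x\<bar> powr q + \<bar>T n x - \<phi> k x\<bar> powr q))"
    using intT intphi by (intro integrable_mult_right Bochner_Integration.integrable_add)
  have int4: "integrable ?M (\<lambda>x. \<bar>\<Psi> x - \<phi> k x\<bar> powr q)"
    by (rule Bochner_Integration.integrable_bound[OF int3]) (use le3 in auto)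
  have "(LINT x|?M. \<bar>\<Psi> x - \<phi> k x\<bar> powr q)
      \<le> (LINT x|?M. 2 powr q * (\<bar>\<Psi> x - T n x\<bar> powr q + \<bar>T n x - \<phi> k x\<bar> powr q))"
    by (rule integral_mono[OF int4 int3 le3])
  also have "\<dots> = 2 powr q * ((LINT x|?M. \<bar>\<Psi> x - T n x\<bar> powr q) + (LINT x|?M. \<bar>T n x - \<phi> k x\<bar> powr q))"
    using intT intphi by simp
  also have "\<dots> < 2 powr q * (e / 2 / 2 powr q + e / 2 / 2 powr q)"
    using n k by (intro mult_strict_left_mono add_strict_mono) auto
  also have "\<dots> = e" by simp
  finally show ?thesis using int4 \<phi>(1) by blast
qed

lemma integrable_mult_conjugate:
  fixes f g :: "'a \<Rightarrow> real"
  assumes "1 < p" "f \<in> borel_measurable M" "g \<in> borel_measurable M"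
    "integrable M (\<lambda>x. \<bar>f x\<bar> powr p)" "integrable M (\<lambda>x. \<bar>g x\<bar> powr (p / (p - 1)))"
  shows "integrable M (\<lambda>x. g x * f x)"
proof (rule Bochner_Integration.integrable_bound)
  show "integrable M (\<lambda>x. \<bar>f x\<bar> powr p + \<bar>g x\<bar> powr (p / (p - 1)))"
    using assms by (intro Bochner_Integration.integrable_add)
  show "AE x in M. norm (g x * f x) \<le> norm (\<bar>f x\<bar> powr p + \<bar>g x\<bar> powr (p / (p - 1)))"
    using young_eps[OF assms(1), of 1 "\<bar>g _\<bar>" "\<bar>f _\<bar>"] by (intro AE_I2) (simp add: abs_mult)
qed (use assms in simp)

lemma integrable_inner_conjugate:
  fixes X H :: "'a \<Rightarrow> 'b::euclidean_space"
  assumes p: "1 < p" and [measurable]: "X \<in> borel_measurable M" "H \<in> borel_measurable M"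
    and "integrable M (\<lambda>x. norm (X x) powr (p / (p - 1)))" "integrable M (\<lambda>x. norm (H x) powr p)"
  shows "integrable M (\<lambda>x. X x \<bullet> H x)"
proof (rule Bochner_Integration.integrable_bound)
  show "integrable M (\<lambda>x. norm (X x) * norm (H x))"
    by (rule integrable_mult_conjugate[OF p]) (use assms in auto)
  show "AE x in M. norm (X x \<bullet> H x) \<le> norm (norm (X x) * norm (H x))"
    using Cauchy_Schwarz_ineq2 by (intro AE_I2) auto
qed measurable

text \<open>Strong convergence in the conjugate space against mere boundedness in L^p. Young's
  inequality with a small weight on the bounded factor takes the place of Hoelder's.\<close>

lemma product_tendsto_zero:
  fixes a b :: "nat \<Rightarrow> 'a \<Rightarrow> real"
  assumes p: "1 < p" and [measurable]: "\<And>n. a n \<in> borel_measurable M" "\<And>n. b n \<in> borel_measurable M"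
    and aint: "\<And>n. integrable M (\<lambda>x. \<bar>a n x\<bar> powr p)" and aC: "\<And>n. (LINT x|M. \<bar>a n x\<bar> powr p) \<le> C"
    and bint: "\<And>n. integrable M (\<lambda>x. \<bar>b n x\<bar> powr (p / (p - 1)))"
    and lim: "(\<lambda>n. LINT x|M. \<bar>b n x\<bar> powr (p / (p - 1))) \<longlonglongrightarrow> 0"
  shows "(\<lambda>n. LINT x|M. \<bar>b n x * a n x\<bar>) \<longlonglongrightarrow> 0"
proof (rule LIMSEQ_I)
  fix e :: real assume e: "0 < e"
  have C0: "0 \<le> C" by (rule order_trans[OF _ aC[of 0]]) simp
  define s where "s = e / (2 * (C + 1))"
  have s: "0 < s" using e C0 by (simp add: s_def)
  have sC: "s * C < e"
  proof -
    have "s * C \<le> s * (C + 1)" using s by simp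
    also have "s * (C + 1) = e / 2" using C0 by (simp add: s_def field_simps)
    finally show ?thesis using e by simp
  qed
  define T where "T = s powr (- 1 / (p - 1))"
  have le: "(LINT x|M. \<bar>b n x * a n x\<bar>) \<le> s * C + T * (LINT x|M. \<bar>b n x\<bar> powr (p / (p - 1)))" for n
  proof -
    have i: "integrable M (\<lambda>x. b n x * a n x)"
      by (rule integrable_mult_conjugate[OF p _ _ aint bint]) auto
    have i2: "integrable M (\<lambda>x. s * \<bar>a n x\<bar> powr p + T * \<bar>b n x\<bar> powr (p / (p - 1)))"
      using aint bint by (intro Bochner_Integration.integrable_add integrable_mult_right)
    have "(LINT x|M. \<bar>b n x * a n x\<bar>) \<le> (LINT x|M. s * \<bar>a n x\<bar> powr p + T * \<bar>b n x\<bar> powr (p / (p - 1)))"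
      using young_eps[OF p s, of "\<bar>b n _\<bar>" "\<bar>a n _\<bar>"]
      by (intro integral_mono[OF integrable_abs[OF i] i2]) (simp add: abs_mult T_def)
    also have "\<dots> = s * (LINT x|M. \<bar>a n x\<bar> powr p) + T * (LINT x|M. \<bar>b n x\<bar> powr (p / (p - 1)))"
      using aint bint by simp
    also have "\<dots> \<le> s * C + T * (LINT x|M. \<bar>b n x\<bar> powr (p / (p - 1)))"
      using aC[of n] s by (intro add_right_mono mult_left_mono) auto
    finally show ?thesis .
  qed
  have "(\<lambda>n. s * C + T * (LINT x|M. \<bar>b n x\<bar> powr (p / (p - 1)))) \<longlonglongrightarrow> s * C + T * 0"
    by (intro tendsto_intros lim)
  then have "\<forall>\<^sub>F n in sequentially. s * C + T * (LINT x|M. \<bar>b n x\<bar> powr (p / (p - 1))) < e"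
    using sC by (intro order_tendstoD) auto
  then obtain N where N: "\<And>n. N \<le> n \<Longrightarrow> s * C + T * (LINT x|M. \<bar>b n x\<bar> powr (p / (p - 1))) < e"
    unfolding eventually_sequentially by auto
  have "norm ((LINT x|M. \<bar>b n x * a n x\<bar>) - 0) < e" if "N \<le> n" for n
    using le[of n] N[OF that] by simp
  then show "\<exists>no. \<forall>n\<ge>no. norm ((LINT x|M. \<bar>b n x * a n x\<bar>) - 0) < e" by blast
qed

text \<open>The uniform L^p bound makes the pairings uniformly continuous in \<open>\<Psi>\<close>
  with respect to the conjugate norm, so convergence extends from the dense class
  \<open>C1_0\<close>.\<close>

lemma weak_convergence_Lp:
  fixes f :: "nat \<Rightarrow> 'a::euclidean_space \<Rightarrow> real"
  assumes p: "1 < p" and f[measurable]: "\<And>n. f n \<in> borel_measurable unit_ball_lebesgue"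
    and int: "\<And>n. integrable unit_ball_lebesgue (\<lambda>x. \<bar>f n x\<bar> powr p)"
    and C: "\<And>n. (LINT x|unit_ball_lebesgue. \<bar>f n x\<bar> powr p) \<le> C"
    and lim: "\<And>\<phi>. \<phi> \<in> C1_0 (ball 0 1) \<Longrightarrow> (\<lambda>n. LINT x|unit_ball_lebesgue. \<phi> x * f n x) \<longlonglongrightarrow> 0"
    and \<Psi>[measurable]: "\<Psi> \<in> borel_measurable unit_ball_lebesgue"
    and int\<Psi>: "integrable unit_ball_lebesgue (\<lambda>x. \<bar>\<Psi> x\<bar> powr (p / (p - 1)))"
  shows "(\<lambda>n. LINT x|unit_ball_lebesgue. \<Psi> x * f n x) \<longlonglongrightarrow> 0"
proof (rule LIMSEQ_I)
  let ?M = "unit_ball_lebesgue :: 'a measure"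
  fix e :: real assume e: "0 < e"
  have C0: "0 \<le> C" by (rule order_trans[OF _ C[of 0]]) simp
  \<comment> \<open>\<open>C + 1\<close> replaces \<open>C\<close> because the bound may be 0. The
    three thirds of \<open>e\<close> go to the bounded factor, the density error and the smooth
    pairing.\<close>
  define s where "s = e / (3 * (C + 1))"
  have s: "0 < s" using e C0 by (simp add: s_def)
  have sC: "s * C \<le> e / 3"
  proof -
    have "s * C \<le> s * (C + 1)" using s by simp
    also have "\<dots> = e / 3"
    proof -
      have "C + 1 \<noteq> 0" using C0 by linarith
      then show ?thesis by (simp add: s_def field_simps)
    qed
    finally show ?thesis .
  qed
  define T where "T = s powr (- 1 / (p - 1))"
  have T: "0 < T" using s by (simp add: T_def)
  let ?q = "p / (p - 1)"
  have q: "0 < ?q" using p by simp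
  obtain \<phi> where \<phi>: "\<phi> \<in> C1_0 (ball 0 1)" "integrable ?M (\<lambda>x. \<bar>\<Psi> x - \<phi> x\<bar> powr ?q)"
    "(LINT x|?M. \<bar>\<Psi> x - \<phi> x\<bar> powr ?q) < e / 3 / T"
    using C1_0_dense_Lq[OF q \<Psi> int\<Psi>, of "e / 3 / T"] e T by auto
  note [measurable] = C1_0_measurable(1)[OF \<phi>(1)]
  obtain N where N: "\<And>n. N \<le> n \<Longrightarrow> \<bar>LINT x|?M. \<phi> x * f n x\<bar> < e / 3"
    using LIMSEQ_D[OF lim[OF \<phi>(1)], of "e/3"] e by auto
  have "\<bar>LINT x|?M. \<Psi> x * f n x\<bar> < e" if "N \<le> n" for n
  proof -
    have i0: "integrable ?M (\<lambda>x. \<Psi> x * f n x)"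
      by (rule integrable_mult_conjugate[OF p f \<Psi> int int\<Psi>])
    have i1: "integrable ?M (\<lambda>x. (\<Psi> x - \<phi> x) * f n x)"
      by (rule integrable_mult_conjugate[OF p f _ int \<phi>(2)]) simp
    have "(\<lambda>x. \<phi> x * f n x) = (\<lambda>x. \<Psi> x * f n x - (\<Psi> x - \<phi> x) * f n x)"
      by (auto simp: algebra_simps)
    then have "(LINT x|?M. \<phi> x * f n x) = (LINT x|?M. \<Psi> x * f n x) - (LINT x|?M. (\<Psi> x - \<phi> x) * f n x)"
      using i0 i1 by simp
    moreover have "\<bar>LINT x|?M. (\<Psi> x - \<phi> x) * f n x\<bar> \<le> s * C + T * (LINT x|?M. \<bar>\<Psi> x - \<phi> x\<bar> powr ?q)"
    proof -
      have i2: "integrable ?M (\<lambda>x. s * \<bar>f n x\<bar> powr p + T * \<bar>\<Psi> x - \<phi> x\<bar> powr ?q)"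
        using int \<phi>(2) by (intro Bochner_Integration.integrable_add integrable_mult_right)
      have "\<bar>LINT x|?M. (\<Psi> x - \<phi> x) * f n x\<bar> \<le> (LINT x|?M. \<bar>(\<Psi> x - \<phi> x) * f n x\<bar>)"
        using integral_norm_bound[of ?M "\<lambda>x. (\<Psi> x - \<phi> x) * f n x"] by simp
      also have "\<dots> \<le> (LINT x|?M. s * \<bar>f n x\<bar> powr p + T * \<bar>\<Psi> x - \<phi> x\<bar> powr ?q)"
        using young_eps[OF p s, of "\<bar>\<Psi> _ - \<phi> _\<bar>" "\<bar>f n _\<bar>"]
        by (intro integral_mono[OF integrable_abs[OF i1] i2]) (simp add: abs_mult T_def)
      also have "\<dots> = s * (LINT x|?M. \<bar>f n x\<bar> powr p) + T * (LINT x|?M. \<bar>\<Psi> x - \<phi> x\<bar> powr ?q)"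
        using int \<phi>(2) by simp
      also have "\<dots> \<le> s * C + T * (LINT x|?M. \<bar>\<Psi> x - \<phi> x\<bar> powr ?q)"
        using C[of n] s by (intro add_right_mono mult_left_mono) auto
      finally show ?thesis .
    qed
    moreover have "T * (LINT x|?M. \<bar>\<Psi> x - \<phi> x\<bar> powr ?q) < e / 3"
    proof -
      have "T * (LINT x|?M. \<bar>\<Psi> x - \<phi> x\<bar> powr ?q) < T * (e / 3 / T)"
        using \<phi>(3) T by (intro mult_strict_left_mono)
      then show ?thesis using T by simp
    qed
    ultimately show ?thesis using N[OF that] sC by linarith
  qed
  then show "\<exists>no. \<forall>n\<ge>no. norm ((LINT x|?M. \<Psi> x * f n x) - 0) < e" by auto
qed

text \<open>Beyond \<open>s\<close>, the ratio \<open>a / s\<close> exceeds 1, and so does its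
  power. With \<open>s = 1\<close> this gives integrability on the ball from L^p; with larger
  \<open>s\<close> it suppresses high gradients as p grows.\<close>

lemma powr_ge_linear:
  fixes a s p :: real
  assumes "1 \<le> p" "0 < s" "0 \<le> a"
  shows "a \<le> s + s powr (1 - p) * a powr p"
proof (cases "a \<le> s")
  case True
  then show ?thesis by (simp add: add_increasing2)
next
  case False
  then have "1 powr (p - 1) \<le> (a / s) powr (p - 1)" using assms by (intro powr_mono2) auto
  then have "a * 1 \<le> a * (a / s) powr (p - 1)" using assms by (intro mult_left_mono) auto
  also have "\<dots> = s powr (1 - p) * (a * a powr (p - 1))"
  proof -
    have "s powr (1 - p) = 1 / s powr (p - 1)" using powr_minus_divide[of s "p - 1"] by simp
    then show ?thesis using assms by (simp add: powr_divide)
  qed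
  also have "a * a powr (p - 1) = a powr p" using False assms powr_add[of a 1 "p - 1"] by simp
  finally show ?thesis using assms by simp
qed

section \<open>Sums in L^p and the passage to L^1 on the ball\<close>

lemma integrable_powr_add:
  fixes f g :: "'a \<Rightarrow> 'b::euclidean_space"
  assumes "0 < p" and [measurable]: "f \<in> borel_measurable M" "g \<in> borel_measurable M"
    and "integrable M (\<lambda>x. norm (f x) powr p)" "integrable M (\<lambda>x. norm (g x) powr p)"
  shows "integrable M (\<lambda>x. norm (f x + g x) powr p)"
    "(LINT x|M. norm (f x + g x) powr p) \<le> 2 powr p * ((LINT x|M. norm (f x) powr p) + (LINT x|M. norm (g x) powr p))"
proof -
  have le: "norm (f x + g x) powr p \<le> 2 powr p * (norm (f x) powr p + norm (g x) powr p)" for x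
  proof -
    have "norm (f x + g x) powr p \<le> (norm (f x) + norm (g x)) powr p"
      using assms(1) by (intro powr_mono2 norm_triangle_ineq) auto
    also have "\<dots> \<le> 2 powr p * (norm (f x) powr p + norm (g x) powr p)"
      using assms(1) by (intro powr_add_le) auto
    finally show ?thesis .
  qed
  have i: "integrable M (\<lambda>x. 2 powr p * (norm (f x) powr p + norm (g x) powr p))"
    using assms by (intro integrable_mult_right Bochner_Integration.integrable_add)
  show i2: "integrable M (\<lambda>x. norm (f x + g x) powr p)"
    by (rule Bochner_Integration.integrable_bound[OF i]) (use le in auto)
  have "(LINT x|M. norm (f x + g x) powr p) \<le> (LINT x|M. 2 powr p * (norm (f x) powr p + norm (g x) powr p))"
    by (rule integral_mono[OF i2 i le])
  then show "(LINT x|M. norm (f x + g x) powr p) \<le> 2 powr p * ((LINT x|M. norm (f x) powr p) + (LINT x|M. norm (g x) powr p))"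
    using assms by simp
qed

lemma integrable_powr_diff:
  fixes f g :: "'a \<Rightarrow> 'b::euclidean_space"
  assumes "0 < p" "f \<in> borel_measurable M" "g \<in> borel_measurable M"
    and "integrable M (\<lambda>x. norm (f x) powr p)" "integrable M (\<lambda>x. norm (g x) powr p)"
  shows "integrable M (\<lambda>x. norm (f x - g x) powr p)"
    "(LINT x|M. norm (f x - g x) powr p) \<le> 2 powr p * ((LINT x|M. norm (f x) powr p) + (LINT x|M. norm (g x) powr p))"
  using integrable_powr_add[OF assms(1,2) borel_measurable_uminus[OF assms(3)]] assms(4,5) by auto

lemma integrable_of_powr:
  fixes f :: "'a::euclidean_space \<Rightarrow> 'b::euclidean_space"
  assumes "1 \<le> p" "f \<in> borel_measurable unit_ball_lebesgue"
    and "integrable unit_ball_lebesgue (\<lambda>x. norm (f x) powr p)"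
  shows "integrable unit_ball_lebesgue f"
proof (rule Bochner_Integration.integrable_bound[OF _ assms(2)])
  show "integrable unit_ball_lebesgue (\<lambda>x. 1 + norm (f x) powr p)"
    by (intro Bochner_Integration.integrable_add integrable_unit_ball_const assms(3))
  show "AE x in unit_ball_lebesgue. norm (f x) \<le> norm (1 + norm (f x) powr p)"
    using powr_ge_linear[OF assms(1), of 1 "norm (f _)"] by (intro AE_I2) auto
qed

lemma measure_unit_ball_lebesgue:
  "measure unit_ball_lebesgue (ball (0::'a::euclidean_space) 1) = measure lebesgue (ball (0::'a) 1)"
  by (rule measure_restrict_space) auto

lemma Lp_tendsto_imp_L1_tendsto:
  fixes f :: "nat \<Rightarrow> 'a::euclidean_space \<Rightarrow> real"
  assumes p: "1 < p" and m: "\<And>n. f n \<in> borel_measurable unit_ball_lebesgue"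
    and int: "\<And>n. integrable unit_ball_lebesgue (\<lambda>x. \<bar>f n x\<bar> powr p)"
    and lim: "(\<lambda>n. LINT x|unit_ball_lebesgue. \<bar>f n x\<bar> powr p) \<longlonglongrightarrow> 0"
  shows "(\<lambda>n. LINT x|unit_ball_lebesgue. \<bar>f n x\<bar>) \<longlonglongrightarrow> 0"
proof -
  \<comment> \<open>Conjugation is an involution: starting from the conjugate exponent,
    \<open>product_tendsto_zero\<close> is applied with the roles exchanged and the constant 1 as
    bounded factor.\<close>
  have q: "1 < p / (p - 1)" and qp: "p / (p - 1) / (p / (p - 1) - 1) = p"
    using p by (simp_all add: field_simps)
  have "(\<lambda>n. LINT x|unit_ball_lebesgue. \<bar>f n x * 1\<bar>) \<longlonglongrightarrow> 0"
    by (rule product_tendsto_zero[OF q, unfolded qp, OF _ m _ order_refl int lim])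
      (auto intro: integrable_unit_ball_const)
  then show ?thesis by simp
qed

lemma C1_measurable:
  assumes "C1 f"
  shows "f \<in> borel_measurable unit_ball_lebesgue" "gradient f \<in> borel_measurable unit_ball_lebesgue"
  using assms by (auto intro: measurable_unit_ball_continuous C1_continuous C1_continuous_gradient)

text \<open>Integration by parts puts both gradients onto the test function, so their difference
  tested with \<open>C1_0\<close> functions is controlled by the L^1 distance of \<open>u\<close>
  and \<open>W n\<close>. The L^p bound then upgrades each component to all conjugate
  fields.\<close>

lemma weak_convergence_gradient:
  fixes u :: "'a::euclidean_space \<Rightarrow> real"
  assumes p: "1 < p" and u: "W1p p (ball 0 1) u Du"
    and W: "\<And>n. C1 (W n)"
    and W1: "\<And>n. integrable unit_ball_lebesgue (\<lambda>x. W n x)"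
    and Wint: "\<And>n. integrable unit_ball_lebesgue (\<lambda>x. norm (gradient (W n) x) powr p)"
    and WC: "\<And>n. (LINT x|unit_ball_lebesgue. norm (gradient (W n) x) powr p) \<le> C"
    and lim: "(\<lambda>n. LINT x|unit_ball_lebesgue. \<bar>u x - W n x\<bar>) \<longlonglongrightarrow> 0"
    and \<Psi>[measurable]: "\<Psi> \<in> borel_measurable unit_ball_lebesgue"
    and int\<Psi>: "integrable unit_ball_lebesgue (\<lambda>x. norm (\<Psi> x) powr (p / (p - 1)))"
  shows "(\<lambda>n. LINT x|unit_ball_lebesgue. \<Psi> x \<bullet> gradient (W n) x) \<longlonglongrightarrow> (LINT x|unit_ball_lebesgue. \<Psi> x \<bullet> Du x)"
proof -
  let ?M = "unit_ball_lebesgue :: 'a measure"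
  let ?q = "p / (p - 1)"
  have [measurable]: "u \<in> borel_measurable ?M" "Du \<in> borel_measurable ?M"
    and uint: "integrable ?M (\<lambda>x. norm (u x) powr p)" and Dint: "integrable ?M (\<lambda>x. norm (Du x) powr p)"
    and wg: "weak_gradient (ball 0 1) u Du"
    using u by (auto simp: W1p_def Lp_def)
  note [measurable] = C1_measurable[OF W]
  have u1: "integrable ?M u" by (rule integrable_of_powr[OF _ _ uint]) (use p in auto)
  have D1: "integrable ?M Du" by (rule integrable_of_powr[OF _ _ Dint]) (use p in auto)
  have G1: "integrable ?M (gradient (W n))" for n
    by (rule integrable_of_powr[OF _ _ Wint]) (use p in auto)
  define f where "f n x = gradient (W n) x - Du x" for n x
  have [measurable]: "f n \<in> borel_measurable ?M" for n unfolding f_def by measurable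
  have p0: "0 < p" using p by simp
  have fint: "integrable ?M (\<lambda>x. norm (f n x) powr p)" for n
    unfolding f_def by (rule integrable_powr_diff(1)[OF p0 _ _ Wint Dint]) auto
  define C' where "C' = 2 powr p * (C + (LINT x|?M. norm (Du x) powr p))"
  have fC: "(LINT x|?M. norm (f n x) powr p) \<le> C'" for n
  proof -
    have "(LINT x|?M. norm (f n x) powr p)
      \<le> 2 powr p * ((LINT x|?M. norm (gradient (W n) x) powr p) + (LINT x|?M. norm (Du x) powr p))"
      unfolding f_def by (rule integrable_powr_diff(2)[OF p0 _ _ Wint Dint]) auto
    also have "\<dots> \<le> C'" unfolding C'_def using WC by (intro mult_left_mono add_right_mono) auto
    finally show ?thesis .
  qed
  have comp: "(\<lambda>n. LINT x|?M. (\<Psi> x \<bullet> e) * (f n x \<bullet> e)) \<longlonglongrightarrow> 0" if e: "e \<in> Basis" for e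
  proof (rule weak_convergence_Lp[OF p])
    have le: "\<bar>f n x \<bullet> e\<bar> powr p \<le> norm (f n x) powr p" for n x
      using p Basis_le_norm[OF e] by (intro powr_mono2) auto
    show "(\<lambda>x. f n x \<bullet> e) \<in> borel_measurable ?M" for n by measurable
    show ifp: "integrable ?M (\<lambda>x. \<bar>f n x \<bullet> e\<bar> powr p)" for n
      by (rule Bochner_Integration.integrable_bound[OF fint[of n]]) (use le in auto)
    show "(LINT x|?M. \<bar>f n x \<bullet> e\<bar> powr p) \<le> C'" for n
      by (rule order_trans[OF integral_mono[OF ifp fint le] fC])
    show "(\<lambda>x. \<Psi> x \<bullet> e) \<in> borel_measurable ?M" by measurable
    have le2: "\<bar>\<Psi> x \<bullet> e\<bar> powr ?q \<le> norm (\<Psi> x) powr ?q" for x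
      using p Basis_le_norm[OF e] by (intro powr_mono2) auto
    show "integrable ?M (\<lambda>x. \<bar>\<Psi> x \<bullet> e\<bar> powr ?q)"
      by (rule Bochner_Integration.integrable_bound[OF int\<Psi>]) (use le2 in auto)
    fix \<phi> :: "'a \<Rightarrow> real" assume \<phi>: "\<phi> \<in> C1_0 (ball 0 1)"
    obtain B where B: "0 \<le> B" "\<And>x. \<bar>\<phi> x\<bar> \<le> B" "\<And>x. norm (gradient \<phi> x) \<le> B"
      using C1_0_bounded[OF \<phi>] by blast
    note [measurable] = C1_0_measurable[OF \<phi>]
    have i\<phi>: "integrable ?M (\<lambda>x. \<phi> x *\<^sub>R H x)" if H: "integrable ?M H" for H :: "'a \<Rightarrow> 'a"
    proof (rule Bochner_Integration.integrable_bound)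
      note [measurable] = borel_measurable_integrable[OF H]
      show "integrable ?M (\<lambda>x. B * norm (H x))" using H by (intro integrable_mult_right integrable_norm)
      show "(\<lambda>x. \<phi> x *\<^sub>R H x) \<in> borel_measurable ?M" by measurable
      show "AE x in ?M. norm (\<phi> x *\<^sub>R H x) \<le> norm (B * norm (H x))"
        using B by (intro AE_I2) (simp add: mult_right_mono)
    qed
    have ig: "integrable ?M (\<lambda>x. h x *\<^sub>R gradient \<phi> x)" if H: "integrable ?M h" for h :: "'a \<Rightarrow> real"
    proof (rule Bochner_Integration.integrable_bound)
      note [measurable] = borel_measurable_integrable[OF H]
      show "integrable ?M (\<lambda>x. B * \<bar>h x\<bar>)" using H by (intro integrable_mult_right integrable_abs)
      show "(\<lambda>x. h x *\<^sub>R gradient \<phi> x) \<in> borel_measurable ?M" by measurable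
      show "AE x in ?M. norm (h x *\<^sub>R gradient \<phi> x) \<le> norm (B * \<bar>h x\<bar>)"
        using B by (intro AE_I2) (simp add: mult_right_mono mult.commute[of "\<bar>h _\<bar>"])
    qed
    have eq: "(LINT x|?M. \<phi> x *\<^sub>R f n x) = (LINT x|?M. (u x - W n x) *\<^sub>R gradient \<phi> x)" for n
    proof -
      have "(LINT x|?M. \<phi> x *\<^sub>R f n x) = (LINT x|?M. \<phi> x *\<^sub>R gradient (W n) x) - (LINT x|?M. \<phi> x *\<^sub>R Du x)"
        using i\<phi>[OF G1] i\<phi>[OF D1] by (simp add: f_def scaleR_right_diff_distrib)
      also have "(LINT x|?M. \<phi> x *\<^sub>R gradient (W n) x) = - (LINT x|?M. W n x *\<^sub>R gradient \<phi> x)"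
        using C1_weak_gradient[OF W, of "ball 0 1" n] \<phi> by (simp add: weak_gradient_def)
      also have "(LINT x|?M. \<phi> x *\<^sub>R Du x) = - (LINT x|?M. u x *\<^sub>R gradient \<phi> x)"
        using wg \<phi> by (simp add: weak_gradient_def)
      also have "- (LINT x|?M. W n x *\<^sub>R gradient \<phi> x) - - (LINT x|?M. u x *\<^sub>R gradient \<phi> x)
          = (LINT x|?M. (u x - W n x) *\<^sub>R gradient \<phi> x)"
        using ig[OF u1] ig[OF W1] by (simp add: scaleR_left_diff_distrib)
      finally show ?thesis .
    qed
    have bound: "norm (LINT x|?M. \<phi> x * (f n x \<bullet> e)) \<le> B * (LINT x|?M. \<bar>u x - W n x\<bar>)" for n
    proof -
      have f1: "integrable ?M (f n)" unfolding f_def by (intro Bochner_Integration.integrable_diff G1 D1)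
      have d1: "integrable ?M (\<lambda>x. u x - W n x)" by (intro Bochner_Integration.integrable_diff u1 W1)
      have "(LINT x|?M. \<phi> x * (f n x \<bullet> e)) = (LINT x|?M. (\<phi> x *\<^sub>R f n x) \<bullet> e)" by simp
      also have "\<dots> = (LINT x|?M. \<phi> x *\<^sub>R f n x) \<bullet> e"
        by (rule integral_inner_left) (rule i\<phi>[OF f1])
      finally have "\<bar>LINT x|?M. \<phi> x * (f n x \<bullet> e)\<bar> \<le> norm (LINT x|?M. (u x - W n x) *\<^sub>R gradient \<phi> x)"
        using Basis_le_norm[OF e, of "LINT x|?M. \<phi> x *\<^sub>R f n x"] by (simp add: eq)
      also have "\<dots> \<le> (LINT x|?M. norm ((u x - W n x) *\<^sub>R gradient \<phi> x))" by (rule integral_norm_bound)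
      also have "\<dots> \<le> (LINT x|?M. B * \<bar>u x - W n x\<bar>)"
        using B(3) by (intro integral_mono integrable_norm ig[OF d1] integrable_mult_right integrable_abs d1)
          (simp add: mult_right_mono mult.commute[of "\<bar>_\<bar>"])
      finally show ?thesis by simp
    qed
    show "(\<lambda>n. LINT x|?M. \<phi> x * (f n x \<bullet> e)) \<longlonglongrightarrow> 0"
    proof (rule Lim_null_comparison)
      show "\<forall>\<^sub>F n in sequentially. norm (LINT x|?M. \<phi> x * (f n x \<bullet> e)) \<le> B * (LINT x|?M. \<bar>u x - W n x\<bar>)"
        using bound by simp
      show "(\<lambda>n. B * (LINT x|?M. \<bar>u x - W n x\<bar>)) \<longlonglongrightarrow> 0"
        using tendsto_mult_right_zero[OF lim] .
    qed
  qed
  have iprod: "integrable ?M (\<lambda>x. \<Psi> x \<bullet> H x)"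
    if "H \<in> borel_measurable ?M" "integrable ?M (\<lambda>x. norm (H x) powr p)" for H
    by (rule integrable_inner_conjugate[OF p \<Psi> that(1) int\<Psi> that(2)])
  have icomp: "integrable ?M (\<lambda>x. (\<Psi> x \<bullet> e) * (f n x \<bullet> e))" if e: "e \<in> Basis" for n e
  proof (rule Bochner_Integration.integrable_bound)
    show "integrable ?M (\<lambda>x. norm (\<Psi> x) * norm (f n x))"
      by (rule integrable_mult_conjugate[OF p]) (use fint int\<Psi> in auto)
    show "AE x in ?M. norm ((\<Psi> x \<bullet> e) * (f n x \<bullet> e)) \<le> norm (norm (\<Psi> x) * norm (f n x))"
      using Basis_le_norm[OF e] by (intro AE_I2) (auto simp: abs_mult intro!: mult_mono)
  qed auto
  have "(\<lambda>n. (\<Sum>e\<in>Basis. (LINT x|?M. (\<Psi> x \<bullet> e) * (f n x \<bullet> e))) + (LINT x|?M. \<Psi> x \<bullet> Du x))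
      \<longlonglongrightarrow> (\<Sum>e\<in>(Basis::'a set). 0) + (LINT x|?M. \<Psi> x \<bullet> Du x)"
    by (intro tendsto_intros comp)
  moreover have "(\<Sum>e\<in>Basis. (LINT x|?M. (\<Psi> x \<bullet> e) * (f n x \<bullet> e))) + (LINT x|?M. \<Psi> x \<bullet> Du x)
      = (LINT x|?M. \<Psi> x \<bullet> gradient (W n) x)" for n
  proof -
    have "(\<Sum>e\<in>Basis. (LINT x|?M. (\<Psi> x \<bullet> e) * (f n x \<bullet> e))) = (LINT x|?M. (\<Sum>e\<in>Basis. (\<Psi> x \<bullet> e) * (f n x \<bullet> e)))"
      by (rule Bochner_Integration.integral_sum[symmetric]) (rule icomp)
    also have "\<dots> = (LINT x|?M. \<Psi> x \<bullet> gradient (W n) x - \<Psi> x \<bullet> Du x)"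
      by (simp flip: euclidean_inner add: f_def inner_diff_right)
    also have "\<dots> = (LINT x|?M. \<Psi> x \<bullet> gradient (W n) x) - (LINT x|?M. \<Psi> x \<bullet> Du x)"
      by (intro Bochner_Integration.integral_diff iprod Wint Dint) auto
    finally show ?thesis by simp
  qed
  ultimately show ?thesis by simp
qed

section \<open>The energy inequality\<close>

lemma continuous_bounded_unit_ball:
  fixes f :: "'a::euclidean_space \<Rightarrow> 'b::euclidean_space"
  assumes "continuous_on UNIV f"
  obtains B where "0 \<le> B" "\<And>x. x \<in> ball 0 1 \<Longrightarrow> norm (f x) \<le> B"
proof -
  have "compact (f ` cball 0 1)"
    by (intro compact_continuous_image continuous_on_subset[OF assms]) auto
  then obtain B where B: "\<forall>x\<in>cball 0 1. norm (f x) \<le> B"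
    using compact_imp_bounded[of "f ` cball 0 1"] unfolding bounded_iff by auto
  show thesis
    by (rule that[of "max B 0"]) (use B in \<open>auto simp: le_max_iff_disj\<close>)
qed

lemma integrable_unit_ball_continuous:
  fixes f :: "'a::euclidean_space \<Rightarrow> 'b::euclidean_space"
  assumes "continuous_on UNIV f"
  shows "integrable unit_ball_lebesgue f"
proof -
  obtain B where "0 \<le> B" "\<And>x. x \<in> ball 0 1 \<Longrightarrow> norm (f x) \<le> B"
    using continuous_bounded_unit_ball[OF assms] by blast
  then show ?thesis
    using continuous_on_subset[OF assms]
    by (intro integrable_unit_ball_bounded[of _ B] measurable_unit_ball_continuous) auto
qed

lemma integrable_unit_ball_continuous_powr:
  fixes f :: "'a::euclidean_space \<Rightarrow> 'b::euclidean_space"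
  assumes "continuous_on UNIV f" "0 < p"
  shows "integrable unit_ball_lebesgue (\<lambda>x. norm (f x) powr p)"
proof -
  obtain B where B: "0 \<le> B" "\<And>x. x \<in> ball 0 1 \<Longrightarrow> norm (f x) \<le> B"
    using continuous_bounded_unit_ball[OF assms(1)] by blast
  have [measurable]: "f \<in> borel_measurable unit_ball_lebesgue"
    using continuous_on_subset[OF assms(1)] by (intro measurable_unit_ball_continuous) auto
  show ?thesis
    by (rule integrable_unit_ball_bounded[of _ "B powr p"]) (use B assms(2) in \<open>auto intro!: powr_mono2\<close>)
qed

text \<open>Separates the boundary data from the part with compact support: \<open>F n\<close>
  smooths the \<open>L\<close>-Lipschitz extension and alone carries the constant \<open>L\<close>;
  everything of uncontrolled slope is absorbed in \<open>\<theta> n\<close>. The constant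
  \<open>C\<close> may depend on \<open>p\<close> and \<open>u\<close>; it serves only weak
  convergence.\<close>

lemma boundary_value_C1_approx:
  fixes u g Gt :: "'a::euclidean_space \<Rightarrow> real"
  assumes p: "1 < p" and u: "W1p p (ball 0 1) u Du" and bv: "boundary_value p (ball 0 1) u g"
    and Gt: "L-lipschitz_on UNIV Gt" "\<And>x. x \<in> sphere 0 1 \<Longrightarrow> Gt x = g x"
  obtains F \<theta> :: "nat \<Rightarrow> 'a \<Rightarrow> real" and C where
    "\<And>n. C1 (F n)" "\<And>n x. norm (gradient (F n) x) \<le> L" "\<And>n x. \<bar>F n x - Gt x\<bar> \<le> L"
    "\<And>n. \<theta> n \<in> C1_0 (ball 0 1)"
    "\<And>n. (LINT x|unit_ball_lebesgue. norm (gradient (\<lambda>x. F n x + \<theta> n x) x) powr p) \<le> C"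
    "(\<lambda>n. LINT x|unit_ball_lebesgue. \<bar>u x - (F n x + \<theta> n x)\<bar>) \<longlonglongrightarrow> 0"
    "AE x in unit_ball_lebesgue. (\<lambda>n. F n x + \<theta> n x) \<longlonglongrightarrow> u x"
proof -
  let ?M = "unit_ball_lebesgue :: 'a measure"
  have L: "0 \<le> L" using Gt(1) lipschitz_on_nonneg by blast
  have p0: "0 < p" "1 \<le> p" using p by auto
  have [measurable]: "u \<in> borel_measurable ?M" and uint: "integrable ?M (\<lambda>x. norm (u x) powr p)"
    using u by (auto simp: W1p_def Lp_def)
  obtain G K where G: "K-lipschitz_on (cball 0 1) G" "\<And>x. x \<in> sphere 0 1 \<Longrightarrow> G x = g x"
    and v0: "(\<lambda>x. u x - G x) \<in> W1p_0 p (ball 0 1)"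
    using bv unfolding boundary_value_def by auto
  obtain Dv \<phi> where v: "W1p p (ball 0 1) (\<lambda>x. u x - G x) Dv" and \<phi>: "\<And>k::nat. \<phi> k \<in> C1_0 (ball 0 1)"
    and lim1: "(\<lambda>k. LINT x|?M. \<bar>u x - G x - \<phi> k x\<bar> powr p) \<longlonglongrightarrow> 0"
    and lim2: "(\<lambda>k. LINT x|?M. norm (Dv x - gradient (\<phi> k) x) powr p) \<longlonglongrightarrow> 0"
    using v0 unfolding W1p_0_def by auto
  have vm[measurable]: "(\<lambda>x. u x - G x) \<in> borel_measurable ?M" and Dvm[measurable]: "Dv \<in> borel_measurable ?M"
    and vint: "integrable ?M (\<lambda>x. norm (u x - G x) powr p)" and Dvint: "integrable ?M (\<lambda>x. norm (Dv x) powr p)"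
    using v by (auto simp: W1p_def Lp_def)
  obtain Gh where Gh: "K-lipschitz_on UNIV Gh" "\<And>x. x \<in> cball 0 1 \<Longrightarrow> Gh x = G x"
    using lipschitz_extension[OF G(1)] by auto
  define K' where "K' = K + L"
  have K': "0 \<le> K'" using L Gh(1) lipschitz_on_nonneg unfolding K'_def by fastforce
  \<comment> \<open>The two extensions agree on the sphere, so their difference is approximated by
    test functions. This exchanges the given extension for \<open>Gt\<close>.\<close>
  define w where "w x = Gh x - Gt x" for x
  have wl: "K'-lipschitz_on UNIV w"
  proof (rule lipschitz_onI[OF _ K'])
    fix x y
    show "dist (w x) (w y) \<le> K' * dist x y"
      using lipschitz_onD[OF Gh(1), of x y] lipschitz_onD[OF Gt(1), of x y]
      by (simp add: dist_real_def w_def K'_def algebra_simps)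
  qed
  have w0: "w x = 0" if "x \<in> sphere 0 1" for x
    using Gh(2)[of x] G(2)[OF that] Gt(2)[OF that] that by (simp add: w_def)
  define d where "d n = inverse (real (Suc n))" for n
  have d: "0 < d n" "d n \<le> 1" for n by (auto simp: d_def inverse_le_1_iff)
  have d0: "d \<longlonglongrightarrow> 0" unfolding d_def by (rule LIMSEQ_inverse_real_of_nat)
  have "\<forall>n. \<exists>F. C1 F \<and> (\<forall>x. norm (gradient F x) \<le> L) \<and> (\<forall>x. \<bar>F x - Gt x\<bar> \<le> L * d n)"
    using lipschitz_C1_approx[OF Gt(1) d(1)] by blast
  from choice[OF this] obtain F where F: "\<And>n. C1 (F n)" "\<And>n x. norm (gradient (F n) x) \<le> L"
    "\<And>n x. \<bar>F n x - Gt x\<bar> \<le> L * d n" by blast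
  have "\<forall>n. \<exists>\<psi>. \<psi> \<in> C1_0 (ball 0 1) \<and> (\<forall>x. norm (gradient \<psi> x) \<le> K') \<and> (\<forall>x\<in>ball 0 1. \<bar>\<psi> x - w x\<bar> \<le> 2 * K' * d n)"
    using lipschitz_sphere_zero_C1_0_approx[OF wl w0 d(1)] by blast
  from choice[OF this] obtain \<psi> where \<psi>: "\<And>n. \<psi> n \<in> C1_0 (ball 0 1)" "\<And>n x. norm (gradient (\<psi> n) x) \<le> K'"
    "\<And>n x. x \<in> ball 0 1 \<Longrightarrow> \<bar>\<psi> n x - w x\<bar> \<le> 2 * K' * d n" by blast
  define \<theta> where "\<theta> n x = \<psi> n x + \<phi> n x" for n x
  have \<theta>: "\<theta> n \<in> C1_0 (ball 0 1)" for n
    unfolding \<theta>_def by (rule C1_0_add[OF \<psi>(1) \<phi>])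
  define W where "W n = (\<lambda>x. F n x + \<theta> n x)" for n
  have C1W: "C1 (W n)" for n unfolding W_def by (rule C1_add(1)[OF F(1) C1_0_C1[OF \<theta>]])
  have gradW: "gradient (W n) x = gradient (F n) x + gradient (\<psi> n) x + gradient (\<phi> n) x" for n x
    unfolding W_def C1_add(2)[OF F(1) C1_0_C1[OF \<theta>]]
    unfolding \<theta>_def C1_add(2)[OF C1_0_C1[OF \<psi>(1)] C1_0_C1[OF \<phi>]] by simp
  note [measurable] = C1_measurable[OF C1W] C1_0_measurable[OF \<phi>] C1_0_measurable[OF \<psi>(1)] C1_measurable[OF F(1)]
  have \<phi>p: "integrable ?M (\<lambda>x. norm (\<phi> n x) powr p)" "integrable ?M (\<lambda>x. norm (gradient (\<phi> n) x) powr p)" for n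
    by (intro integrable_unit_ball_continuous_powr C1_continuous C1_continuous_gradient C1_0_C1[OF \<phi>] p0)+
  have e1: "integrable ?M (\<lambda>x. \<bar>u x - G x - \<phi> n x\<bar> powr p)" for n
    using integrable_powr_diff(1)[OF p0(1) vm _ vint \<phi>p(1)[of n]] by simp
  have e1L: "(\<lambda>n. LINT x|?M. \<bar>u x - G x - \<phi> n x\<bar>) \<longlonglongrightarrow> 0"
    by (rule Lp_tendsto_imp_L1_tendsto[OF p _ e1 lim1]) measurable
  define V where "V = measure lebesgue (ball (0::'a) 1)"
  have close: "\<bar>u x - W n x\<bar> \<le> \<bar>u x - G x - \<phi> n x\<bar> + (L + 2 * K') * d n" if "x \<in> ball 0 1" for n x
  proof -
    have "\<bar>F n x + \<psi> n x - Gh x\<bar> \<le> (L + 2 * K') * d n"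
      using F(3)[of n x] \<psi>(3)[OF that, of n] by (simp add: w_def algebra_simps abs_le_iff)
    moreover have "Gh x = G x" using Gh(2)[of x] that by simp
    ultimately show ?thesis by (simp add: W_def \<theta>_def)
  qed
  have e1i: "integrable ?M (\<lambda>x. u x - G x - \<phi> n x)" for n
    by (rule integrable_of_powr[OF p0(2)]) (use e1[of n] in auto)
  note ci = integrable_unit_ball_const
  have u1: "integrable ?M u" by (rule integrable_of_powr[OF p0(2) _ uint]) auto
  have W1: "integrable ?M (W n)" for n by (rule integrable_unit_ball_continuous[OF C1_continuous[OF C1W]])
  have limW: "(\<lambda>n. LINT x|?M. \<bar>u x - W n x\<bar>) \<longlonglongrightarrow> 0"
  proof (rule Lim_null_comparison)
    have "(LINT x|?M. \<bar>u x - W n x\<bar>) \<le> (LINT x|?M. \<bar>u x - G x - \<phi> n x\<bar>) + (L + 2 * K') * d n * V" for n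
    proof -
      have "(LINT x|?M. \<bar>u x - W n x\<bar>) \<le> (LINT x|?M. \<bar>u x - G x - \<phi> n x\<bar> + (L + 2 * K') * d n)"
      proof (rule integral_mono)
        show "integrable ?M (\<lambda>x. \<bar>u x - W n x\<bar>)"
          by (intro integrable_abs Bochner_Integration.integrable_diff u1 W1)
        show "integrable ?M (\<lambda>x. \<bar>u x - G x - \<phi> n x\<bar> + (L + 2 * K') * d n)"
          by (intro Bochner_Integration.integrable_add integrable_abs e1i ci)
      qed (use close in auto)
      also have "\<dots> = (LINT x|?M. \<bar>u x - G x - \<phi> n x\<bar>) + (LINT x|?M. (L + 2 * K') * d n)"
        by (intro Bochner_Integration.integral_add integrable_abs e1i ci)
      finally show ?thesis by (simp add: V_def measure_unit_ball_lebesgue mult_ac)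
    qed
    then show "\<forall>\<^sub>F n in sequentially. norm (LINT x|?M. \<bar>u x - W n x\<bar>) \<le> (LINT x|?M. \<bar>u x - G x - \<phi> n x\<bar>) + (L + 2 * K') * d n * V"
      by simp
    have "(\<lambda>n. (LINT x|?M. \<bar>u x - G x - \<phi> n x\<bar>) + (L + 2 * K') * d n * V) \<longlonglongrightarrow> 0 + (L + 2 * K') * 0 * V"
      by (intro tendsto_intros e1L d0)
    then show "(\<lambda>n. (LINT x|?M. \<bar>u x - G x - \<phi> n x\<bar>) + (L + 2 * K') * d n * V) \<longlonglongrightarrow> 0" by simp
  qed
  have e2: "integrable ?M (\<lambda>x. norm (Dv x - gradient (\<phi> n) x) powr p)" for n
    by (rule integrable_powr_diff(1)[OF p0(1) Dvm _ Dvint \<phi>p(2)]) measurable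
  obtain C1' where C1': "\<And>n. (LINT x|?M. norm (Dv x - gradient (\<phi> n) x) powr p) \<le> C1'"
  proof -
    have "Bseq (\<lambda>n. LINT x|?M. norm (Dv x - gradient (\<phi> n) x) powr p)"
      using lim2 by (intro convergent_imp_Bseq convergentI)
    then obtain B where "\<And>n. norm (LINT x|?M. norm (Dv x - gradient (\<phi> n) x) powr p) \<le> B"
      unfolding Bseq_def by auto
    then show thesis by (intro that[of B]) (simp add: abs_le_iff)
  qed
  define C2 where "C2 = 2 powr p * ((LINT x|?M. norm (Dv x) powr p) + C1')"
  have gphi: "(LINT x|?M. norm (gradient (\<phi> n) x) powr p) \<le> C2" for n
  proof -
    have "(LINT x|?M. norm (Dv x - (Dv x - gradient (\<phi> n) x)) powr p)
      \<le> 2 powr p * ((LINT x|?M. norm (Dv x) powr p) + (LINT x|?M. norm (Dv x - gradient (\<phi> n) x) powr p))"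
      by (rule integrable_powr_diff(2)[OF p0(1) Dvm _ Dvint e2]) measurable
    also have "\<dots> \<le> C2" unfolding C2_def using C1' by (intro mult_left_mono add_left_mono) auto
    finally show ?thesis by simp
  qed
  define h where "h n x = gradient (F n) x + gradient (\<psi> n) x" for n x
  have [measurable]: "h n \<in> borel_measurable ?M" for n unfolding h_def by measurable
  have hle: "norm (h n x) powr p \<le> (L + K') powr p" for n x
  proof -
    have "norm (h n x) \<le> L + K'"
      unfolding h_def by (rule order_trans[OF norm_triangle_ineq add_mono[OF F(2) \<psi>(2)]])
    then show ?thesis using p0 by (intro powr_mono2) auto
  qed
  have hint: "integrable ?M (\<lambda>x. norm (h n x) powr p)" for n
    by (rule integrable_unit_ball_bounded[of _ "(L + K') powr p"]) (use hle in auto)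
  have hC: "(LINT x|?M. norm (h n x) powr p) \<le> (L + K') powr p * V" for n
  proof -
    have "(LINT x|?M. norm (h n x) powr p) \<le> (LINT x|?M. (L + K') powr p)"
      by (rule integral_mono[OF hint ci hle])
    then show ?thesis by (simp add: V_def measure_unit_ball_lebesgue mult.commute)
  qed
  define C where "C = 2 powr p * ((L + K') powr p * V + C2)"
  have WC: "(LINT x|?M. norm (gradient (W n) x) powr p) \<le> C" for n
  proof -
    have "(LINT x|?M. norm (h n x + gradient (\<phi> n) x) powr p)
      \<le> 2 powr p * ((LINT x|?M. norm (h n x) powr p) + (LINT x|?M. norm (gradient (\<phi> n) x) powr p))"
      by (rule integrable_powr_add(2)[OF p0(1) _ _ hint \<phi>p(2)]) measurable
    also have "\<dots> \<le> C" unfolding C_def using hC gphi by (intro mult_left_mono add_mono) auto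
    finally show ?thesis by (simp add: gradW h_def)
  qed
  \<comment> \<open>Convergence in L^1 gives convergence almost everywhere only along a subsequence;
    the other properties pass to it.\<close>
  obtain r :: "nat \<Rightarrow> nat" where r: "strict_mono r" "AE x in ?M. (\<lambda>n. u x - W (r n) x) \<longlonglongrightarrow> 0"
    using tendsto_L1_AE_subseq[of ?M "\<lambda>n x. u x - W n x"] limW u1 W1 by auto
  show thesis
  proof (rule that[of "\<lambda>n. F (r n)" "\<lambda>n. \<theta> (r n)" C])
    show "C1 (F (r n))" "norm (gradient (F (r n)) x) \<le> L" "\<theta> (r n) \<in> C1_0 (ball 0 1)" for n x
      using F \<theta> by blast+
    show "\<bar>F (r n) x - Gt x\<bar> \<le> L" for n x
    proof -
      have "L * d (r n) \<le> L * 1" using L d by (intro mult_left_mono)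
      then show ?thesis using F(3)[of "r n" x] by simp
    qed
    show "(LINT x|?M. norm (gradient (\<lambda>x. F (r n) x + \<theta> (r n) x) x) powr p) \<le> C" for n
      using WC[of "r n"] by (simp add: W_def)
    show "(\<lambda>n. LINT x|?M. \<bar>u x - (F (r n) x + \<theta> (r n) x)\<bar>) \<longlonglongrightarrow> 0"
      using LIMSEQ_subseq_LIMSEQ[OF limW r(1)] by (simp add: W_def o_def)
    show "AE x in ?M. (\<lambda>n. F (r n) x + \<theta> (r n) x) \<longlonglongrightarrow> u x"
      using r(2)
    proof (rule AE_mp, intro AE_I2 impI)
      fix x assume "(\<lambda>n. u x - W (r n) x) \<longlonglongrightarrow> 0"
      then have "(\<lambda>n. u x - (u x - W (r n) x)) \<longlonglongrightarrow> u x - 0" by (intro tendsto_intros)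
      then show "(\<lambda>n. F (r n) x + \<theta> (r n) x) \<longlonglongrightarrow> u x" by (simp add: W_def)
    qed
  qed
qed

section \<open>The flux of the p-Laplacian\<close>

definition p_flux :: "real \<Rightarrow> 'a::real_inner \<Rightarrow> 'a" where
  "p_flux p v = norm v powr (p - 2) *\<^sub>R v"

lemma norm_p_flux:
  "norm (p_flux p v) = norm v powr (p - 1)"
proof (cases "v = 0")
  case False
  then show ?thesis using powr_add[of "norm v" "p - 2" 1] by (simp add: p_flux_def)
qed (simp add: p_flux_def)

text \<open>The flux of an L^p gradient lies in the conjugate space, hence is admissible in
  \<open>weak_convergence_gradient\<close>.\<close>

lemma norm_p_flux_powr:
  assumes "1 < p"
  shows "norm (p_flux p v) powr (p / (p - 1)) = norm v powr p"
  using assms by (simp add: norm_p_flux powr_powr)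

lemma p_flux_inner_self: "p_flux p v \<bullet> v = norm v powr p"
proof (cases "v = 0")
  case False
  then show ?thesis using powr_add[of "norm v" "p - 2" 2]
    by (simp add: p_flux_def dot_square_norm)
qed (simp add: p_flux_def)

lemma p_flux_measurable[measurable]:
  fixes f :: "'a \<Rightarrow> 'b::euclidean_space"
  assumes [measurable]: "f \<in> borel_measurable M"
  shows "(\<lambda>x. p_flux p (f x)) \<in> borel_measurable M"
  unfolding p_flux_def by measurable

text \<open>Cauchy-Schwarz reduces the claim to the scalar case, where \<open>t powr (p - 1)\<close>
  is increasing.\<close>

lemma p_flux_monotone:
  fixes a b :: "'a::real_inner"
  assumes "1 < p"
  shows "0 \<le> (p_flux p a - p_flux p b) \<bullet> (a - b)"
proof -
  let ?A = "norm a" and ?B = "norm b"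
  have "p_flux p a \<bullet> b \<le> ?A powr (p - 1) * ?B" "p_flux p b \<bullet> a \<le> ?B powr (p - 1) * ?A"
    using norm_cauchy_schwarz[of "p_flux p a" b] norm_cauchy_schwarz[of "p_flux p b" a]
    by (simp_all add: norm_p_flux)
  moreover have "norm v powr p = norm v powr (p - 1) * norm v" for v :: 'a
    using powr_add[of "norm v" "p - 1" 1] by (cases "v = 0") auto
  ultimately have "(?A powr (p - 1) - ?B powr (p - 1)) * (?A - ?B) \<le> (p_flux p a - p_flux p b) \<bullet> (a - b)"
    by (simp add: inner_diff_left inner_diff_right p_flux_inner_self algebra_simps)
  moreover have "0 \<le> (?A powr (p - 1) - ?B powr (p - 1)) * (?A - ?B)"
  proof (cases "?B \<le> ?A")
    case True
    then show ?thesis using assms by (intro mult_nonneg_nonneg) (auto intro!: powr_mono2)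
  next
    case False
    then show ?thesis using assms by (intro mult_nonpos_nonpos) (auto intro!: powr_mono2)
  qed
  ultimately show ?thesis by linarith
qed

text \<open>The flux of \<open>u\<close> is paired with the gradient of
  \<open>F n + \<theta> n\<close>. The first part is bounded through \<open>L\<close>, the second is
  a legitimate use of the equation, and weak convergence turns the left side into the
  energy.\<close>

lemma energy_inequality:
  fixes u g Gt f :: "'a::euclidean_space \<Rightarrow> real"
  assumes p: "1 < p" and u: "W1p p (ball 0 1) u Du" and bv: "boundary_value p (ball 0 1) u g"
    and Gt: "L-lipschitz_on UNIV Gt" "\<And>x. x \<in> sphere 0 1 \<Longrightarrow> Gt x = g x"
    and f[measurable]: "f \<in> borel_measurable unit_ball_lebesgue"
    and fM: "\<And>x. x \<in> ball 0 1 \<Longrightarrow> \<bar>f x\<bar> \<le> M"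
    and eq: "\<And>\<phi>. \<phi> \<in> C1_0 (ball 0 1) \<Longrightarrow>
      (LINT x|unit_ball_lebesgue. p_flux p (Du x) \<bullet> gradient \<phi> x) = - (LINT x|unit_ball_lebesgue. f x * \<phi> x)"
  shows "(LINT x|unit_ball_lebesgue. norm (Du x) powr p)
    \<le> 2 * (measure lebesgue (ball (0::'a) 1) * (2 * L) powr p
          + M * ((LINT x|unit_ball_lebesgue. \<bar>u x - Gt x\<bar>) + L * measure lebesgue (ball (0::'a) 1)))"
proof -
  let ?M = "unit_ball_lebesgue :: 'a measure"
  define V where "V = measure lebesgue (ball (0::'a) 1)"
  have L: "0 \<le> L" using Gt(1) lipschitz_on_nonneg by blast
  have M: "0 \<le> M" using fM[of 0] by simp
  have p0: "0 < p" "1 \<le> p" using p by auto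
  have [measurable]: "u \<in> borel_measurable ?M" "Du \<in> borel_measurable ?M"
    and uint: "integrable ?M (\<lambda>x. norm (u x) powr p)" and Dint: "integrable ?M (\<lambda>x. norm (Du x) powr p)"
    using u by (auto simp: W1p_def Lp_def)
  obtain F \<theta> :: "nat \<Rightarrow> 'a \<Rightarrow> real" and C where F: "\<And>n. C1 (F n)" "\<And>n x. norm (gradient (F n) x) \<le> L"
    "\<And>n x. \<bar>F n x - Gt x\<bar> \<le> L" and \<theta>: "\<And>n. \<theta> n \<in> C1_0 (ball 0 1)"
    and C: "\<And>n. (LINT x|?M. norm (gradient (\<lambda>x. F n x + \<theta> n x) x) powr p) \<le> C"
    and lim: "(\<lambda>n. LINT x|?M. \<bar>u x - (F n x + \<theta> n x)\<bar>) \<longlonglongrightarrow> 0"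
    by (rule boundary_value_C1_approx[OF p u bv Gt]) (assumption, (rule that; assumption))
  let ?W = "\<lambda>n x. F n x + \<theta> n x"
  have C1W: "C1 (?W n)" for n by (rule C1_add(1)[OF F(1) C1_0_C1[OF \<theta>]])
  note [measurable] = C1_measurable[OF C1W] C1_0_measurable[OF \<theta>] C1_measurable[OF F(1)]
  have W1: "integrable ?M (?W n)" for n by (rule integrable_unit_ball_continuous[OF C1_continuous[OF C1W]])
  have Gtc: "continuous_on UNIV Gt" using Gt(1) lipschitz_on_continuous_on by blast
  have Gt1: "integrable ?M Gt" by (rule integrable_unit_ball_continuous[OF Gtc])
  have u1: "integrable ?M u" by (rule integrable_of_powr[OF p0(2) _ uint]) auto
  note ci = integrable_unit_ball_const
  have Aint: "integrable ?M (\<lambda>x. norm (p_flux p (Du x)) powr (p / (p - 1)))"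
    using Dint by (simp add: norm_p_flux_powr[OF p])
  have limA: "(\<lambda>n. LINT x|?M. p_flux p (Du x) \<bullet> gradient (?W n) x) \<longlonglongrightarrow> (LINT x|?M. p_flux p (Du x) \<bullet> Du x)"
    by (rule weak_convergence_gradient[OF p u C1W W1 _ C lim _ Aint])
      (auto intro!: integrable_unit_ball_continuous_powr C1_continuous_gradient C1W p0)
  have Dp1: "integrable ?M (\<lambda>x. norm (Du x) powr (p - 1))"
  proof (rule Bochner_Integration.integrable_bound)
    show "integrable ?M (\<lambda>x. 1 + norm (Du x) powr p)"
      using Dint ci by (intro Bochner_Integration.integrable_add)
    have "norm v powr (p - 1) \<le> 1 + norm v powr p" for v :: 'a
    proof (cases "norm v \<le> 1")
      case True
      then have "norm v powr (p - 1) \<le> 1 powr (p - 1)" using p by (intro powr_mono2) auto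
      then show ?thesis by (simp add: add_increasing2)
    next
      case False
      then have "norm v powr (p - 1) \<le> norm v powr p" by (intro powr_mono) auto
      then show ?thesis by simp
    qed
    then show "AE x in ?M. norm (norm (Du x) powr (p - 1)) \<le> norm (1 + norm (Du x) powr p)"
      by (intro AE_I2) auto
  qed auto
  have Ai: "integrable ?M (\<lambda>x. p_flux p (Du x) \<bullet> gradient h x)" if h: "C1 h" for h
    by (rule integrable_inner_conjugate[OF p _ C1_measurable(2)[OF h] Aint
          integrable_unit_ball_continuous_powr[OF C1_continuous_gradient[OF h] p0(1)]]) measurable
  define I where "I = (LINT x|?M. norm (Du x) powr p)"
  define J where "J = (LINT x|?M. norm (Du x) powr (p - 1))"
  define U where "U = (LINT x|?M. \<bar>u x - Gt x\<bar>)"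
  have le: "(LINT x|?M. p_flux p (Du x) \<bullet> gradient (?W n) x)
    \<le> L * J + M * ((LINT x|?M. \<bar>u x - ?W n x\<bar>) + U + L * V)" for n
  proof -
    obtain B where B: "\<And>x. \<bar>\<theta> n x\<bar> \<le> B"
      using C1_0_bounded[OF \<theta>] by blast
    have i1: "integrable ?M (\<lambda>x. p_flux p (Du x) \<bullet> gradient (F n) x)" by (rule Ai[OF F(1)])
    have i2: "integrable ?M (\<lambda>x. p_flux p (Du x) \<bullet> gradient (\<theta> n) x)" by (rule Ai[OF C1_0_C1[OF \<theta>]])
    have "(LINT x|?M. p_flux p (Du x) \<bullet> gradient (?W n) x)
      = (LINT x|?M. p_flux p (Du x) \<bullet> gradient (F n) x) + (LINT x|?M. p_flux p (Du x) \<bullet> gradient (\<theta> n) x)"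
      using i1 i2 by (simp add: C1_add(2)[OF F(1) C1_0_C1[OF \<theta>]] inner_add_right)
    also have "(LINT x|?M. p_flux p (Du x) \<bullet> gradient (F n) x) \<le> (LINT x|?M. L * norm (Du x) powr (p - 1))"
    proof (rule integral_mono[OF i1 integrable_mult_right[OF Dp1]])
      fix x
      have "p_flux p (Du x) \<bullet> gradient (F n) x \<le> norm (Du x) powr (p - 1) * norm (gradient (F n) x)"
        using norm_cauchy_schwarz[of "p_flux p (Du x)" "gradient (F n) x"] by (simp add: norm_p_flux)
      also have "\<dots> \<le> norm (Du x) powr (p - 1) * L" using F(2) by (intro mult_left_mono) auto
      finally show "p_flux p (Du x) \<bullet> gradient (F n) x \<le> L * norm (Du x) powr (p - 1)"
        by (simp add: mult.commute)
    qed
    also have "\<dots> = L * J" by (simp add: J_def)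
    also have "(LINT x|?M. p_flux p (Du x) \<bullet> gradient (\<theta> n) x) = - (LINT x|?M. f x * \<theta> n x)"
      by (rule eq[OF \<theta>])
    also have "- (LINT x|?M. f x * \<theta> n x) \<le> (LINT x|?M. M * (\<bar>u x - ?W n x\<bar> + \<bar>u x - Gt x\<bar> + L))"
    proof -
      have "\<bar>f x * \<theta> n x\<bar> \<le> M * B" if "x \<in> ball 0 1" for x
        unfolding abs_mult using fM[OF that] B[of x] M by (intro mult_mono) auto
      then have i: "integrable ?M (\<lambda>x. f x * \<theta> n x)"
        by (intro integrable_unit_ball_bounded[of _ "M * B"]) auto
      have "- (LINT x|?M. f x * \<theta> n x) = (LINT x|?M. - (f x * \<theta> n x))" by simp
      also have "\<dots> \<le> (LINT x|?M. M * (\<bar>u x - ?W n x\<bar> + \<bar>u x - Gt x\<bar> + L))"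
      proof (rule integral_mono)
        show "integrable ?M (\<lambda>x. - (f x * \<theta> n x))" using i by simp
        show "integrable ?M (\<lambda>x. M * (\<bar>u x - ?W n x\<bar> + \<bar>u x - Gt x\<bar> + L))"
          by (intro integrable_mult_right Bochner_Integration.integrable_add integrable_abs
              Bochner_Integration.integrable_diff u1 W1 Gt1 ci)
        fix x :: 'a assume "x \<in> space ?M"
        then have x: "x \<in> ball 0 1" by simp
        \<comment> \<open>\<open>\<theta> n\<close> is the sum of \<open>W n - u\<close>,
          \<open>u - Gt\<close> and \<open>Gt - F n\<close>; the last is at most \<open>L\<close> in
          absolute value.\<close>
        have "\<bar>\<theta> n x\<bar> \<le> \<bar>u x - ?W n x\<bar> + \<bar>u x - Gt x\<bar> + L" using F(3)[of n x] by linarith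
        then have "\<bar>f x\<bar> * \<bar>\<theta> n x\<bar> \<le> M * (\<bar>u x - ?W n x\<bar> + \<bar>u x - Gt x\<bar> + L)"
          using fM[OF x] M by (intro mult_mono) auto
        then show "- (f x * \<theta> n x) \<le> M * (\<bar>u x - ?W n x\<bar> + \<bar>u x - Gt x\<bar> + L)"
          unfolding abs_mult[symmetric] by linarith
      qed
      finally show ?thesis .
    qed
    also have "\<dots> = M * (LINT x|?M. \<bar>u x - ?W n x\<bar> + \<bar>u x - Gt x\<bar> + L)" by simp
    also have "(LINT x|?M. \<bar>u x - ?W n x\<bar> + \<bar>u x - Gt x\<bar> + L)
       = (LINT x|?M. \<bar>u x - ?W n x\<bar> + \<bar>u x - Gt x\<bar>) + (LINT x|?M. L)"
      by (intro Bochner_Integration.integral_add Bochner_Integration.integrable_add integrable_abs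
              Bochner_Integration.integrable_diff u1 W1 Gt1 ci)
    also have "(LINT x|?M. \<bar>u x - ?W n x\<bar> + \<bar>u x - Gt x\<bar>) = (LINT x|?M. \<bar>u x - ?W n x\<bar>) + U"
      unfolding U_def
      by (intro Bochner_Integration.integral_add integrable_abs Bochner_Integration.integrable_diff u1 W1 Gt1)
    also have "(LINT x|?M. L) = L * V" by (simp add: V_def measure_unit_ball_lebesgue)
    finally show ?thesis by simp
  qed
  have "I \<le> L * J + M * (0 + U + L * V)"
  proof (rule LIMSEQ_le)
    show "(\<lambda>n. LINT x|?M. p_flux p (Du x) \<bullet> gradient (?W n) x) \<longlonglongrightarrow> I"
      using limA by (simp add: p_flux_inner_self I_def)
    show "(\<lambda>n. L * J + M * ((LINT x|?M. \<bar>u x - ?W n x\<bar>) + U + L * V)) \<longlonglongrightarrow> L * J + M * (0 + U + L * V)"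
      by (intro tendsto_intros lim)
  qed (use le in auto)
  \<comment> \<open>Half of the energy is absorbed on the left. The pointwise split is at gradient
    length \<open>2 * L\<close>, which is the origin of the base \<open>2 * L\<close> in the
    bound.\<close>
  moreover have "L * J \<le> I / 2 + V * (2 * L) powr p"
  proof -
    have le: "L * norm v powr (p - 1) \<le> norm v powr p / 2 + (2 * L) powr p" for v :: 'a
    proof (cases "2 * L \<le> norm v")
      case True
      have "L * norm v powr (p - 1) \<le> (norm v / 2) * norm v powr (p - 1)"
        using True by (intro mult_right_mono) auto
      also have "\<dots> = norm v powr p / 2"
        using powr_add[of "norm v" 1 "p - 1"] by (cases "v = 0") auto
      finally show ?thesis by (simp add: add_increasing2)
    next
      case False
      then have "norm v powr (p - 1) \<le> (2 * L) powr (p - 1)" using p by (intro powr_mono2) auto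
      then have "L * norm v powr (p - 1) \<le> (2 * L) * (2 * L) powr (p - 1)"
        using L by (intro mult_mono) auto
      also have "\<dots> = (2 * L) powr p"
        using powr_add[of "2 * L" 1 "p - 1"] L by (cases "L = 0") auto
      finally show ?thesis by (simp add: add_increasing)
    qed
    have "L * J = (LINT x|?M. L * norm (Du x) powr (p - 1))" by (simp add: J_def)
    also have "\<dots> \<le> (LINT x|?M. norm (Du x) powr p / 2 + (2 * L) powr p)"
      using Dp1 Dint ci le by (intro integral_mono integrable_mult_right Bochner_Integration.integrable_add) auto
    also have "\<dots> = (LINT x|?M. norm (Du x) powr p / 2) + (LINT x|?M. (2 * L) powr p)"
      using Dint ci by (intro Bochner_Integration.integral_add) auto
    finally show ?thesis by (simp add: I_def V_def measure_unit_ball_lebesgue)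
  qed
  ultimately have "I \<le> 2 * (V * (2 * L) powr p + M * (U + L * V))" by simp
  then show ?thesis by (simp only: I_def U_def V_def)
qed

section \<open>Lipschitz continuity of the limit\<close>

text \<open>The mollified gradient is a mean of \<open>Du\<close> with a kernel of integral 1, so
  the part of \<open>Du\<close> below \<open>t\<close> contributes \<open>t\<close> and the excess
  is paid for by the energy. \<open>mollify\<close> integrates over the whole space, hence the
  continuous substitute \<open>f\<close> agreeing with \<open>u\<close> well inside the
  ball.\<close>

lemma gradient_mollify_bound:
  fixes u :: "'a::euclidean_space \<Rightarrow> real"
  assumes p: "1 \<le> p" and u: "W1p p (ball 0 1) u Du"
    and \<eta>: "mollifier \<delta> \<eta>" "\<And>z. \<eta> z \<le> B" and \<delta>: "0 < \<delta>"
    and f: "continuous_on UNIV f" "\<And>z. z \<in> cball 0 (1 - \<delta>) \<Longrightarrow> f z = u z"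
    and x: "norm x < 1 - 2 * \<delta>" and t: "0 < t"
  shows "norm (gradient (mollify \<eta> f) x)
    \<le> t + B * t powr (1 - p) * (LINT z|unit_ball_lebesgue. norm (Du z) powr p)"
proof -
  let ?M = "unit_ball_lebesgue :: 'a measure"
  have [measurable]: "Du \<in> borel_measurable ?M" and Dint: "integrable ?M (\<lambda>x. norm (Du x) powr p)"
    and wg: "weak_gradient (ball 0 1) u Du"
    using u by (auto simp: W1p_def Lp_def)
  define \<phi> where "\<phi> z = \<eta> (z - x)" for z
  have C1\<eta>: "C1 \<eta>" using \<eta>(1) by (simp add: mollifier_def)
  have C1\<phi>: "C1 \<phi>" unfolding \<phi>_def by (rule C1_translate(1)[OF C1\<eta>])
  have g\<phi>: "gradient \<phi> = (\<lambda>z. gradient \<eta> (z - x))" unfolding \<phi>_def by (rule C1_translate(2)[OF C1\<eta>])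
  have sub: "cball x \<delta> \<subseteq> cball 0 (1 - \<delta>)"
  proof
    fix z assume "z \<in> cball x \<delta>"
    then have "norm (z - x) \<le> \<delta>" by (simp add: dist_norm norm_minus_commute)
    then show "z \<in> cball 0 (1 - \<delta>)" using norm_triangle_ineq[of x "z - x"] x by simp
  qed
  have sub2: "cball 0 (1 - \<delta>) \<subseteq> ball (0::'a) 1" using \<delta> by auto
  have \<phi>0: "\<phi> z = 0" if "z \<notin> cball x \<delta>" for z
    using \<eta>(1) that by (simp add: \<phi>_def mollifier_def dist_norm norm_minus_commute)
  have \<phi>C: "\<phi> \<in> C1_0 (ball 0 1)"
    by (rule C1_0I[OF C1\<phi> compact_cball[of x \<delta>]]) (use sub sub2 \<phi>0 in auto)
  have g0: "gradient \<phi> z = 0" if "z \<notin> cball x \<delta>" for z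
  proof (rule GDERIV_zero_open)
    show "open (- cball x \<delta>)" by (simp add: open_Compl)
    show "z \<in> - cball x \<delta>" using that by simp
    show "\<phi> y = 0" if "y \<in> - cball x \<delta>" for y using \<phi>0[of y] that by simp
  qed
  have fu: "f z *\<^sub>R gradient \<phi> z = u z *\<^sub>R gradient \<phi> z" for z
    using g0[of z] f(2)[of z] sub by (cases "z \<in> cball x \<delta>") auto
  have cg: "continuous_on UNIV (\<lambda>z. f z *\<^sub>R gradient \<phi> z)"
    by (intro continuous_intros f(1) C1_continuous_gradient[OF C1\<phi>])
  have sb: "ball (0::'a) 1 \<in> sets lebesgue" by simp
  have nb: "z \<notin> cball x \<delta>" if "z \<notin> ball 0 1" for z using that sub sub2 by blast
  have "gradient (mollify \<eta> f) x = - (LINT z|lborel. f z *\<^sub>R gradient \<phi> z)"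
    by (simp add: mollify_C1(2)[OF \<eta>(1) f(1)] g\<phi>)
  also have "(LINT z|lborel. f z *\<^sub>R gradient \<phi> z) = (LINT z|?M. f z *\<^sub>R gradient \<phi> z)"
    using integral_lebesgue_on_support[OF cg sb] g0 nb by simp
  also have "\<dots> = (LINT z|?M. u z *\<^sub>R gradient \<phi> z)" by (simp only: fu)
  also have "\<dots> = - (LINT z|?M. \<phi> z *\<^sub>R Du z)" using wg \<phi>C by (simp add: weak_gradient_def)
  finally have "gradient (mollify \<eta> f) x = (LINT z|?M. \<phi> z *\<^sub>R Du z)" by simp
  then have "norm (gradient (mollify \<eta> f) x) \<le> (LINT z|?M. norm (\<phi> z *\<^sub>R Du z))"
    by (simp only: integral_norm_bound)
  also have "\<dots> \<le> (LINT z|?M. t * \<phi> z + B * t powr (1 - p) * norm (Du z) powr p)"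
  proof (rule integral_mono)
    have i\<phi>: "integrable ?M \<phi>" by (rule integrable_unit_ball_continuous[OF C1_continuous[OF C1\<phi>]])
    show i: "integrable ?M (\<lambda>z. t * \<phi> z + B * t powr (1 - p) * norm (Du z) powr p)"
      using Dint i\<phi> by (intro Bochner_Integration.integrable_add integrable_mult_right)
    have le: "norm (\<phi> z *\<^sub>R Du z) \<le> t * \<phi> z + B * t powr (1 - p) * norm (Du z) powr p" for z
    proof -
      have \<phi>z: "0 \<le> \<phi> z" "\<phi> z \<le> B" using \<eta> by (auto simp: \<phi>_def mollifier_def)
      have "norm (\<phi> z *\<^sub>R Du z) = \<phi> z * norm (Du z)" using \<phi>z by simp
      also have "\<dots> \<le> \<phi> z * (t + t powr (1 - p) * norm (Du z) powr p)"
        using \<phi>z powr_ge_linear[OF p t, of "norm (Du z)"] by (intro mult_left_mono) auto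
      also have "\<dots> = t * \<phi> z + \<phi> z * (t powr (1 - p) * norm (Du z) powr p)" by (simp add: algebra_simps)
      also have "\<phi> z * (t powr (1 - p) * norm (Du z) powr p) \<le> B * (t powr (1 - p) * norm (Du z) powr p)"
        using \<phi>z by (intro mult_right_mono) auto
      finally show ?thesis by (simp add: mult.assoc)
    qed
    show "norm (\<phi> z *\<^sub>R Du z) \<le> t * \<phi> z + B * t powr (1 - p) * norm (Du z) powr p" for z by (rule le)
    note [measurable] = C1_0_measurable(1)[OF \<phi>C]
    show "integrable ?M (\<lambda>z. norm (\<phi> z *\<^sub>R Du z))"
      by (rule Bochner_Integration.integrable_bound[OF i])
        (use le in \<open>auto intro!: AE_I2 order_trans[OF _ abs_ge_self]\<close>)
  qed
  also have "\<dots> = t * (LINT z|?M. \<phi> z) + B * t powr (1 - p) * (LINT z|?M. norm (Du z) powr p)"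
    using Dint integrable_unit_ball_continuous[OF C1_continuous[OF C1\<phi>]] by simp
  also have "(LINT z|?M. \<phi> z) = 1"
  proof -
    have "(LINT z|?M. \<phi> z) = (LINT z|lborel. \<phi> z)"
      by (rule integral_lebesgue_on_support[OF C1_continuous[OF C1\<phi>] sb]) (use \<phi>0 nb in simp)
    also have "\<dots> = 1" unfolding \<phi>_def by (rule integral_mollifier_shift[OF \<eta>(1)])
    finally show ?thesis .
  qed
  finally show ?thesis by simp
qed

lemma powr_tendsto_zero_at_top:
  fixes c :: real
  assumes "0 \<le> c" "c < 1" "filterlim p at_top F"
  shows "((\<lambda>k. c powr p k) \<longlongrightarrow> 0) F"
proof (cases "c = 0")
  case False
  then have "ln c < 0" using assms by simp
  then have "filterlim (\<lambda>k. ln c * p k) at_bot F"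
    by (intro filterlim_tendsto_neg_mult_at_bot[OF tendsto_const _ assms(3)])
  then have "((\<lambda>k. exp (ln c * p k)) \<longlongrightarrow> 0) F"
    by (rule filterlim_compose[OF exp_at_bot])
  then show ?thesis using False by (simp add: powr_def mult.commute)
qed simp

text \<open>The order of choices matters: the kernel, and with it its supremum \<open>B\<close>, is
  fixed before \<open>k\<close>. The factor \<open>B\<close>, however large, is then beaten by the
  geometric decay in \<open>p k\<close>.\<close>

lemma uniform_limit_W1p_lipschitz:
  fixes u :: "nat \<Rightarrow> 'a::euclidean_space \<Rightarrow> real"
  assumes p: "\<And>k. 1 < p k" "filterlim p at_top sequentially"
    and u: "\<And>k. W1p (p k) (ball 0 1) (u k) (Du k)" "\<And>k. continuous_on (ball 0 1) (u k)"
    and L: "0 \<le> L"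
    and bound: "\<And>k. (LINT z|unit_ball_lebesgue. norm (Du k z) powr p k) \<le> 2 * (V * (2 * L) powr p k + D)"
    and lim: "uniform_limit (ball 0 1) u v sequentially"
    and xy: "x \<in> ball 0 1" "y \<in> ball 0 1"
  shows "\<bar>v x - v y\<bar> \<le> (2 * L + 2) * dist x y"
proof (rule field_le_epsilon)
  fix e0 :: real assume e0: "0 < e0"
  \<comment> \<open>Replacing \<open>v\<close> by the mollified function at \<open>x\<close> and
    \<open>y\<close> costs \<open>4 * e\<close>, and the excess \<open>e\<close> of the slope costs
    \<open>2 * e\<close> over the diameter of the ball.\<close>
  define e where "e = e0 / 8"
  have e: "0 < e" using e0 by (simp add: e_def)
  \<comment> \<open>\<open>t\<close> exceeds both \<open>2 * L\<close> and 1, so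
    \<open>2 * L / t\<close> and \<open>1 / t\<close> are below 1 and both parts of the energy bound
    die out after division by \<open>t powr p k\<close>.\<close>
  define t where "t = 2 * L + 2"
  have t: "0 < t" "1 < t" using L by (auto simp: t_def)
  have cv: "continuous_on (ball 0 1) v"
    using uniform_limit_theorem[OF _ lim] u(2) by simp
  have near: "\<exists>d>0. \<forall>z\<in>ball 0 1. dist z w < d \<longrightarrow> \<bar>v z - v w\<bar> < e" if "w \<in> ball 0 1" for w
    using cv that e unfolding continuous_on_iff dist_real_def by blast
  obtain d1 where d1: "0 < d1" "\<And>z. z \<in> ball 0 1 \<Longrightarrow> dist z x < d1 \<Longrightarrow> \<bar>v z - v x\<bar> < e"
    using near[OF xy(1)] by blast
  obtain d2 where d2: "0 < d2" "\<And>z. z \<in> ball 0 1 \<Longrightarrow> dist z y < d2 \<Longrightarrow> \<bar>v z - v y\<bar> < e"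
    using near[OF xy(2)] by blast
  \<comment> \<open>A third of the distance to the sphere leaves the margin
    \<open>2 * \<delta>\<close>: one \<open>\<delta>\<close> for the kernel, one to remain where
    \<open>f\<close> equals \<open>u k\<close>.\<close>
  define a b where "a = (1 - norm x) / 3" and "b = (1 - norm y) / 3"
  define \<delta> where "\<delta> = min (min d1 d2) (min a b)"
  have "0 < a" "0 < b" using xy by (auto simp: a_def b_def)
  then have \<delta>: "0 < \<delta>" "\<delta> \<le> d1" "\<delta> \<le> d2" and \<delta>': "\<delta> \<le> a" "\<delta> \<le> b"
    using d1(1) d2(1) unfolding \<delta>_def by simp_all
  have \<delta>xy: "norm x < 1 - 2 * \<delta>" "norm y < 1 - 2 * \<delta>"
    using \<delta>(1) \<delta>' by (simp_all add: a_def b_def field_simps)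
  obtain \<eta> :: "'a \<Rightarrow> real" where \<eta>: "mollifier \<delta> \<eta>" using mollifier_exists[OF \<delta>(1)] by blast
  have "\<exists>B\<ge>0. \<forall>z. norm (\<eta> z) \<le> B"
  proof (rule continuous_compact_support_bounded)
    show "continuous_on UNIV \<eta>" by (rule mollifier_continuous[OF \<eta>])
    show "compact (cball (0::'a) \<delta>)" by simp
    show "\<eta> z = 0" if "z \<notin> cball 0 \<delta>" for z using \<eta> that by (simp add: mollifier_def)
  qed
  then obtain B where B: "0 \<le> B" "\<And>z. norm (\<eta> z) \<le> B" by blast
  have B': "\<eta> z \<le> B" for z using B(2)[of z] by simp
  have small: "(\<lambda>k. B * t * 2 * (V * (2 * L / t) powr p k + D * (1 / t) powr p k)) \<longlonglongrightarrow> B * t * 2 * (V * 0 + D * 0)"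
    using L t by (intro tendsto_intros powr_tendsto_zero_at_top p(2)) (auto simp: t_def)
  have ev1: "\<forall>\<^sub>F k in sequentially. B * t * 2 * (V * (2 * L / t) powr p k + D * (1 / t) powr p k) < e"
    using order_tendstoD(2)[OF small, of e] e by simp
  have ev2: "\<forall>\<^sub>F k in sequentially. \<forall>z\<in>ball 0 1. dist (u k z) (v z) < e"
    using uniform_limitD[OF lim e] .
  obtain k where k1: "B * t * 2 * (V * (2 * L / t) powr p k + D * (1 / t) powr p k) < e"
    and k2: "\<And>z. z \<in> ball 0 1 \<Longrightarrow> \<bar>u k z - v z\<bar> < e"
    using eventually_happens[OF eventually_conj[OF ev1 ev2]] by (auto simp: dist_real_def)
  define S where "S = cball (0::'a) (1 - \<delta>)"
  have S: "closed S" "convex S" "S \<noteq> {}" "S \<subseteq> ball 0 1"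
  proof -
    have "0 \<le> 1 - \<delta>" using \<delta>(1) \<delta>xy(1) norm_ge_zero[of x] by linarith
    then show "closed S" "convex S" "S \<noteq> {}" "S \<subseteq> ball 0 1"
      using \<delta>(1) unfolding S_def by auto
  qed
  \<comment> \<open>Projection onto the closed ball \<open>S\<close> extends \<open>u k\<close>
    continuously to the whole space without changing it on \<open>S\<close>.\<close>
  define f where "f z = u k (closest_point S z)" for z
  have cf: "continuous_on UNIV f"
    unfolding f_def
    by (rule continuous_on_compose2[OF u(2) continuous_on_closest_point[OF S(2,1,3)]])
      (use closest_point_in_set[OF S(1,3)] S(4) in auto)
  have fu: "f z = u k z" if "z \<in> S" for z
    using closest_point_self[OF that] by (simp add: f_def)
  have grad: "norm (gradient (mollify \<eta> f) w) \<le> t + e" if "w \<in> ball 0 (1 - 2 * \<delta>)" for w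
  proof -
    have "norm (gradient (mollify \<eta> f) w)
      \<le> t + B * t powr (1 - p k) * (LINT z|unit_ball_lebesgue. norm (Du k z) powr p k)"
      by (rule gradient_mollify_bound[OF _ u(1) \<eta> B' \<delta>(1) cf _ _ t(1)])
        (use p(1)[of k] fu that in \<open>auto simp: S_def\<close>)
    also have "\<dots> \<le> t + B * t powr (1 - p k) * (2 * (V * (2 * L) powr p k + D))"
      using B bound by (intro add_left_mono mult_left_mono) auto
    also have "t powr (1 - p k) = t * (1 / t) powr p k"
      using t by (simp add: powr_diff powr_divide)
    also have "B * (t * (1 / t) powr p k) * (2 * (V * (2 * L) powr p k + D))
        = B * t * 2 * (V * (2 * L / t) powr p k + D * (1 / t) powr p k)"
      using t L by (simp add: powr_divide algebra_simps)
    finally show ?thesis using k1 by linarith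
  qed
  have cl: "\<bar>mollify \<eta> f w - v w\<bar> \<le> 2 * e"
    if w: "norm w < 1 - 2 * \<delta>" and near: "\<And>z. z \<in> ball 0 1 \<Longrightarrow> dist z w < \<delta> \<Longrightarrow> \<bar>v z - v w\<bar> < e" for w
  proof (rule mollify_close[OF \<eta> cf])
    fix z assume z: "z \<in> ball w \<delta>"
    have "norm z \<le> norm w + norm (z - w)" using norm_triangle_ineq[of w "z - w"] by simp
    then have "z \<in> S" using z w by (simp add: S_def dist_norm norm_minus_commute)
    then have zb: "z \<in> ball 0 1" using S(4) by blast
    have "\<bar>v z - v w\<bar> < e" using near[OF zb] z by (simp add: dist_commute)
    then show "\<bar>f z - v w\<bar> \<le> 2 * e" using k2[OF zb] fu[OF \<open>z \<in> S\<close>] by linarith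
  qed
  have "\<bar>mollify \<eta> f x - mollify \<eta> f y\<bar> \<le> (t + e) * norm (x - y)"
    by (rule C1_lipschitz_bound[OF mollify_C1(1)[OF \<eta> cf] convex_ball[of 0 "1 - 2 * \<delta>"] grad]) (use \<delta>xy in auto)
  moreover have "\<bar>mollify \<eta> f x - v x\<bar> \<le> 2 * e"
    using \<delta> \<delta>xy d1 by (intro cl) auto
  moreover have "\<bar>mollify \<eta> f y - v y\<bar> \<le> 2 * e"
    using \<delta> \<delta>xy d2 by (intro cl) auto
  ultimately have "\<bar>v x - v y\<bar> \<le> (t + e) * dist x y + 4 * e" unfolding dist_norm by linarith
  also have "\<dots> = t * dist x y + e * dist x y + 4 * e" by (simp add: algebra_simps)
  also have "\<dots> \<le> t * dist x y + e * 2 + 4 * e"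
  proof -
    have "dist x y \<le> 2" using norm_triangle_ineq4[of x y] xy by (simp add: dist_norm)
    then show ?thesis using e by simp
  qed
  also have "\<dots> \<le> (2 * L + 2) * dist x y + e0" using e0 by (simp add: t_def e_def)
  finally show "\<bar>v x - v y\<bar> \<le> (2 * L + 2) * dist x y + e0" .
qed

section \<open>Truncated test functions\<close>

text \<open>A smooth stand-in for the positive part: nondecreasing and positive exactly on the
  positive axis, like the truncation usual in comparison arguments, but C^1, so that composing it
  with smooth functions keeps them admissible.\<close>

definition bump :: "real \<Rightarrow> real" where
  "bump t = (max 0 t)\<^sup>2 / (1 + t\<^sup>2)"

definition bump' :: "real \<Rightarrow> real" where
  "bump' t = 2 * max 0 t / (1 + t\<^sup>2)\<^sup>2"

lemma one_plus_square_pos: "0 < 1 + (t::real)\<^sup>2"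
  by (simp add: add_pos_nonneg)

lemma DERIV_bump: "DERIV bump t :> bump' t"
proof -
  note pos = one_plus_square_pos[of t]
  have "DERIV (\<lambda>t. (max 0 t)\<^sup>2 / (1 + t\<^sup>2)) t :>
    ((2 * max 0 t) * (1 + t\<^sup>2) - (max 0 t)\<^sup>2 * (2 * t)) / ((1 + t\<^sup>2) * (1 + t\<^sup>2))"
  proof (rule DERIV_divide[OF DERIV_max_0_power2])
    show "DERIV (\<lambda>t. 1 + t\<^sup>2) t :> 2 * t" by (auto intro!: derivative_eq_intros)
    show "1 + t\<^sup>2 \<noteq> 0" using pos by linarith
  qed
  moreover have "(2 * max 0 t) * (1 + t\<^sup>2) - (max 0 t)\<^sup>2 * (2 * t) = 2 * max 0 t"
    by (cases "0 \<le> t") (auto simp: power2_eq_square algebra_simps max_def)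
  ultimately show ?thesis by (simp add: bump_def[abs_def] bump'_def power2_eq_square)
qed

lemma continuous_on_bump': "continuous_on A bump'"
proof -
  have "1 + (t::real)\<^sup>2 \<noteq> 0" for t using one_plus_square_pos[of t] by linarith
  then show ?thesis unfolding bump'_def by (intro continuous_intros) auto
qed

lemma bump_bounds: "0 \<le> bump t" "bump t \<le> 1"
proof -
  show "0 \<le> bump t" using one_plus_square_pos[of t] by (simp add: bump_def)
  have "(max 0 t)\<^sup>2 \<le> 1 + t\<^sup>2" by (auto simp: max_def)
  then show "bump t \<le> 1" using one_plus_square_pos[of t] by (simp add: bump_def)
qed

lemma bump'_bounds: "0 \<le> bump' t" "bump' t \<le> 1"
proof -
  show "0 \<le> bump' t" by (simp add: bump'_def)
  have "2 * max 0 t \<le> 1 + t\<^sup>2"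
    using zero_le_power2[of "t - 1"] by (auto simp: max_def power2_eq_square algebra_simps)
  also have "\<dots> \<le> (1 + t\<^sup>2)\<^sup>2" by (rule self_le_power) auto
  finally show "bump' t \<le> 1" using one_plus_square_pos[of t] by (simp add: bump'_def)
qed

lemma bump_nonpos: "t \<le> 0 \<Longrightarrow> bump t = 0" "t \<le> 0 \<Longrightarrow> bump' t = 0"
  by (simp_all add: bump_def bump'_def max_def)

lemma bump_pos: "0 < t \<Longrightarrow> 0 < bump t"
  using one_plus_square_pos[of t] by (simp add: bump_def)

lemma bump_measurable[measurable]: "bump \<in> borel_measurable borel" "bump' \<in> borel_measurable borel"
proof -
  have "continuous_on UNIV bump"
    using DERIV_bump by (intro continuous_at_imp_continuous_on ballI DERIV_isCont)
  then show "bump \<in> borel_measurable borel" by (rule borel_measurable_continuous_onI)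
  show "bump' \<in> borel_measurable borel"
    by (rule borel_measurable_continuous_onI[OF continuous_on_bump'])
qed

lemma integrable_of_powr_gt1:
  fixes X :: "'a::euclidean_space \<Rightarrow> 'a"
  assumes "1 < p" "X \<in> borel_measurable unit_ball_lebesgue"
    "integrable unit_ball_lebesgue (\<lambda>x. norm (X x) powr (p / (p - 1)))"
  shows "integrable unit_ball_lebesgue X"
proof -
  have "1 \<le> p / (p - 1)" using assms(1) by simp
  then show ?thesis using assms(2,3) by (rule integrable_of_powr)
qed

text \<open>Since \<open>bump\<close> and its derivative are bounded, the truncated difference is an admissible test
  function although \<open>u\<close> is only approximated weakly by smooth functions.\<close>

lemma weak_equation_truncated_test:
  fixes u g Gt v f \<zeta> :: "'a::euclidean_space \<Rightarrow> real"
  assumes p: "1 < p" and u: "W1p p (ball 0 1) u Du" and bv: "boundary_value p (ball 0 1) u g"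
    and Gt: "L-lipschitz_on UNIV Gt" "\<And>x. x \<in> sphere 0 1 \<Longrightarrow> Gt x = g x"
    and f[measurable]: "f \<in> borel_measurable unit_ball_lebesgue"
    and fM: "\<And>x. x \<in> ball 0 1 \<Longrightarrow> \<bar>f x\<bar> \<le> M"
    and X[measurable]: "X \<in> borel_measurable unit_ball_lebesgue"
    and Xint: "integrable unit_ball_lebesgue (\<lambda>x. norm (X x) powr (p / (p - 1)))"
    and eq: "\<And>\<phi>. \<phi> \<in> C1_0 (ball 0 1) \<Longrightarrow>
      (LINT x|unit_ball_lebesgue. X x \<bullet> gradient \<phi> x) = - (LINT x|unit_ball_lebesgue. f x * \<phi> x)"
    and v: "C1 v" and \<zeta>: "\<zeta> \<in> C1_0 (ball 0 1)"
  shows "(LINT x|unit_ball_lebesgue. \<zeta> x * bump' (u x - v x) * (X x \<bullet> (Du x - gradient v x)))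
      + (LINT x|unit_ball_lebesgue. bump (u x - v x) * (X x \<bullet> gradient \<zeta> x))
    = - (LINT x|unit_ball_lebesgue. f x * (\<zeta> x * bump (u x - v x)))"
proof -
  let ?M = "unit_ball_lebesgue :: 'a measure"
  let ?q = "p / (p - 1)"
  have p0: "0 < p" "1 \<le> p" and q0: "0 < ?q" using p by auto
  have [measurable]: "u \<in> borel_measurable ?M" "Du \<in> borel_measurable ?M"
    and Dint: "integrable ?M (\<lambda>x. norm (Du x) powr p)"
    using u by (auto simp: W1p_def Lp_def)
  obtain F \<theta> :: "nat \<Rightarrow> 'a \<Rightarrow> real" and C where F: "\<And>n. C1 (F n)" and \<theta>: "\<And>n. \<theta> n \<in> C1_0 (ball 0 1)"
    and C: "\<And>n. (LINT x|?M. norm (gradient (\<lambda>x. F n x + \<theta> n x) x) powr p) \<le> C"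
    and lim: "(\<lambda>n. LINT x|?M. \<bar>u x - (F n x + \<theta> n x)\<bar>) \<longlonglongrightarrow> 0"
    and limAE: "AE x in ?M. (\<lambda>n. F n x + \<theta> n x) \<longlonglongrightarrow> u x"
    by (rule boundary_value_C1_approx[OF p u bv Gt]) (assumption, (rule that; assumption))
  define W where "W n = (\<lambda>x. F n x + \<theta> n x)" for n
  have C1W: "C1 (W n)" for n unfolding W_def by (rule C1_add(1)[OF F C1_0_C1[OF \<theta>]])
  note C = C[folded W_def] and lim = lim[folded W_def]
  have limAE: "AE x in ?M. (\<lambda>n. W n x) \<longlonglongrightarrow> u x" using limAE by (simp add: W_def)
  have lim: "(\<lambda>n. LINT x|?M. \<bar>u x - W n x\<bar>) \<longlonglongrightarrow> 0" using lim by (simp add: W_def)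
  note [measurable] = C1_measurable[OF C1W] C1_measurable[OF v] C1_0_measurable[OF \<zeta>]
  have W1: "integrable ?M (W n)" for n by (rule integrable_unit_ball_continuous[OF C1_continuous[OF C1W]])
  have Wint: "integrable ?M (\<lambda>x. norm (gradient (W n) x) powr p)" for n
    by (intro integrable_unit_ball_continuous_powr C1_continuous_gradient C1W p0)
  obtain Bz where Bz: "0 \<le> Bz" "\<And>x. \<bar>\<zeta> x\<bar> \<le> Bz" "\<And>x. norm (gradient \<zeta> x) \<le> Bz"
    using C1_0_bounded[OF \<zeta>] by blast
  obtain Bv where Bv: "0 \<le> Bv" "\<And>x. x \<in> ball 0 1 \<Longrightarrow> norm (gradient v x) \<le> Bv"
    using continuous_bounded_unit_ball[OF C1_continuous_gradient[OF v]] by blast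
  have X1: "integrable ?M X" by (rule integrable_of_powr_gt1[OF p X Xint])
  have nX1: "integrable ?M (\<lambda>x. norm (X x))" using X1 by (rule integrable_norm)
  have C1d: "C1 (\<lambda>x. W n x - v x)" for n by (rule C1_diff(1)[OF C1W v])
  have C1b: "C1 (\<lambda>x. bump (W n x - v x))" for n
    by (rule C1_compose(1)[OF C1d DERIV_bump continuous_on_bump'])
  have gb: "gradient (\<lambda>x. bump (W n x - v x)) x = bump' (W n x - v x) *\<^sub>R (gradient (W n) x - gradient v x)" for n x
    by (simp add: C1_compose(2)[OF C1d DERIV_bump continuous_on_bump'] C1_diff(2)[OF C1W v])
  \<comment> \<open>The desired test function contains \<open>u\<close>; it is replaced by its
    approximants, for which the equation holds, and the four resulting integrals are passed to the
    limit.\<close>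
  define \<phi> where "\<phi> n = (\<lambda>x. \<zeta> x * bump (W n x - v x))" for n
  have \<phi>: "\<phi> n \<in> C1_0 (ball 0 1)" for n unfolding \<phi>_def by (rule C1_0_mult[OF \<zeta> C1b])
  have g\<phi>: "gradient (\<phi> n) x = (\<zeta> x * bump' (W n x - v x)) *\<^sub>R (gradient (W n) x - gradient v x)
      + bump (W n x - v x) *\<^sub>R gradient \<zeta> x" for n x
    unfolding \<phi>_def C1_mult(2)[OF C1_0_C1[OF \<zeta>] C1b] by (simp add: gb)
  have pw: "norm (a * (X x \<bullet> h)) \<le> B * norm (X x)" if "\<bar>a\<bar> * norm h \<le> B" for a B x and h :: 'a
  proof -
    have "norm (a * (X x \<bullet> h)) \<le> \<bar>a\<bar> * (norm (X x) * norm h)"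
      unfolding real_norm_def abs_mult by (intro mult_left_mono Cauchy_Schwarz_ineq2) auto
    also have "\<dots> = (\<bar>a\<bar> * norm h) * norm (X x)" by simp
    also have "\<dots> \<le> B * norm (X x)" using that by (intro mult_right_mono) auto
    finally show ?thesis .
  qed
  have dom: "integrable ?M (\<lambda>x. a x * (X x \<bullet> H x))"
    if [measurable]: "a \<in> borel_measurable ?M" "H \<in> borel_measurable ?M"
      and "\<And>x. x \<in> ball 0 1 \<Longrightarrow> \<bar>a x\<bar> * norm (H x) \<le> B" for a H B
  proof (rule Bochner_Integration.integrable_bound)
    show "integrable ?M (\<lambda>x. B * norm (X x))" using nX1 by (rule integrable_mult_right)
    show "AE x in ?M. norm (a x * (X x \<bullet> H x)) \<le> norm (B * norm (X x))"
    proof (rule AE_I2)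
      fix x assume "x \<in> space ?M"
      then have "norm (a x * (X x \<bullet> H x)) \<le> B * norm (X x)" using that(3) by (intro pw) simp
      then show "norm (a x * (X x \<bullet> H x)) \<le> norm (B * norm (X x))"
        by (simp only: real_norm_def order_trans[OF _ abs_ge_self])
    qed
  qed measurable
  have conv: "(\<lambda>n. LINT x|?M. a n x * (X x \<bullet> H x)) \<longlonglongrightarrow> (LINT x|?M. a' x * (X x \<bullet> H x))"
    if [measurable]: "\<And>n. a n \<in> borel_measurable ?M" "a' \<in> borel_measurable ?M" "H \<in> borel_measurable ?M"
      and bd: "\<And>n x. x \<in> ball 0 1 \<Longrightarrow> \<bar>a n x\<bar> * norm (H x) \<le> B"
      and ae: "AE x in ?M. (\<lambda>n. a n x) \<longlonglongrightarrow> a' x" for a :: "nat \<Rightarrow> 'a \<Rightarrow> real" and a' H B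
  proof (rule integral_dominated_convergence)
    show "integrable ?M (\<lambda>x. B * norm (X x))" using nX1 by (rule integrable_mult_right)
    show "AE x in ?M. (\<lambda>n. a n x * (X x \<bullet> H x)) \<longlonglongrightarrow> a' x * (X x \<bullet> H x)"
      using ae by (rule AE_mp) (intro AE_I2 impI tendsto_intros)
    show "AE x in ?M. norm (a n x * (X x \<bullet> H x)) \<le> B * norm (X x)" for n
      using bd by (intro AE_I2 pw) auto
  qed measurable
  have zb': "\<bar>\<zeta> x * bump' t\<bar> \<le> Bz" for x t
    unfolding abs_mult using mult_mono[OF Bz(2)[of x] bump'_bounds(2)[of t]] bump'_bounds(1)[of t] Bz by simp
  have isC: "isCont bump t" "isCont bump' t" for t
    using DERIV_isCont[OF DERIV_bump] continuous_on_bump'[of UNIV] by (auto simp: continuous_on_eq_continuous_at)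
  have aeb': "AE x in ?M. (\<lambda>n. bump' (W n x - v x)) \<longlonglongrightarrow> bump' (u x - v x)"
    using limAE
    by (rule AE_mp) (intro AE_I2 impI isCont_tendsto_compose[OF isC(2)] tendsto_intros)
  have aeb: "AE x in ?M. (\<lambda>n. bump (W n x - v x)) \<longlonglongrightarrow> bump (u x - v x)"
    using limAE
    by (rule AE_mp) (intro AE_I2 impI isCont_tendsto_compose[OF isC(1)] tendsto_intros)
  have zv: "\<bar>\<zeta> x * bump' t\<bar> * norm (gradient v x) \<le> Bz * Bv" if "x \<in> ball 0 1" for x t
    using zb' Bv(2)[OF that] Bz(1) by (intro mult_mono) auto
  have bz: "\<bar>bump t\<bar> * norm (gradient \<zeta> x) \<le> 1 * Bz" for t x
    using bump_bounds[of t] Bz by (intro mult_mono) auto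
  have T2: "(\<lambda>n. LINT x|?M. (\<zeta> x * bump' (W n x - v x)) * (X x \<bullet> gradient v x))
      \<longlonglongrightarrow> (LINT x|?M. (\<zeta> x * bump' (u x - v x)) * (X x \<bullet> gradient v x))"
  proof (rule conv[where B = "Bz * Bv"])
    show "AE x in ?M. (\<lambda>n. \<zeta> x * bump' (W n x - v x)) \<longlonglongrightarrow> \<zeta> x * bump' (u x - v x)"
      using aeb' by (rule AE_mp) (intro AE_I2 impI tendsto_intros)
  qed (use zv in auto)
  have T3: "(\<lambda>n. LINT x|?M. bump (W n x - v x) * (X x \<bullet> gradient \<zeta> x))
      \<longlonglongrightarrow> (LINT x|?M. bump (u x - v x) * (X x \<bullet> gradient \<zeta> x))"
    by (rule conv[where B = "1 * Bz"]) (use bz aeb in auto)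
  have T4: "(\<lambda>n. LINT x|?M. f x * \<phi> n x) \<longlonglongrightarrow> (LINT x|?M. f x * (\<zeta> x * bump (u x - v x)))"
  proof (rule integral_dominated_convergence)
    show "integrable ?M (\<lambda>x. M * Bz)" by (rule integrable_unit_ball_bounded[of _ "\<bar>M * Bz\<bar>"]) auto
    show "AE x in ?M. (\<lambda>n. f x * \<phi> n x) \<longlonglongrightarrow> f x * (\<zeta> x * bump (u x - v x))"
      unfolding \<phi>_def using aeb by (rule AE_mp) (intro AE_I2 impI tendsto_intros)
    show "AE x in ?M. norm (f x * \<phi> n x) \<le> M * Bz" for n
    proof (rule AE_I2)
      fix x assume "x \<in> space ?M"
      then have x: "x \<in> ball 0 1" by simp
      have "\<bar>\<phi> n x\<bar> \<le> Bz * 1"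
        unfolding \<phi>_def abs_mult using Bz bump_bounds[of "W n x - v x"] by (intro mult_mono) auto
      then have "\<bar>f x\<bar> * \<bar>\<phi> n x\<bar> \<le> M * Bz"
        using fM[OF x] Bz abs_ge_zero[of "f x"] by (intro mult_mono) auto
      then show "norm (f x * \<phi> n x) \<le> M * Bz" by (simp add: abs_mult)
    qed
    show "(\<lambda>x. f x * \<phi> n x) \<in> borel_measurable ?M" for n unfolding \<phi>_def by measurable
  qed measurable
  \<comment> \<open>The gradients of \<open>W n\<close> converge only weakly, so their coefficient
    must not vary with \<open>n\<close>: it is frozen at its limit, and the error is collected in
    \<open>R n\<close>.\<close>
  define \<Psi> where "\<Psi> x = (\<zeta> x * bump' (u x - v x)) *\<^sub>R X x" for x
  have \<Psi>m[measurable]: "\<Psi> \<in> borel_measurable ?M" unfolding \<Psi>_def by measurable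
  have \<Psi>int: "integrable ?M (\<lambda>x. norm (\<Psi> x) powr ?q)"
  proof (rule Bochner_Integration.integrable_bound)
    show "integrable ?M (\<lambda>x. Bz powr ?q * norm (X x) powr ?q)" using Xint by (rule integrable_mult_right)
    have "norm (\<Psi> x) powr ?q \<le> Bz powr ?q * norm (X x) powr ?q" for x
    proof -
      have "norm (\<Psi> x) \<le> Bz * norm (X x)"
        unfolding \<Psi>_def norm_scaleR using zb' by (intro mult_right_mono) auto
      then have "norm (\<Psi> x) powr ?q \<le> (Bz * norm (X x)) powr ?q" using q0 by (intro powr_mono2) auto
      then show ?thesis using Bz by (simp add: powr_mult)
    qed
    then show "AE x in ?M. norm (norm (\<Psi> x) powr ?q) \<le> norm (Bz powr ?q * norm (X x) powr ?q)"
      by (intro AE_I2) auto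
  qed measurable
  have T1: "(\<lambda>n. LINT x|?M. \<Psi> x \<bullet> gradient (W n) x) \<longlonglongrightarrow> (LINT x|?M. \<Psi> x \<bullet> Du x)"
    by (rule weak_convergence_gradient[OF p u C1W W1 Wint C lim \<Psi>m \<Psi>int])
  \<comment> \<open>The change of coefficient tends to 0 strongly in the conjugate space, since
    \<open>bump'\<close> is bounded and continuous; paired with gradients bounded in L^p it vanishes
    in the limit.\<close>
  define b where "b n x = (\<zeta> x * (bump' (W n x - v x) - bump' (u x - v x))) * norm (X x)" for n x
  have bm[measurable]: "b n \<in> borel_measurable ?M" for n unfolding b_def by measurable
  have ble: "\<bar>b n x\<bar> powr ?q \<le> Bz powr ?q * norm (X x) powr ?q" for n x
  proof -
    have "\<bar>bump' (W n x - v x) - bump' (u x - v x)\<bar> \<le> 1"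
      using bump'_bounds[of "W n x - v x"] bump'_bounds[of "u x - v x"] by linarith
    then have "\<bar>\<zeta> x\<bar> * \<bar>bump' (W n x - v x) - bump' (u x - v x)\<bar> \<le> Bz * 1"
      using Bz by (intro mult_mono) auto
    then have "\<bar>b n x\<bar> \<le> Bz * norm (X x)" unfolding b_def by (simp add: abs_mult mult_right_mono)
    then have "\<bar>b n x\<bar> powr ?q \<le> (Bz * norm (X x)) powr ?q" using q0 by (intro powr_mono2) auto
    then show ?thesis using Bz by (simp add: powr_mult)
  qed
  have bdom: "integrable ?M (\<lambda>x. Bz powr ?q * norm (X x) powr ?q)" using Xint by (rule integrable_mult_right)
  have bint: "integrable ?M (\<lambda>x. \<bar>b n x\<bar> powr ?q)" for n
    by (rule Bochner_Integration.integrable_bound[OF bdom]) (use ble in auto)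
  have blim: "(\<lambda>n. LINT x|?M. \<bar>b n x\<bar> powr ?q) \<longlonglongrightarrow> (LINT x|?M. 0)"
  proof (rule integral_dominated_convergence[OF _ _ bdom])
    show "AE x in ?M. (\<lambda>n. \<bar>b n x\<bar> powr ?q) \<longlonglongrightarrow> 0"
      using aeb'
    proof (rule AE_mp, intro AE_I2 impI)
      fix x assume "(\<lambda>n. bump' (W n x - v x)) \<longlonglongrightarrow> bump' (u x - v x)"
      then have "(\<lambda>n. \<bar>b n x\<bar>) \<longlonglongrightarrow> \<bar>(\<zeta> x * (bump' (u x - v x) - bump' (u x - v x))) * norm (X x)\<bar>"
        unfolding b_def by (intro tendsto_intros)
      then show "(\<lambda>n. \<bar>b n x\<bar> powr ?q) \<longlonglongrightarrow> 0"
        using tendsto_zero_powrI[of "\<lambda>n. \<bar>b n x\<bar>" sequentially "\<lambda>_. ?q" ?q] q0 by simp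
    qed
    show "AE x in ?M. norm (\<bar>b n x\<bar> powr ?q) \<le> Bz powr ?q * norm (X x) powr ?q" for n
      using ble by (intro AE_I2) auto
  qed measurable
  have T5: "(\<lambda>n. LINT x|?M. \<bar>b n x * norm (gradient (W n) x)\<bar>) \<longlonglongrightarrow> 0"
    by (rule product_tendsto_zero[OF p _ bm _ _ bint]) (use Wint C blim in auto)
  define R where "R n x = (\<zeta> x * (bump' (W n x - v x) - bump' (u x - v x))) * (X x \<bullet> gradient (W n) x)" for n x
  have Rm[measurable]: "R n \<in> borel_measurable ?M" for n unfolding R_def by measurable
  have Rle: "\<bar>R n x\<bar> \<le> \<bar>b n x * norm (gradient (W n) x)\<bar>" for n x
    unfolding R_def b_def abs_mult mult.assoc
    using Cauchy_Schwarz_ineq2[of "X x" "gradient (W n) x"] by (intro mult_left_mono) auto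
  have bgi: "integrable ?M (\<lambda>x. b n x * norm (gradient (W n) x))" for n
    by (rule integrable_mult_conjugate[OF p _ bm _ bint]) (use Wint in auto)
  have Ri: "integrable ?M (R n)" for n
    by (rule Bochner_Integration.integrable_bound[OF integrable_abs[OF bgi]]) (use Rle in auto)
  have T6: "(\<lambda>n. LINT x|?M. R n x) \<longlonglongrightarrow> 0"
  proof (rule Lim_null_comparison[OF _ T5])
    have "norm (LINT x|?M. R n x) \<le> (LINT x|?M. \<bar>b n x * norm (gradient (W n) x)\<bar>)" for n
    proof -
      have "norm (LINT x|?M. R n x) \<le> (LINT x|?M. norm (R n x))" by (rule integral_norm_bound)
      also have "\<dots> \<le> (LINT x|?M. \<bar>b n x * norm (gradient (W n) x)\<bar>)"
        using Rle by (intro integral_mono integrable_norm Ri integrable_abs bgi) auto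
      finally show ?thesis .
    qed
    then show "\<forall>\<^sub>F n in sequentially. norm (LINT x|?M. R n x) \<le> (LINT x|?M. \<bar>b n x * norm (gradient (W n) x)\<bar>)"
      by simp
  qed
  have iprod: "integrable ?M (\<lambda>x. \<Psi> x \<bullet> H x)"
    if "H \<in> borel_measurable ?M" "integrable ?M (\<lambda>x. norm (H x) powr p)" for H
    by (rule integrable_inner_conjugate[OF p \<Psi>m that(1) \<Psi>int that(2)])
  have i2: "integrable ?M (\<lambda>x. (\<zeta> x * bump' (W n x - v x)) * (X x \<bullet> gradient v x))" for n
    by (rule dom[where B = "Bz * Bv"]) (use zv in auto)
  have i2': "integrable ?M (\<lambda>x. (\<zeta> x * bump' (u x - v x)) * (X x \<bullet> gradient v x))"
    by (rule dom[where B = "Bz * Bv"]) (use zv in auto)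
  have i3: "integrable ?M (\<lambda>x. bump (W n x - v x) * (X x \<bullet> gradient \<zeta> x))" for n
    by (rule dom[where B = "1 * Bz"]) (use bz in auto)
  have split: "(LINT x|?M. X x \<bullet> gradient (\<phi> n) x)
    = (LINT x|?M. \<Psi> x \<bullet> gradient (W n) x) + (LINT x|?M. R n x)
      - (LINT x|?M. (\<zeta> x * bump' (W n x - v x)) * (X x \<bullet> gradient v x))
      + (LINT x|?M. bump (W n x - v x) * (X x \<bullet> gradient \<zeta> x))" for n
  proof -
    have "X x \<bullet> gradient (\<phi> n) x = ((\<Psi> x \<bullet> gradient (W n) x + R n x)
      - (\<zeta> x * bump' (W n x - v x)) * (X x \<bullet> gradient v x))
      + bump (W n x - v x) * (X x \<bullet> gradient \<zeta> x)" for x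
      by (simp add: g\<phi> \<Psi>_def R_def inner_add_right inner_diff_right algebra_simps)
    then show ?thesis
      using iprod[OF _ Wint[of n]] Ri[of n] i2[of n] i3[of n] by simp
  qed
  have "(\<lambda>n. LINT x|?M. X x \<bullet> gradient (\<phi> n) x) \<longlonglongrightarrow>
      (LINT x|?M. \<Psi> x \<bullet> Du x) + 0 - (LINT x|?M. (\<zeta> x * bump' (u x - v x)) * (X x \<bullet> gradient v x))
      + (LINT x|?M. bump (u x - v x) * (X x \<bullet> gradient \<zeta> x))"
    unfolding split by (intro tendsto_intros T1 T6 T2 T3)
  moreover have "(\<lambda>n. LINT x|?M. X x \<bullet> gradient (\<phi> n) x) \<longlonglongrightarrow> - (LINT x|?M. f x * (\<zeta> x * bump (u x - v x)))"
    unfolding eq[OF \<phi>] by (intro tendsto_intros T4)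
  ultimately have "(LINT x|?M. \<Psi> x \<bullet> Du x) + 0 - (LINT x|?M. (\<zeta> x * bump' (u x - v x)) * (X x \<bullet> gradient v x))
      + (LINT x|?M. bump (u x - v x) * (X x \<bullet> gradient \<zeta> x)) = - (LINT x|?M. f x * (\<zeta> x * bump (u x - v x)))"
    by (rule LIMSEQ_unique)
  moreover have "(LINT x|?M. \<zeta> x * bump' (u x - v x) * (X x \<bullet> (Du x - gradient v x)))
      = (LINT x|?M. \<Psi> x \<bullet> Du x) - (LINT x|?M. (\<zeta> x * bump' (u x - v x)) * (X x \<bullet> gradient v x))"
  proof -
    have "\<zeta> x * bump' (u x - v x) * (X x \<bullet> (Du x - gradient v x))
      = \<Psi> x \<bullet> Du x - (\<zeta> x * bump' (u x - v x)) * (X x \<bullet> gradient v x)" for x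
      by (simp add: \<Psi>_def inner_diff_right algebra_simps)
    then show ?thesis using iprod[OF _ Dint] i2' by simp
  qed
  ultimately show ?thesis by simp
qed

section \<open>Comparison with a radial barrier\<close>

text \<open>The exponent is chosen so that \<open>(q - 1) * (p - 2) + (q - 2) = 0\<close>: the
  powers of the norm cancel and the flux is linear, hence of constant divergence.\<close>

lemma p_flux_barrier:
  fixes z :: "'a::euclidean_space"
  assumes "1 < p" "0 < c"
  defines "q \<equiv> p / (p - 1)"
  shows "p_flux p (c *\<^sub>R ((q * norm z powr (q - 2)) *\<^sub>R z)) = (c * q) powr (p - 1) *\<^sub>R z"
proof (cases "z = 0")
  case False
  have q: "0 < q" using assms by (simp add: q_def)
  have q1: "q - 1 = 1 / (p - 1)" using assms by (simp add: q_def field_simps)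
  define n where "n = norm z"
  have n: "0 < n" using False by (simp add: n_def)
  have nn: "n powr (q - 2) * n = n powr (q - 1)" using powr_add[of n "q - 2" 1] n by simp
  have nrm: "norm (c *\<^sub>R ((q * norm z powr (q - 2)) *\<^sub>R z)) = (c * q) * n powr (q - 1)"
    using assms(2) q nn by (simp add: n_def mult.assoc)
  have "norm (c *\<^sub>R ((q * norm z powr (q - 2)) *\<^sub>R z)) powr (p - 2) * (c * (q * n powr (q - 2)))
      = (c * q) powr (p - 2) * n powr ((q - 1) * (p - 2)) * ((c * q) * n powr (q - 2))"
    unfolding nrm using assms(2) q n by (simp add: powr_mult powr_powr)
  also have "\<dots> = ((c * q) powr (p - 2) * (c * q)) * (n powr ((q - 1) * (p - 2)) * n powr (q - 2))"
    by (simp add: mult_ac)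
  also have "(c * q) powr (p - 2) * (c * q) = (c * q) powr (p - 1)"
    using powr_add[of "c * q" "p - 2" 1] assms(2) q by simp
  also have "n powr ((q - 1) * (p - 2)) * n powr (q - 2) = 1"
  proof -
    have "(q - 1) * (p - 2) + (q - 2) = (q - 1) * (p - 1) - 1" by (simp add: algebra_simps)
    also have "\<dots> = 0" using assms(1) by (simp add: q1)
    finally show ?thesis using n by (simp flip: powr_add)
  qed
  finally show ?thesis by (simp add: p_flux_def n_def)
qed (simp add: p_flux_def)

text \<open>Comparison with the explicit solution \<open>c |x - y|^q + a\<close>, \<open>q = p / (p - 1)\<close>, whose
  \<open>p\<close>-Laplacian is the constant \<open>N (c q)^(p - 1)\<close>.\<close>

lemma comparison_barrier:
  fixes u g Gt lam :: "'a::euclidean_space \<Rightarrow> real"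
  assumes p: "1 < p" and u: "W1p p (ball 0 1) u Du" and bv: "boundary_value p (ball 0 1) u g"
    and cu: "continuous_on (ball 0 1) u"
    and Gt: "L-lipschitz_on UNIV Gt" "\<And>x. x \<in> sphere 0 1 \<Longrightarrow> Gt x = g x"
    and lam[measurable]: "lam \<in> borel_measurable unit_ball_lebesgue"
    and lam_bounds: "\<And>x. x \<in> ball 0 1 \<Longrightarrow> m \<le> lam x" "\<And>x. x \<in> ball 0 1 \<Longrightarrow> lam x \<le> M" "0 < m"
    and eq: "\<And>\<phi>. \<phi> \<in> C1_0 (ball 0 1) \<Longrightarrow>
      (LINT x|unit_ball_lebesgue. p_flux p (Du x) \<bullet> gradient \<phi> x)
      = - (LINT x|unit_ball_lebesgue. lam x * indicat_real {y. u y > 0} x * \<phi> x)"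
    and c: "0 < c" "real DIM('a) * (c * (p / (p - 1))) powr (p - 1) < m"
    and a: "0 \<le> a" and r: "0 < r" "ball y r \<subseteq> ball 0 1"
    and le: "\<And>x. x \<in> ball y r \<Longrightarrow> r / 2 \<le> dist x y \<Longrightarrow> u x \<le> c * dist x y powr (p / (p - 1)) + a"
  shows "u y \<le> a"
proof (rule ccontr)
  assume "\<not> u y \<le> a"
  then have uy: "a < u y" by simp
  let ?M = "unit_ball_lebesgue :: 'a measure"
  define q where "q = p / (p - 1)"
  have q: "1 < q" using p by (simp add: q_def)
  define \<kappa> where "\<kappa> = (c * q) powr (p - 1)"
  define N where "N = real DIM('a)"
  have \<kappa>m: "N * \<kappa> < m" using c(2) by (simp add: N_def \<kappa>_def q_def)
  have \<kappa>0: "0 \<le> N * \<kappa>" by (simp add: N_def \<kappa>_def)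
  have [measurable]: "u \<in> borel_measurable ?M" "Du \<in> borel_measurable ?M"
    and Dint: "integrable ?M (\<lambda>x. norm (Du x) powr p)"
    using u by (auto simp: W1p_def Lp_def)
  define v where "v x = c * norm (x - y) powr q + a" for x
  have "C1 (\<lambda>x::'a. c * norm x powr q)" by (rule C1_mult(1)[OF C1_const(1) C1_norm_powr(1)[OF q]])
  then have n1: "C1 (\<lambda>x. c * norm (x - y) powr q)" by (rule C1_translate(1))
  have n2: "gradient (\<lambda>x. c * norm (x - y) powr q)
      = (\<lambda>x. c *\<^sub>R ((q * norm (x - y) powr (q - 2)) *\<^sub>R (x - y)))"
    by (subst C1_translate(2)[OF \<open>C1 (\<lambda>x::'a. c * norm x powr q)\<close>])
      (simp add: C1_mult(2)[OF C1_const(1) C1_norm_powr(1)[OF q]] C1_norm_powr(2)[OF q] C1_const(2))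
  have v: "C1 v" unfolding v_def by (rule C1_add(1)[OF n1 C1_const(1)])
  have gv: "gradient v x = c *\<^sub>R ((q * norm (x - y) powr (q - 2)) *\<^sub>R (x - y))" for x
    unfolding v_def C1_add(2)[OF n1 C1_const(1)] n2 C1_const(2) by simp
  have fv: "p_flux p (gradient v x) = \<kappa> *\<^sub>R (x - y)" for x
    unfolding gv \<kappa>_def q_def by (rule p_flux_barrier[OF p c(1)])
  note [measurable] = C1_measurable[OF v]
  have "y \<in> ball y r" using r by simp
  then have yb: "y \<in> ball 0 1" using r(2) by blast
  obtain \<zeta> where \<zeta>: "\<zeta> \<in> C1_0 (ball y r)" "\<And>x. 0 \<le> \<zeta> x" "\<And>x. \<zeta> x \<le> 1" "\<And>x. x \<in> cball y (r / 2) \<Longrightarrow> \<zeta> x = 1"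
    using C1_0_cutoff[of "r / 2" r y] r(1) by auto
  have \<zeta>b: "\<zeta> \<in> C1_0 (ball 0 1)" using \<zeta>(1) r(2) by (rule C1_0_mono)
  note [measurable] = C1_0_measurable[OF \<zeta>b]
  obtain K where K: "compact K" "K \<subseteq> ball y r" "\<And>x. x \<notin> K \<Longrightarrow> \<zeta> x = 0" "\<And>x. x \<notin> K \<Longrightarrow> gradient \<zeta> x = 0"
    using C1_0_support[OF \<zeta>(1)] by metis
  \<comment> \<open>Subtracting the flux of the barrier makes the leading term of the tested
    equation nonnegative by monotonicity; its constant divergence reappears in \<open>f\<close> as
    \<open>N * \<kappa>\<close>.\<close>
  define X where "X x = p_flux p (Du x) - \<kappa> *\<^sub>R (x - y)" for x
  have lin_c: "continuous_on UNIV (\<lambda>x. \<kappa> *\<^sub>R (x - y))" by (intro continuous_intros)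
  have lin_m[measurable]: "(\<lambda>x. \<kappa> *\<^sub>R (x - y)) \<in> borel_measurable ?M"
    by (rule measurable_unit_ball_continuous[OF continuous_on_subset[OF lin_c]]) simp
  have Am: "(\<lambda>x. p_flux p (Du x)) \<in> borel_measurable ?M" by measurable
  have q0: "0 < p / (p - 1)" using q by (simp add: q_def)
  have Aint: "integrable ?M (\<lambda>x. norm (p_flux p (Du x)) powr (p / (p - 1)))"
    using Dint by (simp add: norm_p_flux_powr[OF p])
  have Xm: "X \<in> borel_measurable ?M" unfolding X_def using Am lin_m by (rule borel_measurable_diff)
  have Xint: "integrable ?M (\<lambda>x. norm (X x) powr (p / (p - 1)))"
    unfolding X_def
    by (rule integrable_powr_diff(1)[OF q0 Am lin_m Aint integrable_unit_ball_continuous_powr[OF lin_c q0]])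
  define f where "f x = lam x * indicat_real {y. u y > 0} x - N * \<kappa>" for x
  have indm[measurable]: "(\<lambda>x. indicat_real {y. u y > 0} x) \<in> borel_measurable ?M"
  proof -
    have "(\<lambda>x. indicat_real {y. u y > 0} x) = (\<lambda>x. if u x > 0 then 1 else 0)"
      by (auto simp: indicator_def)
    then show ?thesis by simp
  qed
  have fm: "f \<in> borel_measurable ?M" unfolding f_def by measurable
  have lamM: "\<bar>lam x * indicat_real {y. u y > 0} x\<bar> \<le> M" if "x \<in> ball 0 1" for x
    using lam_bounds(1,2)[OF that] lam_bounds(3) by (auto simp: indicator_def)
  have fM: "\<bar>f x\<bar> \<le> M + N * \<kappa>" if "x \<in> ball 0 1" for x
    using lamM[OF that] \<kappa>0 unfolding f_def by linarith
  have Xeq: "(LINT x|?M. X x \<bullet> gradient \<phi> x) = - (LINT x|?M. f x * \<phi> x)" if \<phi>: "\<phi> \<in> C1_0 (ball 0 1)" for \<phi>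
  proof -
    obtain B where B: "0 \<le> B" "\<And>x. \<bar>\<phi> x\<bar> \<le> B" "\<And>x. norm (gradient \<phi> x) \<le> B"
      using C1_0_bounded[OF \<phi>] by blast
    note [measurable] = C1_0_measurable[OF \<phi>]
    have c\<phi>: "continuous_on UNIV \<phi>" "continuous_on UNIV (gradient \<phi>)"
      using C1_0_C1[OF \<phi>] by (auto intro: C1_continuous C1_continuous_gradient)
    obtain J where J: "J \<subseteq> ball 0 1" "\<And>x. x \<notin> J \<Longrightarrow> \<phi> x = 0" "\<And>x. x \<notin> J \<Longrightarrow> gradient \<phi> x = 0"
      using C1_0_support[OF \<phi>] by metis
    have z: "\<phi> x = 0" "gradient \<phi> x = 0" if "x \<notin> ball 0 1" for x using J(1) J(2,3)[of x] that by blast+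
    have sb: "ball (0::'a) 1 \<in> sets lebesgue" by simp
    have cl: "continuous_on UNIV (\<lambda>x. (x - y) \<bullet> gradient \<phi> x)" by (intro continuous_intros c\<phi>)
    have lin: "(LINT x|?M. (x - y) \<bullet> gradient \<phi> x) = - N * (LINT x|?M. \<phi> x)"
    proof -
      have "(LINT x|?M. (x - y) \<bullet> gradient \<phi> x) = (LINT x|lborel. (x - y) \<bullet> gradient \<phi> x)"
        by (rule integral_lebesgue_on_support[OF cl sb]) (simp add: z(2))
      moreover have "(LINT x|?M. \<phi> x) = (LINT x|lborel. \<phi> x)"
        by (rule integral_lebesgue_on_support[OF c\<phi>(1) sb z(1)])
      ultimately show ?thesis using integral_linear_field[OF \<phi>, of y] by (simp add: N_def)
    qed
    have i1: "integrable ?M (\<lambda>x. p_flux p (Du x) \<bullet> gradient \<phi> x)"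
      by (rule integrable_inner_conjugate[OF p Am _ Aint integrable_unit_ball_continuous_powr[OF c\<phi>(2)]])
        (use p in auto)
    have i2: "integrable ?M (\<lambda>x. (x - y) \<bullet> gradient \<phi> x)" by (rule integrable_unit_ball_continuous[OF cl])
    have i3: "integrable ?M \<phi>" by (rule integrable_unit_ball_continuous[OF c\<phi>(1)])
    have i4: "integrable ?M (\<lambda>x. lam x * indicat_real {y. u y > 0} x * \<phi> x)"
    proof (rule integrable_unit_ball_bounded)
      show "(\<lambda>x. lam x * indicat_real {y. u y > 0} x * \<phi> x) \<in> borel_measurable ?M" by measurable
      show "norm (lam x * indicat_real {y. u y > 0} x * \<phi> x) \<le> M * B" if "x \<in> ball 0 1" for x
        unfolding real_norm_def abs_mult[of _ "\<phi> x"]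
        using lamM[OF that] B(2)[of x] abs_ge_zero[of "lam x * indicat_real {y. u y > 0} x"] B(1)
        by (intro mult_mono) linarith+
    qed
    have "(LINT x|?M. X x \<bullet> gradient \<phi> x)
      = (LINT x|?M. p_flux p (Du x) \<bullet> gradient \<phi> x) - \<kappa> * (LINT x|?M. (x - y) \<bullet> gradient \<phi> x)"
      using i1 i2 by (simp add: X_def inner_diff_left[of "p_flux p _"])
    also have "\<dots> = - (LINT x|?M. lam x * indicat_real {y. u y > 0} x * \<phi> x) + N * \<kappa> * (LINT x|?M. \<phi> x)"
      unfolding eq[OF \<phi>] lin by simp
    also have "\<dots> = - (LINT x|?M. lam x * indicat_real {y. u y > 0} x * \<phi> x - N * \<kappa> * \<phi> x)"
      using i3 i4 by simp
    also have "\<dots> = - (LINT x|?M. f x * \<phi> x)" by (simp add: f_def left_diff_distrib)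
    finally show ?thesis .
  qed
  define w where "w x = \<zeta> x * bump (u x - v x)" for x
  have far: "u x \<le> v x" if "x \<in> ball y r" "r / 2 \<le> dist x y" for x
    using le[OF that] by (simp add: v_def q_def dist_norm)
  \<comment> \<open>The cutoff varies only in the outer half of the ball, where the hypothesis puts
    \<open>u\<close> below the barrier and \<open>bump\<close> is zero.\<close>
  have "bump (u x - v x) * (X x \<bullet> gradient \<zeta> x) = 0" for x
  proof (cases "x \<in> ball y r \<and> r / 2 \<le> dist x y")
    case True
    then show ?thesis using far bump_nonpos(1) by simp
  next
    case False
    have "gradient \<zeta> x = 0"
    proof (cases "x \<in> ball y r")
      case True
      then have x: "x \<in> ball y (r / 2)" using False by (simp add: dist_commute)
      show ?thesis
      proof (rule GDERIV_zero_open[OF open_ball x])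
        show "\<zeta> z = 1" if "z \<in> ball y (r / 2)" for z using that by (intro \<zeta>(4)) simp
      qed
    qed (use K in blast)
    then show ?thesis by simp
  qed
  then have third: "(LINT x|?M. bump (u x - v x) * (X x \<bullet> gradient \<zeta> x)) = 0" by (simp only: Bochner_Integration.integral_zero)
  have first: "0 \<le> (LINT x|?M. \<zeta> x * bump' (u x - v x) * (X x \<bullet> (Du x - gradient v x)))"
  proof (rule Bochner_Integration.integral_nonneg)
    fix x
    have "0 \<le> X x \<bullet> (Du x - gradient v x)"
      using p_flux_monotone[OF p, of "Du x" "gradient v x"] by (simp add: X_def fv)
    then show "0 \<le> \<zeta> x * bump' (u x - v x) * (X x \<bullet> (Du x - gradient v x))"
      using \<zeta>(2) bump'_bounds(1) by simp
  qed
  have "(LINT x|?M. f x * w x) \<le> 0"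
    using weak_equation_truncated_test[OF p u bv Gt fm fM Xm Xint Xeq v \<zeta>b] first third
    by (simp add: w_def)
  have w0: "0 \<le> w x" and w1: "w x \<le> 1" for x
    using \<zeta>(2,3)[of x] bump_bounds[of "u x - v x"] by (auto simp: w_def mult_le_one)
  have wm[measurable]: "w \<in> borel_measurable ?M" unfolding w_def by measurable
  have wi: "integrable ?M w" by (rule integrable_unit_ball_bounded[of _ 1]) (use w0 w1 in auto)
  \<comment> \<open>Where \<open>w\<close> is nonzero, \<open>u\<close> lies above the nonnegative
    barrier, hence is positive, and the indicator equals 1. The source \<open>f\<close> is then
    bounded below by a positive constant, against the integral just found to be at most 0.\<close>
  have fw: "(m - N * \<kappa>) * w x \<le> f x * w x" if x: "x \<in> ball 0 1" for x
  proof (cases "u x > v x")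
    case True
    have "0 \<le> v x" using a c(1) by (simp add: v_def)
    then have "0 < u x" using True by simp
    then have "m - N * \<kappa> \<le> f x" using lam_bounds(1)[OF x] by (simp add: f_def)
    then show ?thesis using w0 by (intro mult_right_mono)
  next
    case False
    then show ?thesis by (simp add: w_def bump_nonpos)
  qed
  have "(m - N * \<kappa>) * (LINT x|?M. w x) = (LINT x|?M. (m - N * \<kappa>) * w x)" by simp
  also have "\<dots> \<le> (LINT x|?M. f x * w x)"
  proof (rule integral_mono)
    show "integrable ?M (\<lambda>x. (m - N * \<kappa>) * w x)" using wi by (rule integrable_mult_right)
    show "integrable ?M (\<lambda>x. f x * w x)"
    proof (rule integrable_unit_ball_bounded)
      show "(\<lambda>x. f x * w x) \<in> borel_measurable ?M" using fm wm by (rule borel_measurable_times)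
      show "norm (f x * w x) \<le> (M + N * \<kappa>) * 1" if "x \<in> ball 0 1" for x
        unfolding real_norm_def abs_mult
        using fM[OF that] w0[of x] w1[of x] abs_ge_zero[of "f x"] by (intro mult_mono) linarith+
    qed
  qed (use fw in simp)
  also have "\<dots> \<le> 0" by fact
  finally have "(LINT x|?M. w x) \<le> 0" using \<kappa>m by (simp add: mult_le_0_iff)
  moreover have "0 \<le> (LINT x|?M. w x)" using w0 by (intro Bochner_Integration.integral_nonneg)
  ultimately have "(LINT x|?M. w x) = 0" by simp
  then have AEw: "AE x in ?M. w x = 0"
    using integral_nonneg_eq_0_iff_AE[OF wi] w0 by simp
  have cuv: "continuous_on (ball 0 1) (\<lambda>x. u x - v x)"
    by (intro continuous_intros cu C1_continuous[OF v])
  \<comment> \<open>Integration yields \<open>w = 0\<close> only almost everywhere; continuity of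
    \<open>u\<close> turns the strict inequality at \<open>y\<close> into a ball of positive measure
    where \<open>w\<close> is positive.\<close>
  have "open (ball 0 1 \<inter> (\<lambda>x. u x - v x) -` {0<..})"
    by (rule continuous_open_preimage[OF cuv]) auto
  then have opn: "open (ball 0 1 \<inter> (\<lambda>x. u x - v x) -` {0<..} \<inter> ball y (r / 2))" by (rule open_Int) simp
  have "v y = a" using q by (simp add: v_def)
  then have "y \<in> ball 0 1 \<inter> (\<lambda>x. u x - v x) -` {0<..} \<inter> ball y (r / 2)" using uy yb r(1) by simp
  then obtain s where s: "0 < s" "ball y s \<subseteq> ball 0 1 \<inter> (\<lambda>x. u x - v x) -` {0<..} \<inter> ball y (r / 2)"
    using opn openE by meson
  have "0 < w x" if "x \<in> ball y s" for x
  proof -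
    have x: "x \<in> ball 0 1 \<inter> (\<lambda>x. u x - v x) -` {0<..} \<inter> ball y (r / 2)" using s(2) that by blast
    then have "\<zeta> x = 1" by (intro \<zeta>(4)) simp
    then show ?thesis using x bump_pos[of "u x - v x"] by (simp add: w_def)
  qed
  then have "AE x in ?M. x \<notin> ball y s" using AEw by (rule_tac AE_mp[OF AEw]) (intro AE_I2, force)
  then have "AE x in lebesgue. x \<in> ball 0 1 \<longrightarrow> x \<notin> ball y s"
    by (subst (asm) AE_restrict_space_iff) auto
  then have "AE x in lebesgue. x \<notin> ball y s"
    by (rule AE_mp) (use s(2) in \<open>intro AE_I2, blast\<close>)
  then have "ball y s \<in> null_sets lebesgue" by (subst AE_iff_null_sets) auto
  then have "measure lebesgue (ball y s) = 0" by (rule measure_eq_0_null_sets)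
  then show False using content_ball_pos[OF s(1), of y] by simp
qed

section \<open>Non-degeneracy and the density estimate\<close>

lemma weak_solution_p_flux:
  assumes "weak_solution p \<Omega> lam g u"
  obtains Du where "W1p p \<Omega> u Du"
    "\<And>\<phi>. \<phi> \<in> C1_0 \<Omega> \<Longrightarrow> (LINT x|lebesgue_on \<Omega>. p_flux p (Du x) \<bullet> gradient \<phi> x)
      = - (LINT x|lebesgue_on \<Omega>. lam x * indicat_real {y. u y > 0} x * \<phi> x)"
  using assms unfolding weak_solution_def p_flux_def by blast

lemma conjugate_exponent_tendsto_1:
  assumes "filterlim p at_top F"
  shows "((\<lambda>k. p k / (p k - 1)) \<longlongrightarrow> (1::real)) F"
proof -
  have "filterlim (\<lambda>k. p k - 1) at_top F"
    using filterlim_tendsto_add_at_top[OF tendsto_const[of "-1"] assms] by simp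
  then have "((\<lambda>k. inverse (p k - 1)) \<longlongrightarrow> 0) F"
    by (rule tendsto_inverse_0_at_top)
  then have "((\<lambda>k. 1 + inverse (p k - 1)) \<longlongrightarrow> 1 + 0) F" by (intro tendsto_intros)
  moreover have "\<forall>\<^sub>F k in F. 1 + inverse (p k - 1) = p k / (p k - 1)"
    using filterlim_at_top_dense[THEN iffD1, OF assms, rule_format, of 1]
    by eventually_elim (simp add: field_simps)
  ultimately show ?thesis using Lim_transform_eventually by fastforce
qed

text \<open>If \<open>v\<close> stayed below r/8, the barrier with c = 1/2 would dominate
  \<open>u k\<close> on the outer half of the ball, since its values there are nearly r/4 or more.
  Comparison at the centre would then make \<open>u k y\<close> too small for its limit.\<close>

lemma limit_nondegeneracy:
  fixes u :: "nat \<Rightarrow> 'a::euclidean_space \<Rightarrow> real"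
  assumes lam: "lam \<in> borel_measurable unit_ball_lebesgue"
    "\<And>x. x \<in> ball 0 1 \<Longrightarrow> m \<le> lam x" "\<And>x. x \<in> ball 0 1 \<Longrightarrow> lam x \<le> M" "0 < m"
    and Gt: "L-lipschitz_on UNIV Gt" "\<And>x. x \<in> sphere 0 1 \<Longrightarrow> Gt x = g x"
    and p: "filterlim p at_top sequentially" "\<And>k. 1 < p k"
    and u: "\<And>k. weak_solution (p k) (ball 0 1) lam g (u k)"
    and lim: "uniform_limit (ball 0 1) u v sequentially"
    and y: "0 < v y" and r: "0 < r" "ball y r \<subseteq> ball 0 1"
  shows "\<exists>z\<in>ball y r. r / 8 \<le> v z"
proof (rule ccontr)
  assume "\<not> (\<exists>z\<in>ball y r. r / 8 \<le> v z)"
  then have small: "v z < r / 8" if "z \<in> ball y r" for z using that by force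
  define q where "q k = p k / (p k - 1)" for k
  have limq: "q \<longlonglongrightarrow> 1" unfolding q_def by (rule conjugate_exponent_tendsto_1[OF p(1)])
  \<comment> \<open>With error r/16 the upper bound r/8 becomes 3r/16, still below r/4. With error
    v(y)/4 the value \<open>u k y\<close> exceeds 3v(y)/4, contradicting the bound v(y)/4 from
    comparison.\<close>
  define e where "e = min (v y / 4) (r / 16)"
  have e: "0 < e" "e \<le> v y / 4" "e \<le> r / 16" using y r(1) by (auto simp: e_def)
  have ev1: "\<forall>\<^sub>F k in sequentially. \<forall>z\<in>ball 0 1. dist (u k z) (v z) < e"
    using uniform_limitD[OF lim e(1)] .
  have "(\<lambda>k. (1 / 2) * (r / 2) powr q k) \<longlonglongrightarrow> (1 / 2) * (r / 2) powr 1"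
    using r(1) by (intro tendsto_intros limq) auto
  then have ev2: "\<forall>\<^sub>F k in sequentially. 3 * r / 16 < (1 / 2) * (r / 2) powr q k"
    by (rule order_tendstoD(1)) (use r(1) in auto)
  \<comment> \<open>Half of 3/2 is 3/4; being below 1, its powers bring the divergence of the
    barrier under the lower bound \<open>m\<close>, however small.\<close>
  have ev3: "\<forall>\<^sub>F k in sequentially. q k < 3 / 2"
    by (rule order_tendstoD(2)[OF limq]) simp
  have "filterlim (\<lambda>k. p k - 1) at_top sequentially"
    using filterlim_tendsto_add_at_top[OF tendsto_const[of "-1"] p(1)] by simp
  then have "(\<lambda>k. real DIM('a) * (3 / 4) powr (p k - 1)) \<longlonglongrightarrow> real DIM('a) * 0"
    by (intro tendsto_intros powr_tendsto_zero_at_top) auto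
  then have ev4: "\<forall>\<^sub>F k in sequentially. real DIM('a) * (3 / 4) powr (p k - 1) < m"
    by (rule order_tendstoD(2)) (use lam(4) in auto)
  obtain k where k1: "\<forall>z\<in>ball 0 1. dist (u k z) (v z) < e" and k: "3 * r / 16 < (1 / 2) * (r / 2) powr q k"
    "q k < 3 / 2" "real DIM('a) * (3 / 4) powr (p k - 1) < m"
    using eventually_happens[OF eventually_conj[OF ev1 eventually_conj[OF ev2 eventually_conj[OF ev3 ev4]]]]
    by auto
  have k1: "\<bar>u k z - v z\<bar> < e" if "z \<in> ball 0 1" for z
    using k1 that by (simp add: dist_real_def)
  obtain Du where Du: "W1p (p k) (ball 0 1) (u k) Du"
    "\<And>\<phi>. \<phi> \<in> C1_0 (ball 0 1) \<Longrightarrow> (LINT x|unit_ball_lebesgue. p_flux (p k) (Du x) \<bullet> gradient \<phi> x)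
      = - (LINT x|unit_ball_lebesgue. lam x * indicat_real {y. u k y > 0} x * \<phi> x)"
    using weak_solution_p_flux[OF u] by blast
  have q1: "1 < q k" using p(2)[of k] by (simp add: q_def)
  have "u k y \<le> v y / 4"
  proof (rule comparison_barrier[OF p(2) Du(1) _ _ Gt lam Du(2) _ _ _ r])
    show "boundary_value (p k) (ball 0 1) (u k) g" "continuous_on (ball 0 1) (u k)"
      using u[of k] by (auto simp: weak_solution_def)
    show "0 < (1 / 2 :: real)" by simp
    have "((1 / 2) * q k) powr (p k - 1) \<le> (3 / 4) powr (p k - 1)"
      using k(2) q1 p(2)[of k] by (intro powr_mono2) auto
    then have "real DIM('a) * ((1 / 2) * q k) powr (p k - 1) \<le> real DIM('a) * (3 / 4) powr (p k - 1)"
      by (intro mult_left_mono) auto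
    then show "real DIM('a) * ((1 / 2) * (p k / (p k - 1))) powr (p k - 1) < m"
      using k(3) unfolding q_def by linarith
    show "0 \<le> v y / 4" using y by simp
    fix x assume x: "x \<in> ball y r" "r / 2 \<le> dist x y"
    have "(r / 2) powr q k \<le> dist x y powr q k" using x(2) r(1) q1 by (intro powr_mono2) auto
    moreover have "\<bar>u k x - v x\<bar> < e" using x(1) r(2) by (intro k1) blast
    ultimately show "u k x \<le> 1 / 2 * dist x y powr (p k / (p k - 1)) + v y / 4"
      using small[OF x(1)] k(1) e(3) y unfolding q_def[symmetric] by linarith
  qed
  moreover have "\<bar>u k y - v y\<bar> < e"
    using r by (intro k1 subsetD[OF r(2)]) simp
  ultimately show False using e(2) y by linarith
qed

text \<open>What remains is a bound on the L^1 distance to \<open>Gt\<close> that does not depend on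
  \<open>k\<close>; uniform convergence provides it from some index on.\<close>

lemma limit_lipschitz:
  fixes u :: "nat \<Rightarrow> 'a::euclidean_space \<Rightarrow> real"
  assumes lam: "lam \<in> borel_measurable unit_ball_lebesgue"
    "\<And>x. x \<in> ball 0 1 \<Longrightarrow> m \<le> lam x" "\<And>x. x \<in> ball 0 1 \<Longrightarrow> lam x \<le> M" "0 < m"
    and Gt: "L-lipschitz_on UNIV Gt" "\<And>x. x \<in> sphere 0 1 \<Longrightarrow> Gt x = g x"
    and p: "filterlim p at_top sequentially" "\<And>k. 1 < p k"
    and u: "\<And>k. weak_solution (p k) (ball 0 1) lam g (u k)"
    and lim: "uniform_limit (ball 0 1) u v sequentially"
    and xy: "x \<in> ball 0 1" "y \<in> ball 0 1"
  shows "\<bar>v x - v y\<bar> \<le> (2 * L + 2) * dist x y"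
proof -
  let ?M = "unit_ball_lebesgue :: 'a measure"
  define V where "V = measure lebesgue (ball (0::'a) 1)"
  have L: "0 \<le> L" using Gt(1) lipschitz_on_nonneg by blast
  have M: "0 \<le> M" using lam(2)[of 0] lam(3)[of 0] lam(4) by simp
  have cu: "continuous_on (ball 0 1) (u k)" and bv: "boundary_value (p k) (ball 0 1) (u k) g" for k
    using u[of k] by (auto simp: weak_solution_def)
  have "\<forall>k. \<exists>Du. W1p (p k) (ball 0 1) (u k) Du \<and>
    (\<forall>\<phi>\<in>C1_0 (ball 0 1). (LINT x|?M. p_flux (p k) (Du x) \<bullet> gradient \<phi> x)
      = - (LINT x|?M. lam x * indicat_real {y. u k y > 0} x * \<phi> x))"
    using u by (simp add: weak_solution_def p_flux_def)
  from choice[OF this] obtain Du where Du': "\<forall>k. W1p (p k) (ball 0 1) (u k) (Du k) \<and>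
    (\<forall>\<phi>\<in>C1_0 (ball 0 1). (LINT x|?M. p_flux (p k) (Du k x) \<bullet> gradient \<phi> x)
      = - (LINT x|?M. lam x * indicat_real {y. u k y > 0} x * \<phi> x))" ..
  have Du: "\<And>k. W1p (p k) (ball 0 1) (u k) (Du k)"
    "\<And>k \<phi>. \<phi> \<in> C1_0 (ball 0 1) \<Longrightarrow> (LINT x|?M. p_flux (p k) (Du k x) \<bullet> gradient \<phi> x)
      = - (LINT x|?M. lam x * indicat_real {y. u k y > 0} x * \<phi> x)"
    using Du' by simp_all
  obtain K where K': "\<forall>k\<ge>K. \<forall>x\<in>ball 0 1. dist (u k x) (v x) < 1"
    using uniform_limitD[OF lim zero_less_one] unfolding eventually_sequentially by auto
  note K = K'[rule_format]
  have u1: "integrable ?M (u k)" for k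
  proof (rule integrable_of_powr)
    show "1 \<le> p k" using p(2)[of k] by simp
    show "u k \<in> borel_measurable ?M" "integrable ?M (\<lambda>x. norm (u k x) powr p k)"
      using Du(1)[of k] unfolding W1p_def Lp_def by blast+
  qed
  have Gt1: "integrable ?M Gt"
    by (rule integrable_unit_ball_continuous[OF lipschitz_on_continuous_on[OF Gt(1)]])
  \<comment> \<open>From index \<open>K\<close> on, all solutions are within 1 of \<open>v\<close>,
    hence within 2 of \<open>u K\<close>, whose L^1 norm is a fixed number.\<close>
  define E where "E = (LINT x|?M. \<bar>u K x - Gt x\<bar> + 2)"
  have E: "(LINT x|?M. \<bar>u k x - Gt x\<bar>) \<le> E" if "K \<le> k" for k
    unfolding E_def
  proof (rule integral_mono)
    show "integrable ?M (\<lambda>x. \<bar>u k x - Gt x\<bar>)"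
      by (intro integrable_abs Bochner_Integration.integrable_diff u1 Gt1)
    show "integrable ?M (\<lambda>x. \<bar>u K x - Gt x\<bar> + 2)"
      by (intro Bochner_Integration.integrable_add integrable_abs Bochner_Integration.integrable_diff u1 Gt1
          integrable_unit_ball_const)
    fix x assume "x \<in> space ?M"
    then have x: "x \<in> ball 0 1" by simp
    show "\<bar>u k x - Gt x\<bar> \<le> \<bar>u K x - Gt x\<bar> + 2"
      using K[OF that x] K[OF order_refl x] unfolding dist_real_def by linarith
  qed
  define D where "D = M * (E + L * V)"
  have bound: "(LINT x|?M. norm (Du k x) powr p k) \<le> 2 * (V * (2 * L) powr p k + D)" if k: "K \<le> k" for k
  proof -
    note [measurable] = lam(1)
    have [measurable]: "u k \<in> borel_measurable ?M" by (rule measurable_unit_ball_continuous[OF cu])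
    have ind: "(\<lambda>x. indicat_real {y. u k y > 0} x) = (\<lambda>x. if u k x > 0 then 1 else 0)"
      by (auto simp: indicator_def)
    have "(LINT x|?M. norm (Du k x) powr p k)
      \<le> 2 * (V * (2 * L) powr p k + M * ((LINT x|?M. \<bar>u k x - Gt x\<bar>) + L * V))"
      unfolding V_def
    proof (rule energy_inequality[OF p(2) Du(1) bv Gt _ _ Du(2)])
      show "(\<lambda>x. lam x * indicat_real {y. u k y > 0} x) \<in> borel_measurable ?M"
        unfolding ind by measurable
      show "\<bar>lam x * indicat_real {y. u k y > 0} x\<bar> \<le> M" if "x \<in> ball 0 1" for x
        using lam(2,3)[OF that] lam(4) by (auto simp: indicator_def)
    qed
    also have "\<dots> \<le> 2 * (V * (2 * L) powr p k + M * (E + L * V))"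
      using E[OF k] M by (intro mult_left_mono add_left_mono add_right_mono) auto
    finally show ?thesis by (simp add: D_def)
  qed
  show ?thesis
  \<comment> \<open>The energy bound holds only from \<open>K\<close> on, so the sequence is shifted
    by \<open>K\<close>.\<close>
  proof (rule uniform_limit_W1p_lipschitz[OF _ _ _ _ L _ _ xy])
    show "1 < p (k + K)" "W1p (p (k + K)) (ball 0 1) (u (k + K)) (Du (k + K))"
      "continuous_on (ball 0 1) (u (k + K))"
      "(LINT z|?M. norm (Du (k + K) z) powr p (k + K)) \<le> 2 * (V * (2 * L) powr p (k + K) + D)" for k
      using p(2) Du(1) cu bound by auto
    show "filterlim (\<lambda>k. p (k + K)) at_top sequentially"
      by (rule filterlim_compose[OF p(1) filterlim_add_const_nat_at_top])
    show "uniform_limit (ball 0 1) (\<lambda>k. u (k + K)) v sequentially"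
      using filterlim_compose[OF lim filterlim_add_const_nat_at_top] .
  qed
qed

theorem theorem7p1:
  fixes L :: real
  shows "\<exists>\<theta>>0. \<forall>(lam :: real^'n \<Rightarrow> real) (g :: real^'n \<Rightarrow> real) (p :: nat \<Rightarrow> real)
           (u :: nat \<Rightarrow> real^'n \<Rightarrow> real) (u_inf :: real^'n \<Rightarrow> real) (x0 :: real^'n) (\<rho> :: real).
      lam \<in> borel_measurable (lebesgue_on (ball 0 1)) \<longrightarrow>
      (\<exists>m M. 0 < m \<and> (\<forall>x\<in>ball 0 1. m \<le> lam x \<and> lam x \<le> M)) \<longrightarrow>
      L-lipschitz_on (sphere 0 1) g \<longrightarrow>
      filterlim p at_top sequentially \<longrightarrow>
      (\<forall>k. 1 < p k) \<longrightarrow>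
      (\<forall>k. weak_solution (p k) (ball 0 1) lam g (u k)) \<longrightarrow>
      uniform_limit (ball 0 1) u u_inf sequentially \<longrightarrow>
      x0 \<in> frontier {x \<in> ball 0 1. u_inf x > 0} \<inter> ball 0 (1/2) \<longrightarrow>
      0 < \<rho> \<longrightarrow> \<rho> < 1/2 \<longrightarrow>
      measure lebesgue (ball x0 \<rho> \<inter> {x \<in> ball 0 1. u_inf x > 0}) \<ge> \<theta> * \<rho> ^ CARD('n)"
proof -
  \<comment> \<open>\<open>\<theta>\<close> is fixed before the Lipschitz hypothesis is available,
    so the absolute value keeps \<open>C\<close> positive for every real \<open>L\<close>.\<close>
  define C where "C = 2 * \<bar>L\<bar> + 2"
  have C: "2 \<le> C" by (simp add: C_def)
  \<comment> \<open>The volume of a ball of radius \<rho>/(32C), divided by the power of \<rho>; 32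
    is the product of 4, from the radius \<rho>/4 used for growth, and 8, from the growth
    rate.\<close>
  define \<theta> where "\<theta> = unit_ball_vol (real CARD('n)) * (1 / (32 * C)) ^ CARD('n)"
  have "0 < \<theta>" using C by (simp add: \<theta>_def)
  moreover have "\<theta> * \<rho> ^ CARD('n) \<le> measure lebesgue (ball x0 \<rho> \<inter> {x \<in> ball 0 1. v x > 0})"
    if lam: "lam \<in> borel_measurable (lebesgue_on (ball 0 1))"
      and lam_bounds: "\<exists>m M. 0 < m \<and> (\<forall>x\<in>ball 0 1. m \<le> lam x \<and> lam x \<le> M)"
      and g: "L-lipschitz_on (sphere 0 1) g"
      and p: "filterlim p at_top sequentially" "\<forall>k. 1 < p k"
      and u: "\<forall>k. weak_solution (p k) (ball 0 1) lam g (u k)"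
      and lim: "uniform_limit (ball 0 1) u v sequentially"
      and x0: "x0 \<in> frontier {x \<in> ball 0 1. v x > 0} \<inter> ball 0 (1/2)"
      and \<rho>: "0 < \<rho>" "\<rho> < 1/2"
    for lam g v :: "real^'n \<Rightarrow> real" and p :: "nat \<Rightarrow> real" and u :: "nat \<Rightarrow> real^'n \<Rightarrow> real" and x0 \<rho>
  proof -
    let ?P = "{x \<in> ball 0 1. v x > 0}"
    obtain m M where m: "0 < m" "\<And>x. x \<in> ball 0 1 \<Longrightarrow> m \<le> lam x" "\<And>x. x \<in> ball 0 1 \<Longrightarrow> lam x \<le> M"
      using lam_bounds by blast
    have L: "0 \<le> L" using g lipschitz_on_nonneg by blast
    have "\<exists>Gt. L-lipschitz_on UNIV Gt \<and> (\<forall>x\<in>sphere 0 1. Gt x = g x)"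
      by (rule lipschitz_extension[OF g]) simp
    then obtain Gt where Gt: "L-lipschitz_on UNIV Gt" "\<And>x. x \<in> sphere 0 1 \<Longrightarrow> Gt x = g x" by blast
    have lip: "\<bar>v x - v y\<bar> \<le> C * dist x y" if "x \<in> ball 0 1" "y \<in> ball 0 1" for x y
      using limit_lipschitz[OF lam m(2,3,1) Gt p(1) p(2)[rule_format] u[rule_format] lim that] L
      by (simp add: C_def)
    have inball: "z \<in> ball 0 1" if "dist x0 z < \<rho>" for z
    proof -
      have "norm z \<le> norm x0 + dist x0 z"
        using norm_triangle_ineq2[of z x0] by (simp add: dist_norm norm_minus_commute)
      then show ?thesis using that x0 \<rho> by simp
    qed
    have "x0 \<in> closure ?P" using x0 by (simp add: frontier_def)
    \<comment> \<open>Distances add up inside \<open>ball x0 \<rho>\<close>: at most \<rho>/4 to a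
      positivity point, \<rho>/4 to a point of large value, and \<rho>/64 for the final
      ball.\<close>
    then obtain y where y: "y \<in> ?P" "dist y x0 < \<rho> / 4"
      using \<rho>(1) unfolding closure_approachable by (meson divide_pos_pos zero_less_numeral)
    have near: "dist x0 z < \<rho> / 2" if "z \<in> ball y (\<rho> / 4)" for z
      using that y(2) dist_triangle[of x0 z y] by (simp add: dist_commute)
    have sub: "ball y (\<rho> / 4) \<subseteq> ball 0 1"
    proof
      fix z assume "z \<in> ball y (\<rho> / 4)"
      then show "z \<in> ball 0 1" using near[of z] \<rho>(1) by (intro inball) simp
    qed
    have "\<exists>z\<in>ball y (\<rho> / 4). \<rho> / 4 / 8 \<le> v z"
      using limit_nondegeneracy[OF lam m(2,3,1) Gt p(1) p(2)[rule_format] u[rule_format] lim _ _ sub] y(1) \<rho>(1)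
      by simp
    then obtain z where z: "z \<in> ball y (\<rho> / 4)" "\<rho> / 32 \<le> v z" by auto
    define s where "s = \<rho> / (32 * C)"
    \<comment> \<open>Over the distance \<open>s\<close> the Lipschitz bound allows a loss strictly
      less than the value \<rho>/32 at the centre, so \<open>v\<close> remains positive on
      \<open>ball z s\<close>.\<close>
    have s: "0 < s" "s \<le> \<rho> / 64" "C * s = \<rho> / 32"
      using \<rho>(1) C by (auto simp: s_def field_simps)
    have sub2: "ball z s \<subseteq> ball x0 \<rho> \<inter> ?P"
    proof
      fix x assume x: "x \<in> ball z s"
      have "dist x0 x < \<rho>"
        using x near[OF z(1)] s(2) dist_triangle[of x0 x z] \<rho>(1) by simp
      moreover have xb: "x \<in> ball 0 1" by (rule inball) fact
      moreover have "0 < v x"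
      proof -
        have "z \<in> ball 0 1" using z(1) sub by blast
        then have "\<bar>v z - v x\<bar> \<le> C * dist z x" using xb by (rule lip)
        also have "\<dots> < C * s" using x C by (intro mult_strict_left_mono) auto
        finally show ?thesis using z(2) s(3) by linarith
      qed
      ultimately show "x \<in> ball x0 \<rho> \<inter> ?P" by simp
    qed
    have cv: "continuous_on (ball 0 1) v"
      using uniform_limit_theorem[OF _ lim] u by (simp add: weak_solution_def)
    have "open (ball 0 1 \<inter> v -` {0<..})" by (rule continuous_open_preimage[OF cv]) auto
    moreover have "ball 0 1 \<inter> v -` {0<..} = ?P" by auto
    ultimately have "open (ball x0 \<rho> \<inter> ?P)" by (simp add: open_Int)
    \<comment> \<open>\<open>measure\<close> is monotone only towards sets of finite measure that
      are measurable; openness and boundedness provide both.\<close>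
    then have lm: "ball x0 \<rho> \<inter> ?P \<in> lmeasurable"
      by (intro bounded_set_imp_lmeasurable bounded_Int) auto
    have "\<theta> * \<rho> ^ CARD('n) = measure lebesgue (ball z s)"
      using content_ball[of s z] s(1) by (simp add: \<theta>_def s_def power_divide power_mult_distrib)
    also have "\<dots> \<le> measure lebesgue (ball x0 \<rho> \<inter> ?P)"
      by (rule measure_mono_fmeasurable[OF sub2 _ lm]) simp
    finally show ?thesis .
  qed
  ultimately show ?thesis by (intro exI[of _ \<theta>]) blast
qed

end
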